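(* For $N\in\mathbb{N}=\{1,2,\dots\}$ let $Z_N$ be the subshift over $\{c,b,\alpha_1,\dots,\alpha_N\}$ consisting of all bi-infinite sequences containing none of the words $\alpha_i b^mc^k\alpha_j$ with $1\le i,j\le N$, $m,k\ge 0$, $m\neq k$. Then the subshifts $Z_N$, $N=1,2,\dots$, are pairwise not flow equivalent: if $N\ne N'$ then $Z_N$ and $Z_{N'}$ are not flow equivalent.
   Context: A subshift over a finite alphabet $\Sigma$ is a closed set $\Lambda\subset\Sigma^{\mathbb{Z}}$ with $\sigma(\Lambda)=\Lambda$, $\sigma$ the shift. Here $b^m$ denotes the symbol $b$ repeated $m$ times. Two subshifts are flow equivalent if their suspension flow spaces ($\Lambda\times\mathbb{R}$ modulo $(x,t+1)\sim(\sigma(x),t)$, with the flow induced by translation in $t$) are homeomorphic by a homeomorphism mapping flow orbits onto flow orbits and preserving the direction of the flow. *)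

theory Defs
  imports "HOL-Analysis.Analysis"
begin

definition shift_map :: "(int \<Rightarrow> 'a) \<Rightarrow> (int \<Rightarrow> 'a)" where
  "shift_map x = (\<lambda>n. x (n + 1))"

text \<open>The product of discrete topologies on all of \<open>int \<Rightarrow> 'a\<close>; it induces on the sequences over a
  finite alphabet \<open>\<Sigma>\<close> the usual topology of \<open>\<Sigma>\<^sup>\<int>\<close>.\<close>

definition seq_topology :: "(int \<Rightarrow> 'a) topology" where
  "seq_topology = product_topology (\<lambda>_. discrete_topology UNIV) UNIV"

definition full_shift :: "'a set \<Rightarrow> (int \<Rightarrow> 'a) set" where
  "full_shift \<Sigma> = {x. range x \<subseteq> \<Sigma>}"

definition subshift :: "'a set \<Rightarrow> (int \<Rightarrow> 'a) set \<Rightarrow> bool" where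
  "subshift \<Sigma> \<Lambda> \<longleftrightarrow>
     finite \<Sigma> \<and> closedin (subtopology seq_topology (full_shift \<Sigma>)) \<Lambda> \<and> shift_map ` \<Lambda> = \<Lambda>"

definition contains_word :: "(int \<Rightarrow> 'a) \<Rightarrow> 'a list \<Rightarrow> bool" where
  "contains_word x w \<longleftrightarrow> (\<exists>k. \<forall>i < length w. x (k + int i) = w ! i)"

definition avoiding_shift :: "'a set \<Rightarrow> 'a list set \<Rightarrow> (int \<Rightarrow> 'a) set" where
  "avoiding_shift \<Sigma> F = {x \<in> full_shift \<Sigma>. \<forall>w \<in> F. \<not> contains_word x w}"

text \<open>The equivalence relation generated by \<open>(x, t + 1) \<sim> (\<sigma> x, t)\<close>.  Outside \<open>\<Lambda> \<times> \<real>\<close> it is just the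
  identity, which plays no role below.\<close>

definition suspension_rel :: "(int \<Rightarrow> 'a) set \<Rightarrow> (((int \<Rightarrow> 'a) \<times> real) \<times> ((int \<Rightarrow> 'a) \<times> real)) set" where
  "suspension_rel \<Lambda> =
     (let G = {((x, t + 1), (shift_map x, t)) | x t. x \<in> \<Lambda>} in (G \<union> G\<inverse>)\<^sup>*)"

definition suspension_cover :: "(int \<Rightarrow> 'a) set \<Rightarrow> ((int \<Rightarrow> 'a) \<times> real) topology" where
  "suspension_cover \<Lambda> = prod_topology (subtopology seq_topology \<Lambda>) euclideanreal"

text \<open>The quotient topology on the set of equivalence classes.\<close>

definition suspension :: "(int \<Rightarrow> 'a) set \<Rightarrow> ((int \<Rightarrow> 'a) \<times> real) set topology" where
  "suspension \<Lambda> = topology (\<lambda>U. U \<subseteq> (\<Lambda> \<times> UNIV) // suspension_rel \<Lambda>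
                                  \<and> openin (suspension_cover \<Lambda>) (\<Union>U))"

text \<open>The flow acts on an equivalence class by translating all its representatives.\<close>

definition flow :: "real \<Rightarrow> ((int \<Rightarrow> 'a) \<times> real) set \<Rightarrow> ((int \<Rightarrow> 'a) \<times> real) set" where
  "flow s p = (\<lambda>(x, t). (x, t + s)) ` p"

definition flow_orbit :: "((int \<Rightarrow> 'a) \<times> real) set \<Rightarrow> ((int \<Rightarrow> 'a) \<times> real) set set" where
  "flow_orbit p = range (\<lambda>s. flow s p)"

definition maps_orbits_onto_orbits ::
  "(int \<Rightarrow> 'a) set \<Rightarrow> (((int \<Rightarrow> 'a) \<times> real) set \<Rightarrow> ((int \<Rightarrow> 'b) \<times> real) set) \<Rightarrow> bool" where
  "maps_orbits_onto_orbits \<Lambda> h \<longleftrightarrow>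
     (\<forall>p \<in> topspace (suspension \<Lambda>). h ` flow_orbit p = flow_orbit (h p))"

text \<open>Along every orbit, \<open>h\<close> acts by an increasing continuous change of time.  On a periodic orbit
  the time change is not determined by \<open>h\<close> and one takes a lift to the real line.\<close>

definition preserves_direction ::
  "(int \<Rightarrow> 'a) set \<Rightarrow> (((int \<Rightarrow> 'a) \<times> real) set \<Rightarrow> ((int \<Rightarrow> 'b) \<times> real) set) \<Rightarrow> bool" where
  "preserves_direction \<Lambda> h \<longleftrightarrow>
     (\<forall>p \<in> topspace (suspension \<Lambda>). \<exists>\<tau> :: real \<Rightarrow> real.
        strict_mono \<tau> \<and> continuous_on UNIV \<tau> \<and> (\<forall>s. h (flow s p) = flow (\<tau> s) (h p)))"

definition flow_equivalent :: "(int \<Rightarrow> 'a) set \<Rightarrow> (int \<Rightarrow> 'b) set \<Rightarrow> bool" where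
  "flow_equivalent \<Lambda> \<Lambda>' \<longleftrightarrow>
     (\<exists>h. homeomorphic_map (suspension \<Lambda>) (suspension \<Lambda>') h
          \<and> maps_orbits_onto_orbits \<Lambda> h \<and> preserves_direction \<Lambda> h)"

datatype sym = Sym_c | Sym_b | Sym_alpha nat

definition Z_alphabet :: "nat \<Rightarrow> sym set" where
  "Z_alphabet N = {Sym_c, Sym_b} \<union> Sym_alpha ` {1..N}"

definition Z_forbidden :: "nat \<Rightarrow> sym list set" where
  "Z_forbidden N =
     {[Sym_alpha i] @ replicate m Sym_b @ replicate k Sym_c @ [Sym_alpha j] | i j m k.
        i \<in> {1..N} \<and> j \<in> {1..N} \<and> m \<noteq> k}"

definition Z :: "nat \<Rightarrow> (int \<Rightarrow> sym) set" where
  "Z N = avoiding_shift (Z_alphabet N) (Z_forbidden N)"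

lemma openin_suspension:
  "openin (suspension \<Lambda>) U \<longleftrightarrow>
     U \<subseteq> (\<Lambda> \<times> UNIV) // suspension_rel \<Lambda> \<and> openin (suspension_cover \<Lambda>) (\<Union>U)"
proof -
  let ?Q = "(\<Lambda> \<times> UNIV) // suspension_rel \<Lambda>"
  have equiv_r: "equiv UNIV (suspension_rel \<Lambda>)"
    unfolding suspension_rel_def Let_def equiv_def
    by (auto intro!: refl_rtrancl trans_rtrancl sym_rtrancl simp: sym_Un_converse)
  have disj: "A \<inter> B = {}" if "A \<in> ?Q" "B \<in> ?Q" "A \<noteq> B" for A B
  proof -
    have "A \<in> UNIV // suspension_rel \<Lambda>" "B \<in> UNIV // suspension_rel \<Lambda>"
      using that(1,2) by (auto simp: quotient_def)
    then show ?thesis using quotient_disj[OF equiv_r] that(3) by blast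
  qed
  have "istopology (\<lambda>U. U \<subseteq> ?Q \<and> openin (suspension_cover \<Lambda>) (\<Union>U))"
    unfolding istopology_def
  proof (intro conjI allI impI)
    fix S T
    assume S: "S \<subseteq> ?Q \<and> openin (suspension_cover \<Lambda>) (\<Union>S)"
      and T: "T \<subseteq> ?Q \<and> openin (suspension_cover \<Lambda>) (\<Union>T)"
    show "S \<inter> T \<subseteq> ?Q" using S by blast
    have "A = B" if "A \<in> S" "B \<in> T" "z \<in> A" "z \<in> B" for A B z
    proof (rule ccontr)
      assume "A \<noteq> B"
      then have "A \<inter> B = {}" using that S T by (intro disj) blast+
      then show False using that by blast
    qed
    then have "\<Union>(S \<inter> T) = \<Union>S \<inter> \<Union>T"
      by blast
    then show "openin (suspension_cover \<Lambda>) (\<Union>(S \<inter> T))"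
      using S T by (simp add: openin_Int)
  next
    fix K
    assume K: "\<forall>k\<in>K. k \<subseteq> ?Q \<and> openin (suspension_cover \<Lambda>) (\<Union>k)"
    then show "\<Union>K \<subseteq> ?Q" by blast
    have "\<Union>(\<Union>K) = \<Union>(Union ` K)" by blast
    moreover have "openin (suspension_cover \<Lambda>) (\<Union>(Union ` K))"
    proof (rule openin_Union)
      fix S assume "S \<in> Union ` K"
      then obtain k where "k \<in> K" "S = \<Union>k" by (rule imageE)
      with K show "openin (suspension_cover \<Lambda>) S" by simp
    qed
    ultimately show "openin (suspension_cover \<Lambda>) (\<Union>(\<Union>K))"
      by simp
  qed
  then show ?thesis by (simp add: suspension_def)
qed

lemma suspension_rel_iff:
  assumes inv: "shift_map ` \<Lambda> = \<Lambda>" and x: "x \<in> \<Lambda>"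
  shows "((x, t), (y, s)) \<in> suspension_rel \<Lambda> \<longleftrightarrow>
           (\<exists>n :: int. y = (\<lambda>k. x (k + n)) \<and> s = t - of_int n)"
proof -
  define G where "G = {((x, t + 1), (shift_map x, t)) | x (t::real). x \<in> \<Lambda>}"
  have R: "suspension_rel \<Lambda> = (G \<union> G\<inverse>)\<^sup>*"
    unfolding suspension_rel_def G_def Let_def ..
  have fwd: "(\<lambda>k. x (k + int n)) \<in> \<Lambda> \<and> ((x, t), (\<lambda>k. x (k + int n), t - real n)) \<in> (G \<union> G\<inverse>)\<^sup>*"
    if "x \<in> \<Lambda>" for n x t
  proof (induction n)
    case 0 then show ?case using that by simp
  next
    case (Suc n)
    let ?y = "\<lambda>k. x (k + int n)"
    have eq: "shift_map ?y = (\<lambda>k. x (k + int (Suc n)))"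
      by (auto simp: shift_map_def fun_eq_iff algebra_simps)
    have "((?y, (t - real (Suc n)) + 1), (shift_map ?y, t - real (Suc n))) \<in> G"
      using Suc unfolding G_def by blast
    moreover have "t - real (Suc n) + 1 = t - real n" by simp
    ultimately have "((?y, t - real n), (\<lambda>k. x (k + int (Suc n)), t - real (Suc n))) \<in> G"
      unfolding eq by metis
    then have "((x, t), (\<lambda>k. x (k + int (Suc n)), t - real (Suc n))) \<in> (G \<union> G\<inverse>)\<^sup>*"
      by (rule rtrancl_into_rtrancl[OF conjunct2[OF Suc] UnI1])
    moreover have "shift_map ?y \<in> \<Lambda>" using Suc inv by blast
    ultimately show ?case unfolding eq by blast
  qed
  have sym: "sym ((G \<union> G\<inverse>)\<^sup>*)"
    by (intro sym_rtrancl sym_Un_converse)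
  have bwd: "\<exists>y\<in>\<Lambda>. x = (\<lambda>k. y (k + int n))" if "x \<in> \<Lambda>" for n x
  proof (induction n)
    case 0 then show ?case using that by auto
  next
    case (Suc n)
    then obtain y where y: "y \<in> \<Lambda>" "x = (\<lambda>k. y (k + int n))" by blast
    obtain z where z: "z \<in> \<Lambda>" "y = shift_map z" using y inv by blast
    have "x = (\<lambda>k. z (k + int (Suc n)))"
      using y z by (auto simp: shift_map_def fun_eq_iff algebra_simps)
    then show ?case using z by blast
  qed
  show ?thesis
  proof
    assume "((x, t), (y, s)) \<in> suspension_rel \<Lambda>"
    then have "((x, t), (y, s)) \<in> (G \<union> G\<inverse>)\<^sup>*" by (simp add: R)
    then show "\<exists>n :: int. y = (\<lambda>k. x (k + n)) \<and> s = t - of_int n"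
    proof (induction "(y, s)" arbitrary: y s rule: rtrancl_induct)
      case base then show ?case by (intro exI[of _ 0]) auto
    next
      case (step q)
      obtain y' s' where q: "q = (y', s')" by (cases q)
      obtain n where n: "y' = (\<lambda>k. x (k + n))" "s' = t - of_int n"
        using step(3)[OF q] by blast
      from step(2) show ?case
      proof
        assume "(q, (y, s)) \<in> G"
        then have "y = shift_map y'" "s' = s + 1" by (auto simp: G_def q)
        then show ?thesis using n
          by (intro exI[of _ "n + 1"]) (auto simp: shift_map_def fun_eq_iff algebra_simps)
      next
        assume "(q, (y, s)) \<in> G\<inverse>"
        then have *: "y' = shift_map y" "s = s' + 1" by (auto simp: G_def q)
        have "y k = x (k + (n - 1))" for k
        proof -
          have "y k = shift_map y (k - 1)" by (simp add: shift_map_def)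
          also have "\<dots> = x ((k - 1) + n)" using fun_cong[OF trans[OF *(1)[symmetric] n(1)]] .
          finally show ?thesis by (simp add: algebra_simps)
        qed
        then show ?thesis using n *
          by (intro exI[of _ "n - 1"]) (auto simp: fun_eq_iff)
      qed
    qed
  next
    assume "\<exists>n :: int. y = (\<lambda>k. x (k + n)) \<and> s = t - of_int n"
    then obtain n :: int where n: "y = (\<lambda>k. x (k + n))" "s = t - of_int n" by blast
    show "((x, t), (y, s)) \<in> suspension_rel \<Lambda>"
    proof (cases "n \<ge> 0")
      case True
      then obtain m where m: "n = int m" by (rule nonneg_int_cases)
      then show ?thesis using fwd[OF x, of m t] n by (simp add: R)
    next
      case False
      then have "n \<le> 0" by simp
      then obtain m where m: "n = - int m" by (rule nonpos_int_cases)
      obtain z where z: "z \<in> \<Lambda>" "x = (\<lambda>k. z (k + int m))" using bwd[OF x] by blast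
      have "y = z" using n m z by auto
      then have "((y, s), (x, t)) \<in> (G \<union> G\<inverse>)\<^sup>*"
        using fwd[OF z(1), of m s] z n m by simp
      then show ?thesis using sym unfolding R by (meson symD)
    qed
  qed
qed

lemma suspension_class_subset:
  assumes inv: "shift_map ` \<Lambda> = \<Lambda>" and p: "p \<in> \<Lambda> \<times> UNIV"
  shows "suspension_rel \<Lambda> `` {p} \<subseteq> \<Lambda> \<times> UNIV"
proof
  fix q assume "q \<in> suspension_rel \<Lambda> `` {p}"
  then have "(p, q) \<in> ({((x, t + 1), (shift_map x, t :: real)) | x t. x \<in> \<Lambda>}
      \<union> {((x, t + 1), (shift_map x, t)) | x t. x \<in> \<Lambda>}\<inverse>)\<^sup>*"
    by (simp add: suspension_rel_def Let_def)
  then show "q \<in> \<Lambda> \<times> UNIV"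
    by (induction rule: rtrancl_induct) (use p inv in auto)
qed

lemma topspace_suspension_cover: "topspace (suspension_cover \<Lambda>) = \<Lambda> \<times> UNIV"
  by (simp add: suspension_cover_def seq_topology_def)

lemma topspace_suspension:
  assumes inv: "shift_map ` \<Lambda> = \<Lambda>"
  shows "topspace (suspension \<Lambda>) = (\<Lambda> \<times> UNIV) // suspension_rel \<Lambda>"
proof -
  have "p \<in> suspension_rel \<Lambda> `` {p}" for p
    by (simp add: suspension_rel_def Let_def)
  then have "\<Union>((\<Lambda> \<times> UNIV) // suspension_rel \<Lambda>) = \<Lambda> \<times> UNIV"
    using suspension_class_subset[OF inv] unfolding quotient_def by blast
  then have "openin (suspension \<Lambda>) ((\<Lambda> \<times> UNIV) // suspension_rel \<Lambda>)"
    by (metis openin_suspension openin_topspace order_refl topspace_suspension_cover)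
  then show ?thesis
    using openin_subset openin_suspension[of \<Lambda> "topspace (suspension \<Lambda>)"] by blast
qed

lemma quotient_map_suspension:
  assumes inv: "shift_map ` \<Lambda> = \<Lambda>"
  shows "quotient_map (suspension_cover \<Lambda>) (suspension \<Lambda>) (\<lambda>p. suspension_rel \<Lambda> `` {p})"
proof -
  let ?r = "suspension_rel \<Lambda>" and ?Q = "(\<Lambda> \<times> UNIV) // suspension_rel \<Lambda>"
  have equiv_r: "equiv UNIV ?r"
    unfolding suspension_rel_def Let_def equiv_def
    by (auto intro!: refl_rtrancl trans_rtrancl sym_rtrancl simp: sym_Un_converse)
  have self: "p \<in> ?r `` {p}" for p
    by (simp add: suspension_rel_def Let_def)
  have preimage: "{p \<in> \<Lambda> \<times> UNIV. ?r `` {p} \<in> U} = \<Union>U" if U: "U \<subseteq> ?Q" for U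
  proof
    show "{p \<in> \<Lambda> \<times> UNIV. ?r `` {p} \<in> U} \<subseteq> \<Union>U" using self by blast
    show "\<Union>U \<subseteq> {p \<in> \<Lambda> \<times> UNIV. ?r `` {p} \<in> U}"
    proof
      fix q assume "q \<in> \<Union>U"
      then obtain A where A: "A \<in> U" "q \<in> A" by blast
      with U obtain p where p: "p \<in> \<Lambda> \<times> UNIV" "A = ?r `` {p}" unfolding quotient_def by blast
      have "q \<in> \<Lambda> \<times> UNIV" using suspension_class_subset[OF inv p(1)] A p by blast
      moreover have "?r `` {q} = A" using A p equiv_class_eq[OF equiv_r, of p q] by blast
      ultimately show "q \<in> {p \<in> \<Lambda> \<times> UNIV. ?r `` {p} \<in> U}" using A by simp
    qed
  qed
  show ?thesis
    unfolding quotient_map_def topspace_suspension[OF inv] topspace_suspension_cover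
  proof (intro conjI allI impI)
    show "(\<lambda>p. ?r `` {p}) ` (\<Lambda> \<times> UNIV) = ?Q" unfolding quotient_def by blast
  next
    fix U assume "U \<subseteq> ?Q"
    then show "openin (suspension_cover \<Lambda>) {p \<in> \<Lambda> \<times> UNIV. ?r `` {p} \<in> U} = openin (suspension \<Lambda>) U"
      using preimage[of U] by (simp add: openin_suspension)
  qed
qed

lemma flow_class:
  assumes inv: "shift_map ` \<Lambda> = \<Lambda>" and x: "x \<in> \<Lambda>"
  shows "flow s (suspension_rel \<Lambda> `` {(x, t)}) = suspension_rel \<Lambda> `` {(x, t + s)}"
proof (rule set_eqI)
  fix q :: "(int \<Rightarrow> 'a) \<times> real"
  obtain y u where q: "q = (y, u)" by (cases q)
  have "q \<in> flow s (suspension_rel \<Lambda> `` {(x, t)}) \<longleftrightarrow> ((x, t), (y, u - s)) \<in> suspension_rel \<Lambda>"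
    unfolding flow_def q by (force simp: image_iff)
  also have "\<dots> \<longleftrightarrow> ((x, t + s), (y, u)) \<in> suspension_rel \<Lambda>"
    unfolding suspension_rel_iff[OF inv x] by (simp add: algebra_simps)
  finally show "q \<in> flow s (suspension_rel \<Lambda> `` {(x, t)})
      \<longleftrightarrow> q \<in> suspension_rel \<Lambda> `` {(x, t + s)}"
    by (simp add: q)
qed

lemma subshift_avoiding_shift:
  assumes "finite \<Sigma>"
  shows "subshift \<Sigma> (avoiding_shift \<Sigma> F)"
proof -
  have top: "topspace seq_topology = (UNIV :: (int \<Rightarrow> 'a) set)"
    by (simp add: seq_topology_def)
  have cont: "continuous_map seq_topology (discrete_topology UNIV) (\<lambda>x :: int \<Rightarrow> 'a. x n)" for n
    unfolding seq_topology_def by (rule continuous_map_product_projection) simp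
  have cyl: "openin seq_topology {x :: int \<Rightarrow> 'a. x n = a}" for n a
    using openin_continuous_map_preimage[OF cont[of n], of "{a}"] by (simp add: top)
  have word: "openin seq_topology {x :: int \<Rightarrow> 'a. contains_word x w}" for w
  proof -
    have "openin seq_topology {x :: int \<Rightarrow> 'a. \<forall>i < l. x (k + int i) = w ! i}" for k l
    proof (induction l)
      case 0 show ?case using openin_topspace[of "seq_topology :: (int \<Rightarrow> 'a) topology"] unfolding top by simp
    next
      case (Suc l)
      have "{x :: int \<Rightarrow> 'a. \<forall>i < Suc l. x (k + int i) = w ! i} =
              {x. \<forall>i < l. x (k + int i) = w ! i} \<inter> {x. x (k + int l) = w ! l}"
        by (auto simp: less_Suc_eq)
      then show ?case using Suc cyl by (simp add: openin_Int)
    qed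
    moreover have "{x :: int \<Rightarrow> 'a. contains_word x w} =
        (\<Union>k. {x. \<forall>i < length w. x (k + int i) = w ! i})"
      by (auto simp: contains_word_def)
    ultimately show ?thesis by (auto intro: openin_Union)
  qed
  have "openin seq_topology (\<Union>w\<in>F. {x :: int \<Rightarrow> 'a. contains_word x w})"
    using word by (auto intro: openin_Union)
  then have "closedin seq_topology (UNIV - (\<Union>w\<in>F. {x :: int \<Rightarrow> 'a. contains_word x w}))"
    by (metis closedin_diff closedin_topspace top)
  moreover have "avoiding_shift \<Sigma> F =
      (UNIV - (\<Union>w\<in>F. {x. contains_word x w})) \<inter> full_shift \<Sigma>"
    by (auto simp: avoiding_shift_def)
  ultimately have cl: "closedin (subtopology seq_topology (full_shift \<Sigma>)) (avoiding_shift \<Sigma> F)"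
    unfolding closedin_subtopology by blast
  have cw: "contains_word (\<lambda>k. x (k + n)) w \<longleftrightarrow> contains_word x w" for x :: "int \<Rightarrow> 'a" and n w
  proof
    assume "contains_word (\<lambda>k. x (k + n)) w"
    then obtain k where "\<forall>i < length w. x (k + int i + n) = w ! i"
      by (auto simp: contains_word_def)
    then show "contains_word x w" unfolding contains_word_def
      by (intro exI[of _ "k + n"]) (simp add: algebra_simps)
  next
    assume "contains_word x w"
    then obtain k where "\<forall>i < length w. x (k + int i) = w ! i"
      by (auto simp: contains_word_def)
    then show "contains_word (\<lambda>k. x (k + n)) w" unfolding contains_word_def
      by (intro exI[of _ "k - n"]) (simp add: algebra_simps)
  qed
  have tr: "(\<lambda>k. x (k + n)) \<in> avoiding_shift \<Sigma> F" if "x \<in> avoiding_shift \<Sigma> F" for x n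
    using that cw[of x n] by (auto simp: avoiding_shift_def full_shift_def)
  have "shift_map ` avoiding_shift \<Sigma> F = avoiding_shift \<Sigma> F"
  proof
    show "shift_map ` avoiding_shift \<Sigma> F \<subseteq> avoiding_shift \<Sigma> F"
      using tr[of _ 1] by (auto simp: shift_map_def)
    show "avoiding_shift \<Sigma> F \<subseteq> shift_map ` avoiding_shift \<Sigma> F"
    proof
      fix x assume "x \<in> avoiding_shift \<Sigma> F"
      then have "(\<lambda>k. x (k + - 1)) \<in> avoiding_shift \<Sigma> F" by (rule tr)
      moreover have "x = shift_map (\<lambda>k. x (k + - 1))" by (simp add: shift_map_def)
      ultimately show "x \<in> shift_map ` avoiding_shift \<Sigma> F" by blast
    qed
  qed
  then show ?thesis using assms cl by (simp add: subshift_def)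
qed

lemma subshift_Z: "subshift (Z_alphabet N) (Z N)"
  unfolding Z_def by (rule subshift_avoiding_shift) (simp add: Z_alphabet_def)

end

theory Submission imports Defs begin

text \<open>
  The invariant is the number of measures on unstable leaves with values in the group of \<open>M\<close>-th roots
  of unity. Fix a point \<open>z\<close> whose left tail is not periodic. The points with the left tail of \<open>z\<close>
  (one unstable leaf) have cylinders \<open>{y. y i = x i for i < n}\<close>, and a measure assigns to
  a cylinder a value depending only on the set of right tails of its points, multiplicatively with
  respect to the partition of a cylinder into cylinders of the next level. A flow equivalence carries
  the leaf of \<open>z\<close> homeomorphically to a leaf of the other subshift and intertwines the holonomies
  (replacing the past of a point by another past with the same right tails), so it transports these measures.

  In \<open>Z\<^sub>N\<close> the set of right tails is given by a countable automaton with states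
  \<open>\<alpha>b\<^sup>m\<close>, \<open>\<alpha>b\<^sup>j\<^sup>+\<^sup>kc\<^sup>k\<close>, \<open>\<alpha>b\<^sup>mc\<^sup>k\<close> with \<open>k > m\<close>, and a state in which everything is allowed.
  The equations force the value \<open>1\<close> on the last state, an arbitrary \<open>d\<close> on the states containing \<open>c\<close>,
  and \<open>a / d\<^sup>m\<close> on \<open>\<alpha>b\<^sup>m\<close>, where the value \<open>a\<close> on \<open>\<alpha>\<close> satisfies only \<open>a\<^sup>N = 1\<close>. (The associated Bowen-Franks
  type group is \<open>\<int> \<oplus> \<int>/N\<close>.) Hence there are \<open>M\<^sup>2\<close> measures for \<open>N = M\<close> and at most \<open>NM\<close> for \<open>N < M\<close>.
\<close>

subsection \<open>Uniform continuity on suspensions\<close>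

text \<open>A flow equivalence does not respect the integer grid. Time is changed by an arbitrary
  increasing homeomorphism, so a cylinder is carried only to a finite union of cylinders, of levels
  unrelated to its own, and a holonomy becomes one whose integer shift is only locally constant.
  This is why measures are evaluated on all compact open subsets of a leaf, and why two values are
  compared by cutting a set into pieces on which the shift is constant. Integer shifts are recovered
  from real times with the margin 1/4: up to four errors below 1/4 still determine the integer. The
  measures live on follower sets, which are intrinsic to the subshift, because infinitely many of
  them occur and no finite graph is available. A finite value group makes the set of measures
  finite. Transport is shown to be injective in one direction, which gives an inequality of
  cardinalities; the inverse equivalence gives the other one.\<close>

definition agree :: "nat \<Rightarrow> (int \<Rightarrow> 'a) \<Rightarrow> (int \<Rightarrow> 'a) \<Rightarrow> bool" where
  "agree L x y \<longleftrightarrow> (\<forall>i. \<bar>i\<bar> \<le> int L \<longrightarrow> x i = y i)"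

definition translate :: "int \<Rightarrow> (int \<Rightarrow> 'a) \<Rightarrow> int \<Rightarrow> 'a" where
  "translate n x = (\<lambda>k. x (k + n))"

definition pt :: "(int \<Rightarrow> 'a) set \<Rightarrow> (int \<Rightarrow> 'a) \<Rightarrow> real \<Rightarrow> ((int \<Rightarrow> 'a) \<times> real) set" where
  "pt X x t = suspension_rel X `` {(x, t)}"

lemma translate_translate: "translate m (translate n x) = translate (m + n) x"
  by (simp add: translate_def algebra_simps)

lemma translate_0: "translate 0 x = x"
  by (simp add: translate_def)

lemma openin_window:
  assumes "finite J"
  shows "openin seq_topology {y. \<forall>j\<in>J. y j = x j}"
proof -
  have "{y. \<forall>j\<in>J. y j = x j} = (\<Pi>\<^sub>E j\<in>UNIV. if j \<in> J then {x j} else UNIV)"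
    by (auto simp: PiE_iff split: if_splits)
  moreover have "openin seq_topology (\<Pi>\<^sub>E j\<in>UNIV. if j \<in> J then {x j} else UNIV)"
    unfolding seq_topology_def using assms
    by (auto simp: openin_PiE_gen intro: finite_subset[of _ J])
  ultimately show ?thesis by simp
qed

lemma openin_agree: "openin seq_topology {y. agree L (translate n y) x}"
proof -
  have "{y. agree L (translate n y) x} = {y. \<forall>j\<in>{n - int L..n + int L}. y j = translate (-n) x j}"
  proof -
    have "(\<forall>i. \<bar>i\<bar> \<le> int L \<longrightarrow> y (i + n) = x i) \<longleftrightarrow> (\<forall>j\<in>{n - int L..n + int L}. y j = x (j - n))" for y
    proof (intro iffI allI impI ballI)
      fix j assume "\<forall>i. \<bar>i\<bar> \<le> int L \<longrightarrow> y (i + n) = x i" "j \<in> {n - int L..n + int L}"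
      then show "y j = x (j - n)" by (auto dest: spec[of _ "j - n"])
    next
      fix i assume "\<forall>j\<in>{n - int L..n + int L}. y j = x (j - n)" "\<bar>i\<bar> \<le> int L"
      moreover have "i + n \<in> {n - int L..n + int L}" using \<open>\<bar>i\<bar> \<le> int L\<close> by auto
      ultimately show "y (i + n) = x i" by force
    qed
    then show ?thesis by (simp add: agree_def translate_def)
  qed
  then show ?thesis using openin_window[of "{n - int L..n + int L}" "translate (-n) x"] by simp
qed

lemma openin_seq_agree:
  assumes "openin seq_topology U" "x \<in> U"
  obtains L where "\<And>y. agree L x y \<Longrightarrow> y \<in> U"
proof -
  obtain V where V: "finite {i. V i \<noteq> UNIV}" "x \<in> PiE UNIV V" "PiE UNIV V \<subseteq> U"
    using assms unfolding seq_topology_def openin_product_topology_alt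
    by (force simp: Let_def)
  define L where "L = nat (Max (insert 0 (abs ` {i. V i \<noteq> UNIV})))"
  have L: "\<bar>i\<bar> \<le> int L" if "V i \<noteq> UNIV" for i
  proof -
    have "\<bar>i\<bar> \<le> Max (insert 0 (abs ` {i. V i \<noteq> UNIV}))"
      using V(1) that by (intro Max_ge) auto
    then show ?thesis unfolding L_def by linarith
  qed
  have "y \<in> U" if "agree L x y" for y
  proof -
    have "y i \<in> V i" for i
    proof (cases "V i = UNIV")
      case False
      then have "y i = x i" using L that by (auto simp: agree_def)
      then show ?thesis using V(2) by (auto simp: PiE_iff)
    qed simp
    then show ?thesis using V(3) by (auto simp: PiE_iff)
  qed
  then show ?thesis using that by blast
qed

locale subshift_space =
  fixes \<Sigma> :: "'a set" and X :: "(int \<Rightarrow> 'a) set"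
  assumes subshift: "subshift \<Sigma> X"
begin

lemma shift_image: "shift_map ` X = X"
  using subshift by (simp add: subshift_def)

lemma finite_alphabet: "finite \<Sigma>"
  using subshift by (simp add: subshift_def)

lemma symbol: "x \<in> X \<Longrightarrow> x i \<in> \<Sigma>"
  using subshift closedin_subset[of "subtopology seq_topology (full_shift \<Sigma>)" X]
  by (force simp: subshift_def full_shift_def)

lemma compactin: "compactin seq_topology X"
proof -
  have "full_shift \<Sigma> = (\<Pi>\<^sub>E j\<in>UNIV. \<Sigma>)"
    by (auto simp: full_shift_def PiE_iff)
  then have "compactin seq_topology (full_shift \<Sigma>)"
    using finite_alphabet by (simp add: seq_topology_def compactin_PiE compactin_discrete_topology)
  then have "compact_space (subtopology seq_topology (full_shift \<Sigma>))"
    by (simp add: compact_space_subtopology)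
  then have "compactin (subtopology seq_topology (full_shift \<Sigma>)) X"
    using subshift closedin_compact_space by (auto simp: subshift_def)
  then show ?thesis by (simp add: compactin_subtopology)
qed

lemma translate_iff: "translate n x \<in> X \<longleftrightarrow> x \<in> X"
proof -
  have up: "translate 1 x \<in> X" if "x \<in> X" for x
    using that shift_image by (auto simp: translate_def shift_map_def)
  have down: "translate (-1) x \<in> X" if "x \<in> X" for x
  proof -
    have "x \<in> shift_map ` X" using that by (simp only: shift_image)
    then obtain y where "y \<in> X" "x = translate 1 y"
      by (auto simp only: image_iff translate_def shift_map_def)
    then show ?thesis by (simp add: translate_translate translate_0)
  qed
  have all: "translate n x \<in> X" if "x \<in> X" for x and n :: int
  proof (induction n rule: int_induct[of _ 0])
    case base then show ?case using that by (simp add: translate_0)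
  next
    case (step1 i)
    then show ?case using up[of "translate i x"] by (simp add: translate_translate add.commute)
  next
    case (step2 i)
    then show ?case using down[of "translate i x"] by (simp add: translate_translate)
  qed
  show ?thesis using all[of x n] all[of "translate n x" "-n"] by (auto simp: translate_translate translate_0)
qed

lemma equiv_suspension_rel: "equiv UNIV (suspension_rel X)"
  unfolding suspension_rel_def Let_def equiv_def
  by (auto intro!: refl_rtrancl trans_rtrancl sym_rtrancl simp: sym_Un_converse)

lemma pt_eq_iff:
  assumes "x \<in> X"
  shows "pt X x t = pt X y s \<longleftrightarrow> (\<exists>n. y = translate n x \<and> s = t - of_int n)"
  unfolding pt_def translate_def suspension_rel_iff[OF shift_image assms, symmetric]
  using eq_equiv_class_iff[OF equiv_suspension_rel] by simp

lemma pt_translate: "x \<in> X \<Longrightarrow> pt X (translate n x) (t - of_int n) = pt X x t"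
  by (subst eq_commute) (auto simp: pt_eq_iff)

lemma topspace_eq: "topspace (suspension X) = {pt X x t | x t. x \<in> X}"
  unfolding topspace_suspension[OF shift_image] quotient_def pt_def by auto

lemma flow_pt: "x \<in> X \<Longrightarrow> flow s (pt X x t) = pt X x (t + s)"
  unfolding pt_def by (rule flow_class[OF shift_image])

lemma continuous_pt: "continuous_map (suspension_cover X) (suspension X) (\<lambda>p. pt X (fst p) (snd p))"
  using quotient_imp_continuous_map[OF quotient_map_suspension[OF shift_image]]
  by (simp add: pt_def)

lemma mem_pt: "x \<in> X \<Longrightarrow> (y, s) \<in> pt X x t \<longleftrightarrow> (\<exists>n. y = translate n x \<and> s = t - of_int n)"
  unfolding pt_def translate_def by (simp add: suspension_rel_iff[OF shift_image])

text \<open>The union of these classes is a union over all integers of translated product boxes,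
  each of which is open, and openness in the suspension is openness of that union.\<close>

lemma openin_nbhd:
  shows "openin (suspension X) {pt X y s | y s. y \<in> X \<and> agree L y x \<and> \<bar>s - t\<bar> < e}"
    (is "openin _ ?U")
  unfolding openin_suspension
proof
  show "?U \<subseteq> (X \<times> UNIV) // suspension_rel X"
    unfolding quotient_def pt_def by auto
  let ?W = "\<lambda>n :: int. ({y. agree L (translate n y) x} \<inter> X) \<times> {t + of_int n - e <..< t + of_int n + e}"
  have "\<Union>?U = (\<Union>n. ?W n)"
  proof (intro equalityI subsetI)
    fix q assume "q \<in> \<Union>?U"
    then obtain y s where "y \<in> X" "agree L y x" "\<bar>s - t\<bar> < e" "q \<in> pt X y s" by blast
    moreover then obtain n where "fst q = translate n y" "snd q = s - of_int n"
      using mem_pt[of y "fst q" "snd q" s] by auto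
    ultimately have "q \<in> ?W (-n)"
      by (cases q) (auto simp: translate_translate translate_0 translate_iff)
    then show "q \<in> (\<Union>n. ?W n)" by blast
  next
    fix q assume "q \<in> (\<Union>n. ?W n)"
    then obtain n where n: "q \<in> ?W n" by blast
    obtain y s where q: "q = (y, s)" by (cases q)
    have "q \<in> pt X (translate n y) (s - of_int n)"
      using n q by (auto simp: pt_translate mem_pt intro!: exI[of _ 0] simp: translate_0)
    moreover have "pt X (translate n y) (s - of_int n) \<in> ?U"
      using n q by (intro CollectI exI[of _ "translate n y"] exI[of _ "s - of_int n"]) (auto simp: translate_iff)
    ultimately show "q \<in> \<Union>?U" by blast
  qed
  moreover have "openin (suspension_cover X) (?W n)" for n
    unfolding suspension_cover_def openin_prod_Times_iff
    by (intro disjI2 conjI openin_subtopology_Int openin_agree) auto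
  ultimately show "openin (suspension_cover X) (\<Union>?U)" by (auto intro: openin_Union)
qed

end

text \<open>Closeness of the images of \<open>(x, t)\<close> and \<open>(y, s)\<close> in the suspension; the integer \<open>n\<close> makes the
  relation independent of the chosen representatives.\<close>

definition close :: "nat \<Rightarrow> real \<Rightarrow> (int \<Rightarrow> 'a) \<Rightarrow> real \<Rightarrow> (int \<Rightarrow> 'a) \<Rightarrow> real \<Rightarrow> bool" where
  "close L e x t y s \<longleftrightarrow>
     (\<exists>n :: int. \<bar>s - t - of_int n\<bar> < e \<and> agree L (translate \<lfloor>t\<rfloor> x) (translate (\<lfloor>t\<rfloor> + n) y))"

lemma close_translate:
  "close L e (translate m x) (t - of_int m) (translate n y) (s - of_int n) \<longleftrightarrow> close L e x t y s"
proof -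
  have ex: "(\<exists>k :: int. P k) \<longleftrightarrow> (\<exists>k. P (k + d))" for P and d :: int
    by (metis diff_add_cancel)
  show ?thesis
    unfolding close_def
    by (subst (2) ex[of _ "n - m"]) (simp add: translate_translate algebra_simps)
qed

lemma openin_suspension_coverD:
  assumes "openin (suspension_cover X) W" "(x, t) \<in> W"
  obtains L e where "e > 0" "\<And>y s. y \<in> X \<Longrightarrow> agree L x y \<Longrightarrow> \<bar>s - t\<bar> < e \<Longrightarrow> (y, s) \<in> W"
proof -
  obtain U V where UV: "openin (subtopology seq_topology X) U" "open V" "x \<in> U" "t \<in> V" "U \<times> V \<subseteq> W"
    using assms unfolding suspension_cover_def openin_prod_topology_alt by force
  then obtain U' where U': "openin seq_topology U'" "U = U' \<inter> X"
    by (auto simp: openin_subtopology)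
  with UV obtain L where L: "\<And>y. agree L x y \<Longrightarrow> y \<in> U'"
    using openin_seq_agree[of U' x] by blast
  obtain e where e: "e > 0" "\<And>s. \<bar>s - t\<bar> < e \<Longrightarrow> s \<in> V"
    using UV(2,4) unfolding open_dist dist_real_def by blast
  show ?thesis using that[of e L] L e U' UV(5) by blast
qed

text \<open>A Lebesgue number argument on the compact fundamental domain
  \<open>X \<times> {0..1}\<close>; invariance of \<open>close\<close> under change of
  representatives extends it to all times. The conclusion compares a single symbol (window 0), which
  is enough because it is applied at every time along a curve.\<close>

lemma uniformly_close:
  fixes h :: "((int \<Rightarrow> 'a) \<times> real) set \<Rightarrow> ((int \<Rightarrow> 'b) \<times> real) set"
  assumes X: "subshift_space \<Sigma> X" and X': "subshift_space \<Sigma>' X'"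
    and h: "continuous_map (suspension X) (suspension X') h" and e: "e > 0"
  obtains L \<delta> where "\<delta> > 0"
    "\<And>x y t s x' t' y' s'. x \<in> X \<Longrightarrow> y \<in> X \<Longrightarrow> x' \<in> X' \<Longrightarrow> y' \<in> X' \<Longrightarrow>
       h (pt X x t) = pt X' x' t' \<Longrightarrow> h (pt X y s) = pt X' y' s' \<Longrightarrow>
       close L \<delta> x t y s \<Longrightarrow> close 0 e x' t' y' s'"
proof -
  interpret X: subshift_space \<Sigma> X by (rule X)
  interpret X': subshift_space \<Sigma>' X' by (rule X')
  define Cl where "Cl P Q \<longleftrightarrow> (\<forall>x' t' y' s'. x' \<in> X' \<longrightarrow> y' \<in> X' \<longrightarrow> P = pt X' x' t' \<longrightarrow>
      Q = pt X' y' s' \<longrightarrow> close 0 e x' t' y' s')" for P Q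
  define e1 where "e1 = min e 1"
  have e1: "0 < e1" "e1 \<le> e" "e1 \<le> 1" using e by (auto simp: e1_def)
  \<comment> \<open>The factor 2 leaves room for the Lebesgue number: one point is taken within
    \<open>\<delta>\<close> of the centre and the other within \<open>\<delta>\<close> of the first.
    The window \<open>L\<close> needs no enlargement, since agreement on a window is
    transitive.\<close>
  have loc: "\<exists>L \<delta>. \<delta> > 0 \<and> (\<forall>y1 s1 y2 s2. y1 \<in> X \<longrightarrow> y2 \<in> X \<longrightarrow> agree L x y1 \<longrightarrow> agree L x y2 \<longrightarrow>
     \<bar>s1 - t\<bar> < 2 * \<delta> \<longrightarrow> \<bar>s2 - t\<bar> < 2 * \<delta> \<longrightarrow> Cl (h (pt X y1 s1)) (h (pt X y2 s2)))"
    if x: "x \<in> X" for x t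
  proof -
    have "h (pt X x t) \<in> topspace (suspension X')"
      using h x unfolding continuous_map_def X.topspace_eq by blast
    then obtain x0 t0 where x0: "x0 \<in> X'" "h (pt X x t) = pt X' x0 t0"
      by (auto simp: X'.topspace_eq)
    define x' where "x' = translate \<lfloor>t0\<rfloor> x0"
    define t' where "t' = t0 - of_int \<lfloor>t0\<rfloor>"
    have x': "x' \<in> X'" "h (pt X x t) = pt X' x' t'"
      using x0 by (simp_all add: x'_def t'_def X'.translate_iff X'.pt_translate)
    have t': "0 \<le> t'" "t' < 1" by (simp_all add: t'_def) linarith
    \<comment> \<open>Window radius 1 suffices: times within \<open>e1 / 2 \<le> 1/2\<close> of a
      point of [0, 1) have floor between -1 and 1, so the symbol read at such a time lies in the
      window.\<close>
    define N where "N = {pt X' y s | y s. y \<in> X' \<and> agree 1 y x' \<and> \<bar>s - t'\<bar> < e1 / 2}"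
    have "openin (suspension X') N" unfolding N_def by (rule X'.openin_nbhd)
    then have op1: "openin (suspension_cover X) {p \<in> topspace (suspension_cover X). (h \<circ> (\<lambda>p. pt X (fst p) (snd p))) p \<in> N}"
      by (rule openin_continuous_map_preimage[OF continuous_map_compose[OF X.continuous_pt h]])
    have hN: "h (pt X x t) \<in> N"
      unfolding x'(2) N_def using x'(1) e1(1)
      by (intro CollectI exI[of _ x'] exI[of _ t']) (auto simp: agree_def)
    have mem1: "(x, t) \<in> {p \<in> topspace (suspension_cover X). (h \<circ> (\<lambda>p. pt X (fst p) (snd p))) p \<in> N}"
      using x hN by (simp add: topspace_suspension_cover)
    obtain L \<delta> where "\<delta> > 0"
      "\<And>y s. y \<in> X \<Longrightarrow> agree L x y \<Longrightarrow> \<bar>s - t\<bar> < \<delta> \<Longrightarrow>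
        (y, s) \<in> {p \<in> topspace (suspension_cover X). (h \<circ> (\<lambda>p. pt X (fst p) (snd p))) p \<in> N}"
      by (rule openin_suspension_coverD[OF op1 mem1]) blast
    then have L: "\<delta> > 0" "\<And>y s. y \<in> X \<Longrightarrow> agree L x y \<Longrightarrow> \<bar>s - t\<bar> < \<delta> \<Longrightarrow> h (pt X y s) \<in> N"
      by auto
    have "Cl P Q" if PQ: "P \<in> N" "Q \<in> N" for P Q
    proof -
      obtain y1 s1 where 1: "P = pt X' y1 s1" "y1 \<in> X'" "agree 1 y1 x'" "\<bar>s1 - t'\<bar> < e1 / 2"
        using PQ(1) unfolding N_def by blast
      obtain y2 s2 where 2: "Q = pt X' y2 s2" "y2 \<in> X'" "agree 1 y2 x'" "\<bar>s2 - t'\<bar> < e1 / 2"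
        using PQ(2) unfolding N_def by blast
      have "-1 \<le> s1" "s1 < 2" using 1(4) t' e1 by linarith+
      then have "-1 \<le> \<lfloor>s1\<rfloor>" "\<lfloor>s1\<rfloor> < 2" by (simp_all add: floor_less_iff le_floor_iff)
      then have "\<bar>\<lfloor>s1\<rfloor>\<bar> \<le> int 1" by linarith
      then have "y1 \<lfloor>s1\<rfloor> = y2 \<lfloor>s1\<rfloor>" using 1(3) 2(3) unfolding agree_def by metis
      moreover have "\<bar>s2 - s1\<bar> < e" using 1(4) 2(4) e1 by linarith
      ultimately have c: "close 0 e y1 s1 y2 s2"
        unfolding close_def by (intro exI[of _ 0]) (auto simp: agree_def translate_def)
      show ?thesis unfolding Cl_def
      proof (intro allI impI)
        fix a t b s assume "a \<in> X'" "b \<in> X'" "P = pt X' a t" "Q = pt X' b s"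
        then obtain m n where "a = translate m y1" "t = s1 - of_int m" "b = translate n y2" "s = s2 - of_int n"
          using 1(1,2) 2(1,2) X'.pt_eq_iff by metis
        then show "close 0 e a t b s" using c by (simp add: close_translate)
      qed
    qed
    then show ?thesis using L by (intro exI[of _ L] exI[of _ "\<delta> / 2"]) auto
  qed
  obtain L \<delta> where L: "\<And>x t. x \<in> X \<Longrightarrow> \<delta> x t > 0"
    "\<And>x t y1 s1 y2 s2. x \<in> X \<Longrightarrow> y1 \<in> X \<Longrightarrow> y2 \<in> X \<Longrightarrow> agree (L x t) x y1 \<Longrightarrow> agree (L x t) x y2 \<Longrightarrow>
     \<bar>s1 - t\<bar> < 2 * \<delta> x t \<Longrightarrow> \<bar>s2 - t\<bar> < 2 * \<delta> x t \<Longrightarrow> Cl (h (pt X y1 s1)) (h (pt X y2 s2))"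
    using loc by metis
  define O' where "O' p = {y. agree (L (fst p) (snd p)) (translate 0 y) (fst p)} \<times>
      {snd p - \<delta> (fst p) (snd p) <..< snd p + \<delta> (fst p) (snd p)}" for p
  have op: "openin (prod_topology seq_topology euclideanreal) (O' p)" for p
    unfolding O'_def openin_prod_Times_iff by (intro disjI2 conjI openin_agree) auto
  have "compactin (prod_topology seq_topology euclideanreal) (X \<times> {0..1})"
    by (simp add: compactin_Times X.compactin)
  moreover have "X \<times> {0..1} \<subseteq> \<Union>(O' ` (X \<times> {0..1}))"
    using L(1) by (force simp: O'_def agree_def translate_def)
  ultimately obtain F where F: "finite F" "F \<subseteq> O' ` (X \<times> {0..1})" "X \<times> {0..1} \<subseteq> \<Union>F"
    using op by (auto simp: compactin_def dest!: spec[of _ "O' ` (X \<times> {0..1})"])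
  then obtain D where D: "finite D" "D \<subseteq> X \<times> {0..1}" "F = O' ` D"
    by (meson finite_subset_image)
  define L0 where "L0 = Max (insert 0 ((\<lambda>p. L (fst p) (snd p)) ` D))"
  define \<delta>0 where "\<delta>0 = Min (insert 1 ((\<lambda>p. \<delta> (fst p) (snd p)) ` D))"
  have L0: "L (fst p) (snd p) \<le> L0" if "p \<in> D" for p
    unfolding L0_def using that D(1) by (intro Max_ge) auto
  have \<delta>0: "\<delta>0 \<le> \<delta> (fst p) (snd p)" if "p \<in> D" for p
    unfolding \<delta>0_def using that D(1) by (intro Min_le) auto
  have "\<delta>0 > 0"
    unfolding \<delta>0_def using D L(1) by (subst Min_gr_iff) auto
  moreover have "close 0 e x' t' y' s'"
    if a: "x \<in> X" "y \<in> X" "x' \<in> X'" "y' \<in> X'" "h (pt X x t) = pt X' x' t'" "h (pt X y s) = pt X' y' s'"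
      "close L0 \<delta>0 x t y s" for x y t s x' t' y' s'
  proof -
    define m where "m = \<lfloor>t\<rfloor>"
    obtain n where n: "\<bar>s - t - of_int n\<bar> < \<delta>0" "agree L0 (translate m x) (translate (m + n) y)"
      using a(7) by (auto simp: close_def m_def)
    define x1 where "x1 = translate m x"
    define y1 where "y1 = translate (m + n) y"
    define t1 where "t1 = t - of_int m"
    define s1 where "s1 = s - of_int (m + n)"
    have "pt X y s = pt X y1 s1"
      unfolding y1_def s1_def using a(2) by (rule X.pt_translate[symmetric])
    then have xy: "x1 \<in> X" "y1 \<in> X" "pt X x t = pt X x1 t1" "pt X y s = pt X y1 s1" "\<bar>s1 - t1\<bar> < \<delta>0" "agree L0 x1 y1"
      using a n by (auto simp: x1_def y1_def t1_def s1_def X.pt_translate X.translate_iff)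
    have "t1 \<in> {0..1}" unfolding t1_def m_def by auto linarith
    then obtain p where p: "p \<in> D" "(x1, t1) \<in> O' p" using F(3) D(3) xy(1) by blast
    have px: "fst p \<in> X" using p(1) D(2) by auto
    have "agree (L (fst p) (snd p)) (fst p) x1"
      using p(2) by (auto simp: O'_def agree_def translate_def)
    moreover from this have "agree (L (fst p) (snd p)) (fst p) y1"
      using xy(6) L0[OF p(1)] by (auto simp: agree_def)
    moreover have t1: "\<bar>t1 - snd p\<bar> < \<delta> (fst p) (snd p)"
      using p(2) by (auto simp: O'_def)
    moreover have "\<bar>s1 - snd p\<bar> < 2 * \<delta> (fst p) (snd p)"
      using t1 xy(5) \<delta>0[OF p(1)] by linarith
    ultimately have "Cl (h (pt X x1 t1)) (h (pt X y1 s1))"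
      using L(2)[OF px xy(1,2)] by auto
    then show ?thesis using a xy unfolding Cl_def by metis
  qed
  ultimately show ?thesis using that by blast
qed

text \<open>By connectedness, two curves which stay close in the suspension do so with a constant integer lag.\<close>

lemma close_lag:
  fixes a b :: "real \<Rightarrow> real"
  assumes I: "connected I" and a: "continuous_on I a" and b: "continuous_on I b"
    and e: "e \<le> 1/4" and cl: "\<And>s. s \<in> I \<Longrightarrow> close 0 e x (a s) y (b s)"
  obtains k :: int where "\<And>s. s \<in> I \<Longrightarrow> \<bar>b s - a s - of_int k\<bar> < e"
    "\<And>s. s \<in> I \<Longrightarrow> x \<lfloor>a s\<rfloor> = y (\<lfloor>a s\<rfloor> + k)"
proof -
  obtain k where k: "\<And>s. s \<in> I \<Longrightarrow> \<bar>b s - a s - of_int (k s)\<bar> < e"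
    "\<And>s. s \<in> I \<Longrightarrow> x \<lfloor>a s\<rfloor> = y (\<lfloor>a s\<rfloor> + k s)"
  proof -
    have "\<forall>s\<in>I. \<exists>n :: int. \<bar>b s - a s - of_int n\<bar> < e \<and> x \<lfloor>a s\<rfloor> = y (\<lfloor>a s\<rfloor> + n)"
      using cl by (force simp: close_def agree_def translate_def)
    then show ?thesis using that by metis
  qed
  have img: "connected ((\<lambda>s. b s - a s) ` I)"
    by (intro connected_continuous_image I continuous_intros a b)
  have lt: False if "s \<in> I" "s' \<in> I" "k s < k s'" for s s'
  proof -
    \<comment> \<open>A jump of \<open>k\<close> would force \<open>b - a\<close> through a
      half-integer, which is not within 1/4 of any integer.\<close>
    let ?c = "of_int (k s) + 1/2 :: real"
    have "of_int (k s) + 1 \<le> (of_int (k s') :: real)" using that(3) by linarith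
    then have "b s - a s \<le> ?c" "?c \<le> b s' - a s'" using k(1)[OF that(1)] k(1)[OF that(2)] e by linarith+
    then have "?c \<in> (\<lambda>s. b s - a s) ` I"
      using img that(1,2) unfolding connected_iff_interval by blast
    then obtain r where r: "r \<in> I" "b r - a r = ?c" by auto
    then have "\<bar>of_int (k s - k r) + 1/2 :: real\<bar> < 1/4" using k(1)[of r] e by (simp add: algebra_simps)
    then have "(of_int (k r) :: real) < of_int (k s) + 1" "(of_int (k s) :: real) < of_int (k r)"
      by linarith+
    then have "(of_int (k r) :: real) < of_int (k s + 1)" "k s < k r" by simp_all
    then show False unfolding of_int_less_iff by linarith
  qed
  show ?thesis
  proof (cases "I = {}")
    case False
    then obtain s0 where "s0 \<in> I" by blast
    then have "k s = k s0" if "s \<in> I" for s using lt that by (meson linorder_neqE)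
    then show ?thesis using that[of "k s0"] k by metis
  qed (use that in auto)
qed

subsection \<open>Orbit lifts and unstable leaves\<close>

text \<open>The time change lifted to the real line, for a chosen representative \<open>x'\<close>
  of the image orbit; another representative changes \<open>a\<close> by an integer. With
  surjectivity included, \<open>inv a\<close> is a lift for the inverse map.\<close>

definition lifts :: "(int \<Rightarrow> 'a) set \<Rightarrow> (int \<Rightarrow> 'b) set \<Rightarrow>
    (((int \<Rightarrow> 'a) \<times> real) set \<Rightarrow> ((int \<Rightarrow> 'b) \<times> real) set) \<Rightarrow>
    (int \<Rightarrow> 'a) \<Rightarrow> (int \<Rightarrow> 'b) \<Rightarrow> (real \<Rightarrow> real) \<Rightarrow> bool" where
  "lifts X X' h x x' a \<longleftrightarrow> x \<in> X \<and> x' \<in> X' \<and> strict_mono a \<and> continuous_on UNIV a \<and> surj a \<and>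
     (\<forall>s. h (pt X x s) = pt X' x' (a s))"

definition left_aperiodic :: "(int \<Rightarrow> 'a) \<Rightarrow> bool" where
  "left_aperiodic z \<longleftrightarrow> (\<forall>d n. (\<forall>i<n. z i = z (i + d)) \<longrightarrow> d = 0)"

definition tail_class :: "(int \<Rightarrow> 'a) set \<Rightarrow> (int \<Rightarrow> 'a) \<Rightarrow> (int \<Rightarrow> 'a) set" where
  "tail_class X z = {y \<in> X. \<exists>n. \<forall>i<n. y i = z i}"

definition cyl :: "(int \<Rightarrow> 'a) set \<Rightarrow> int \<Rightarrow> (int \<Rightarrow> 'a) \<Rightarrow> (int \<Rightarrow> 'a) set" where
  "cyl X n x = {y \<in> X. \<forall>i<n. y i = x i}"

lemma cyl_subset_tail_class:
  assumes "x \<in> tail_class X z"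
  shows "cyl X n x \<subseteq> tail_class X z"
proof
  fix y assume y: "y \<in> cyl X n x"
  obtain m where "\<And>i. i < m \<Longrightarrow> x i = z i" using assms by (auto simp: tail_class_def)
  then have "\<forall>i<min m n. y i = z i" using y by (simp add: cyl_def)
  then show "y \<in> tail_class X z" using y unfolding tail_class_def cyl_def by blast
qed

lemma tail_classE:
  assumes "y \<in> tail_class X z" "w \<in> tail_class X z"
  obtains n where "\<And>i. i < n \<Longrightarrow> y i = z i" "\<And>i. i < n \<Longrightarrow> w i = z i"
proof -
  obtain n1 n2 where "\<And>i. i < n1 \<Longrightarrow> y i = z i" "\<And>i. i < n2 \<Longrightarrow> w i = z i"
    using assms by (auto simp: tail_class_def)
  then show ?thesis using that[of "min n1 n2"] by simp
qed

text \<open>Far to the left both points coincide with \<open>z\<close>, so a lag between them is a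
  period of the left tail of \<open>z\<close>.\<close>

lemma tail_class_lag:
  assumes "left_aperiodic z" "y \<in> tail_class X z" "w \<in> tail_class X z" "\<And>j. j \<le> n \<Longrightarrow> y j = w (j + k)"
  shows "k = 0"
proof -
  obtain m where m: "\<And>i. i < m \<Longrightarrow> y i = z i" "\<And>i. i < m \<Longrightarrow> w i = z i"
    by (rule tail_classE[OF assms(2,3)]) blast
  define r where "r = min (min m n) (m - k)"
  have "z i = z (i + k)" if "i < r" for i
    using m(1)[of i] m(2)[of "i + k"] assms(4)[of i] that by (simp add: r_def)
  then show ?thesis using assms(1) unfolding left_aperiodic_def by blast
qed

text \<open>If \<open>a\<close> gained less than \<open>\<epsilon>\<close> over half a unit of time,
  uniform continuity of \<open>g\<close> would make the times \<open>s\<close> and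
  \<open>s + 1/2\<close> on one orbit close, but 1/2 is not within 1/4 of an integer. As closeness
  already allows integer lags, periodic orbits need no separate treatment.\<close>

lemma time_increment:
  fixes h :: "((int \<Rightarrow> 'a) \<times> real) set \<Rightarrow> ((int \<Rightarrow> 'b) \<times> real) set"
  assumes X: "subshift_space \<Sigma> X" and X': "subshift_space \<Sigma>' X'"
    and g: "continuous_map (suspension X') (suspension X) g"
    and gh: "\<And>p. p \<in> topspace (suspension X) \<Longrightarrow> g (h p) = p"
  obtains \<epsilon> where "\<epsilon> > 0" "\<And>x x' a s. x \<in> X \<Longrightarrow> x' \<in> X' \<Longrightarrow> strict_mono a \<Longrightarrow>
    (\<And>s. h (pt X x s) = pt X' x' (a s)) \<Longrightarrow> a s + \<epsilon> \<le> a (s + 1/2)"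
proof -
  interpret X: subshift_space \<Sigma> X by (rule X)
  obtain L \<epsilon> where \<epsilon>: "\<epsilon> > 0" "\<And>x y t s x' t' y' s'. x \<in> X' \<Longrightarrow> y \<in> X' \<Longrightarrow> x' \<in> X \<Longrightarrow> y' \<in> X \<Longrightarrow>
       g (pt X' x t) = pt X x' t' \<Longrightarrow> g (pt X' y s) = pt X y' s' \<Longrightarrow>
       close L \<epsilon> x t y s \<Longrightarrow> close 0 (1/4) x' t' y' s'"
    by (rule uniformly_close[OF X' X g, of "1/4"]) (simp, blast)
  have "a s + \<epsilon> \<le> a (s + 1/2)"
    if x: "x \<in> X" "x' \<in> X'" "strict_mono a" "\<And>s. h (pt X x s) = pt X' x' (a s)" for x x' a s
  proof (rule ccontr)
    assume "\<not> a s + \<epsilon> \<le> a (s + 1/2)"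
    moreover have "a s < a (s + 1/2)" using x(3) by (simp add: strict_mono_def)
    ultimately have "close L \<epsilon> x' (a s) x' (a (s + 1/2))"
      unfolding close_def by (intro exI[of _ 0]) (auto simp: agree_def)
    moreover have "g (pt X' x' (a s)) = pt X x s" for s
      using gh[of "pt X x s"] x(1,4) by (auto simp: X.topspace_eq)
    ultimately have "close 0 (1/4) x s x (s + 1/2)"
      using \<epsilon>(2) x(1,2) by blast
    then obtain n :: int where "\<bar>1/2 - of_int n\<bar> < (1/4 :: real)" by (auto simp: close_def)
    then have "0 < (of_int n :: real)" "(of_int n :: real) < 1" by linarith+
    then show False by simp
  qed
  then show ?thesis using that \<epsilon>(1) by blast
qed

lemma surj_time_change:
  fixes a :: "real \<Rightarrow> real"
  assumes "continuous_on UNIV a" "\<epsilon> > 0" and inc: "\<And>s. a s + \<epsilon> \<le> a (s + 1/2)"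
  shows "surj a"
proof -
  have up: "a s + of_nat n * \<epsilon> \<le> a (s + of_nat n / 2)" for s n
  proof (induction n)
    case (Suc n)
    have "a (s + of_nat n / 2) + \<epsilon> \<le> a (s + of_nat n / 2 + 1/2)" by (rule inc)
    moreover have "s + of_nat n / 2 + 1/2 = s + of_nat (Suc n) / 2" by (simp add: field_simps)
    ultimately have "a (s + of_nat n / 2) + \<epsilon> \<le> a (s + of_nat (Suc n) / 2)" by metis
    then show ?case using Suc by (simp add: algebra_simps)
  qed simp
  have "\<exists>s. a s = y" for y
  proof -
    obtain n where n: "\<bar>y - a 0\<bar> < of_nat n * \<epsilon>" using reals_Archimedean3[OF assms(2)] by blast
    have "y \<le> a (of_nat n / 2)" "a (- of_nat n / 2) \<le> y"
      using up[of 0 n] up[of "- of_nat n / 2" n] n by auto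
    then show ?thesis
      using IVT'[of a "- of_nat n / 2" y "of_nat n / 2"] continuous_on_subset[OF assms(1)] by auto
  qed
  then show ?thesis by (metis surjI)
qed

section \<open>Lags between lifted orbits\<close>

locale suspension_homeo = X: subshift_space \<Sigma> X + X': subshift_space \<Sigma>' X'
  for \<Sigma> :: "'a set" and X and \<Sigma>' :: "'b set" and X' +
  fixes h g
  assumes cont_h: "continuous_map (suspension X) (suspension X') h"
    and cont_g: "continuous_map (suspension X') (suspension X) g"
    and gh: "p \<in> topspace (suspension X) \<Longrightarrow> g (h p) = p"
    and hg: "q \<in> topspace (suspension X') \<Longrightarrow> h (g q) = q"
begin

lemma suspension_homeo_swap: "suspension_homeo \<Sigma>' X' \<Sigma> X g h"
  by unfold_locales (use cont_h cont_g gh hg in auto)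

lemma lifts_inverse:
  assumes "lifts X X' h x x' a"
  shows "lifts X' X g x' x (inv a)"
proof -
  have a: "x \<in> X" "x' \<in> X'" "strict_mono a" "continuous_on UNIV a" "surj a"
    "\<And>s. h (pt X x s) = pt X' x' (a s)"
    using assms by (auto simp: lifts_def)
  have inj: "inj a" using a(3) by (rule strict_mono_imp_inj_on)
  have mono: "strict_mono (inv a)"
    by (rule strict_monoI) (metis a(3,5) strict_mono_less surj_f_inv_f)
  have "g (pt X' x' s) = pt X x (inv a s)" for s
    using gh[of "pt X x (inv a s)"] a by (auto simp: X.topspace_eq surj_f_inv_f)
  moreover have "continuous_on UNIV (inv a)"
  proof (rule continuous_onI_mono)
    have "range (inv a) = UNIV" using inj by (metis inj_imp_surj_inv)
    then show "open (range (inv a))" by simp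
  qed (use mono in \<open>auto simp: strict_mono_less_eq\<close>)
  moreover have "surj (inv a)" using inj by (rule inj_imp_surj_inv)
  ultimately show ?thesis using a mono by (simp add: lifts_def)
qed

lemma lifts_translate:
  assumes "lifts X X' h x x' a"
  shows "lifts X X' h x (translate k x') (\<lambda>s. a s - of_int k)"
proof -
  have a: "x \<in> X" "x' \<in> X'" "strict_mono a" "continuous_on UNIV a" "surj a"
    "\<And>s. h (pt X x s) = pt X' x' (a s)"
    using assms by (auto simp: lifts_def)
  have "surj (\<lambda>s. a s - of_int k)"
    unfolding surj_def using a(5) by (metis add_diff_cancel surj_def)
  then show ?thesis
    using a by (auto simp: lifts_def X'.translate_iff X'.pt_translate strict_mono_def
        intro!: continuous_intros)
qed

text \<open>The orbit of \<open>g (pt X' x' 0)\<close> has a lift under \<open>h\<close> whose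
  target is a translate of \<open>x'\<close>; correcting the translation and inverting the time
  change gives the lift under \<open>g\<close>.\<close>

lemma lift_g_if_lift_h:
  assumes lift_h: "\<And>x. x \<in> X \<Longrightarrow> \<exists>x' a. lifts X X' h x x' a" and x': "x' \<in> X'"
  shows "\<exists>x a. lifts X' X g x' x a"
proof -
  have p: "pt X' x' 0 \<in> topspace (suspension X')" using x' by (auto simp: X'.topspace_eq)
  then have "g (pt X' x' 0) \<in> topspace (suspension X)"
    using cont_g by (auto simp: continuous_map_def)
  then obtain x t where x: "x \<in> X" "g (pt X' x' 0) = pt X x t" by (auto simp: X.topspace_eq)
  obtain y a where y: "lifts X X' h x y a" using lift_h[OF x(1)] by blast
  have "pt X' y (a t) = pt X' x' 0" using hg[OF p] x(2) y by (simp add: lifts_def)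
  then obtain n where "x' = translate n y" using X'.pt_eq_iff y unfolding lifts_def by blast
  then show ?thesis using lifts_inverse[OF lifts_translate[OF y, of n]] by blast
qed

text \<open>Uniform continuity makes \<open>L\<close> depend on \<open>e\<close> only, not on the
  orbits or on \<open>I\<close>; half-lines for \<open>I\<close> give \<open>lag_left\<close> and
  \<open>lag_right\<close>. The bound on the times is kept beside the equality of symbols because it
  identifies the integer \<open>k\<close> later, when lags of different pairs of orbits are
  compared.\<close>

lemma lag_on:
  assumes e: "0 < e" "e \<le> 1/4"
  obtains L :: int where "\<And>x y x' y' a b d I. lifts X X' h x x' a \<Longrightarrow> lifts X X' h y y' b \<Longrightarrow>
    connected I \<Longrightarrow> (\<And>s i. s \<in> I \<Longrightarrow> \<bar>i - \<lfloor>s\<rfloor>\<bar> < L \<Longrightarrow> x i = y (i + d)) \<Longrightarrow>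
    \<exists>k :: int. (\<forall>s\<in>I. \<bar>b (s + of_int d) - a s - of_int k\<bar> < e) \<and> (\<forall>s\<in>I. x' \<lfloor>a s\<rfloor> = y' (\<lfloor>a s\<rfloor> + k))"
proof -
  obtain L \<delta> where \<delta>: "\<delta> > 0" "\<And>x y t s x' t' y' s'. x \<in> X \<Longrightarrow> y \<in> X \<Longrightarrow> x' \<in> X' \<Longrightarrow> y' \<in> X' \<Longrightarrow>
       h (pt X x t) = pt X' x' t' \<Longrightarrow> h (pt X y s) = pt X' y' s' \<Longrightarrow>
       close L \<delta> x t y s \<Longrightarrow> close 0 e x' t' y' s'"
    by (rule uniformly_close[OF X.subshift_space_axioms X'.subshift_space_axioms cont_h e(1)]) blast
  have "\<exists>k :: int. (\<forall>s\<in>I. \<bar>b (s + of_int d) - a s - of_int k\<bar> < e) \<and> (\<forall>s\<in>I. x' \<lfloor>a s\<rfloor> = y' (\<lfloor>a s\<rfloor> + k))"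
    if x: "lifts X X' h x x' a" and y: "lifts X X' h y y' b" and I: "connected I"
      and eq: "\<And>s i. s \<in> I \<Longrightarrow> \<bar>i - \<lfloor>s\<rfloor>\<bar> < int L + 1 \<Longrightarrow> x i = y (i + d)" for x y x' y' a b d I
  proof -
    have a: "continuous_on UNIV a" and b: "continuous_on UNIV b" using x y by (auto simp: lifts_def)
    have "continuous_on I a" using a by (rule continuous_on_subset) simp
    moreover have "continuous_on I (\<lambda>s. b (s + of_int d))"
      by (rule continuous_on_compose2[OF b]) (auto intro!: continuous_intros)
    moreover have "close 0 e x' (a s) y' (b (s + of_int d))" if s: "s \<in> I" for s
    proof -
      have "x (i + \<lfloor>s\<rfloor>) = y (i + (\<lfloor>s\<rfloor> + d))" if "\<bar>i\<bar> \<le> int L" for i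
        using eq[OF s, of "i + \<lfloor>s\<rfloor>"] that by (simp add: algebra_simps)
      then have "close L \<delta> x s y (s + of_int d)"
        unfolding close_def agree_def translate_def using \<delta>(1) by (intro exI[of _ d]) auto
      moreover have "x \<in> X" "y \<in> X" "x' \<in> X'" "y' \<in> X'" "h (pt X x s) = pt X' x' (a s)"
        "h (pt X y (s + of_int d)) = pt X' y' (b (s + of_int d))"
        using x y by (auto simp: lifts_def)
      ultimately show ?thesis using \<delta>(2) by blast
    qed
    ultimately obtain k where "\<And>s. s \<in> I \<Longrightarrow> \<bar>b (s + of_int d) - a s - of_int k\<bar> < e"
      "\<And>s. s \<in> I \<Longrightarrow> x' \<lfloor>a s\<rfloor> = y' (\<lfloor>a s\<rfloor> + k)"
      by (rule close_lag[OF I _ _ e(2)]) blast+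
    then show ?thesis by blast
  qed
  then show ?thesis by (rule that)
qed

lemma lag_left:
  assumes e: "0 < e" "e \<le> 1/4"
  obtains L :: int where "\<And>x y x' y' a b d n. lifts X X' h x x' a \<Longrightarrow> lifts X X' h y y' b \<Longrightarrow>
    (\<And>i. i < n \<Longrightarrow> x i = y (i + d)) \<Longrightarrow>
    \<exists>k :: int. (\<forall>s \<le> of_int (n - L). \<bar>b (s + of_int d) - a s - of_int k\<bar> < e) \<and>
      (\<forall>j. of_int j \<le> a (of_int (n - L)) \<longrightarrow> x' j = y' (j + k))"
proof -
  obtain L :: int where L: "\<And>x y x' y' a b d I. lifts X X' h x x' a \<Longrightarrow> lifts X X' h y y' b \<Longrightarrow>
    connected I \<Longrightarrow> (\<And>s i. s \<in> I \<Longrightarrow> \<bar>i - \<lfloor>s\<rfloor>\<bar> < L \<Longrightarrow> x i = y (i + d)) \<Longrightarrow>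
    \<exists>k :: int. (\<forall>s\<in>I. \<bar>b (s + of_int d) - a s - of_int k\<bar> < e) \<and> (\<forall>s\<in>I. x' \<lfloor>a s\<rfloor> = y' (\<lfloor>a s\<rfloor> + k))"
    by (rule lag_on[OF e]) blast
  have "\<exists>k :: int. (\<forall>s \<le> of_int (n - L). \<bar>b (s + of_int d) - a s - of_int k\<bar> < e) \<and>
      (\<forall>j. of_int j \<le> a (of_int (n - L)) \<longrightarrow> x' j = y' (j + k))"
    if x: "lifts X X' h x x' a" and y: "lifts X X' h y y' b"
      and eq: "\<And>i. i < n \<Longrightarrow> x i = y (i + d)" for x y x' y' a b d n
  proof -
    have "\<exists>k :: int. (\<forall>s\<in>{..of_int (n - L)}. \<bar>b (s + of_int d) - a s - of_int k\<bar> < e) \<and>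
        (\<forall>s\<in>{..of_int (n - L)}. x' \<lfloor>a s\<rfloor> = y' (\<lfloor>a s\<rfloor> + k))"
    proof (rule L[OF x y])
      fix s :: real and i assume "s \<in> {..of_int (n - L)}" "\<bar>i - \<lfloor>s\<rfloor>\<bar> < L"
      then have "\<lfloor>s\<rfloor> \<le> n - L" by (metis atMost_iff floor_mono floor_of_int)
      then show "x i = y (i + d)" using \<open>\<bar>i - \<lfloor>s\<rfloor>\<bar> < L\<close> by (intro eq) linarith
    qed simp
    then obtain k :: int where k: "\<And>s. s \<le> of_int (n - L) \<Longrightarrow> \<bar>b (s + of_int d) - a s - of_int k\<bar> < e"
        "\<And>s. s \<le> of_int (n - L) \<Longrightarrow> x' \<lfloor>a s\<rfloor> = y' (\<lfloor>a s\<rfloor> + k)"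
      by (auto simp del: of_int_diff)
    \<comment> \<open>Since \<open>a\<close> is onto, some time \<open>s\<close> has
      \<open>a s = j\<close>, and there the floor is \<open>j\<close> itself.\<close>
    have "x' j = y' (j + k)" if "of_int j \<le> a (of_int (n - L))" for j
    proof -
      obtain s where s: "a s = of_int j" using x unfolding lifts_def by (metis surjD)
      then have "s \<le> of_int (n - L)"
        using that x unfolding lifts_def by (metis strict_mono_less_eq)
      then show ?thesis using k(2)[of s] s by simp
    qed
    then show ?thesis using k(1) by blast
  qed
  then show ?thesis by (rule that)
qed

lemma lag_right:
  assumes e: "0 < e" "e \<le> 1/4"
  obtains L :: int where "\<And>x y x' y' a b d n. lifts X X' h x x' a \<Longrightarrow> lifts X X' h y y' b \<Longrightarrow>
    (\<And>i. n \<le> i \<Longrightarrow> x i = y (i + d)) \<Longrightarrow>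
    \<exists>k :: int. (\<forall>s \<ge> of_int (n + L). \<bar>b (s + of_int d) - a s - of_int k\<bar> < e) \<and>
      (\<forall>j. a (of_int (n + L)) \<le> of_int j \<longrightarrow> x' j = y' (j + k))"
proof -
  obtain L :: int where L: "\<And>x y x' y' a b d I. lifts X X' h x x' a \<Longrightarrow> lifts X X' h y y' b \<Longrightarrow>
    connected I \<Longrightarrow> (\<And>s i. s \<in> I \<Longrightarrow> \<bar>i - \<lfloor>s\<rfloor>\<bar> < L \<Longrightarrow> x i = y (i + d)) \<Longrightarrow>
    \<exists>k :: int. (\<forall>s\<in>I. \<bar>b (s + of_int d) - a s - of_int k\<bar> < e) \<and> (\<forall>s\<in>I. x' \<lfloor>a s\<rfloor> = y' (\<lfloor>a s\<rfloor> + k))"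
    by (rule lag_on[OF e]) blast
  have "\<exists>k :: int. (\<forall>s \<ge> of_int (n + L). \<bar>b (s + of_int d) - a s - of_int k\<bar> < e) \<and>
      (\<forall>j. a (of_int (n + L)) \<le> of_int j \<longrightarrow> x' j = y' (j + k))"
    if x: "lifts X X' h x x' a" and y: "lifts X X' h y y' b"
      and eq: "\<And>i. n \<le> i \<Longrightarrow> x i = y (i + d)" for x y x' y' a b d n
  proof -
    have "\<exists>k :: int. (\<forall>s\<in>{of_int (n + L)..}. \<bar>b (s + of_int d) - a s - of_int k\<bar> < e) \<and>
        (\<forall>s\<in>{of_int (n + L)..}. x' \<lfloor>a s\<rfloor> = y' (\<lfloor>a s\<rfloor> + k))"
    proof (rule L[OF x y])
      fix s :: real and i assume "s \<in> {of_int (n + L)..}" "\<bar>i - \<lfloor>s\<rfloor>\<bar> < L"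
      then have "n + L \<le> \<lfloor>s\<rfloor>" by (metis atLeast_iff floor_mono floor_of_int)
      then show "x i = y (i + d)" using \<open>\<bar>i - \<lfloor>s\<rfloor>\<bar> < L\<close> by (intro eq) linarith
    qed simp
    then obtain k :: int where k: "\<And>s. of_int (n + L) \<le> s \<Longrightarrow> \<bar>b (s + of_int d) - a s - of_int k\<bar> < e"
        "\<And>s. of_int (n + L) \<le> s \<Longrightarrow> x' \<lfloor>a s\<rfloor> = y' (\<lfloor>a s\<rfloor> + k)"
      by (auto simp del: of_int_add)
    have "x' j = y' (j + k)" if "a (of_int (n + L)) \<le> of_int j" for j
    proof -
      obtain s where s: "a s = of_int j" using x unfolding lifts_def by (metis surjD)
      then have "of_int (n + L) \<le> s"
        using that x unfolding lifts_def by (metis strict_mono_less_eq)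
      then show ?thesis using k(2)[of s] s by simp
    qed
    then show ?thesis using k(1) by blast
  qed
  then show ?thesis by (rule that)
qed

text \<open>A period of the left tail of \<open>z'\<close> would give, via the inverse homeomorphism, arbitrarily small
  returns along the orbit of \<open>z\<close>, as \<open>z\<close> has no period; this contradicts the lower bound on time increments.\<close>

lemma left_aperiodic_lift:
  assumes z: "lifts X X' h z z' a" and ap: "left_aperiodic z"
  shows "left_aperiodic z'"
  unfolding left_aperiodic_def
proof (intro allI impI)
  fix d n assume per: "\<forall>i<n. z' i = z' (i + d)"
  interpret S: suspension_homeo \<Sigma>' X' \<Sigma> X g h by (rule suspension_homeo_swap)
  define b where "b = inv a"
  have b: "lifts X' X g z' z b" unfolding b_def by (rule lifts_inverse[OF z])
  then have b': "z' \<in> X'" "z \<in> X" "strict_mono b" "\<And>s. g (pt X' z' s) = pt X z (b s)"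
    by (auto simp: lifts_def)
  obtain \<epsilon> where \<epsilon>: "\<epsilon> > 0" "\<And>x x' a s. x \<in> X' \<Longrightarrow> x' \<in> X \<Longrightarrow> strict_mono a \<Longrightarrow>
    (\<And>s. g (pt X' x s) = pt X x' (a s)) \<Longrightarrow> a s + \<epsilon> \<le> a (s + 1/2)"
    by (rule time_increment[OF X'.subshift_space_axioms X.subshift_space_axioms cont_h hg]) blast+
  have inc: "b s + \<epsilon> \<le> b (s + 1/2)" for s by (rule \<epsilon>(2)[OF b'])
  define e where "e = min \<epsilon> (1/4)"
  have e: "0 < e" "e \<le> 1/4" "e \<le> \<epsilon>" using \<epsilon>(1) by (auto simp: e_def)
  obtain L :: int where L: "\<And>x y x' y' a b d n. lifts X' X g x x' a \<Longrightarrow> lifts X' X g y y' b \<Longrightarrow>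
    (\<And>i. i < n \<Longrightarrow> x i = y (i + d)) \<Longrightarrow>
    \<exists>k :: int. (\<forall>s \<le> of_int (n - L). \<bar>b (s + of_int d) - a s - of_int k\<bar> < e) \<and>
      (\<forall>j. of_int j \<le> a (of_int (n - L)) \<longrightarrow> x' j = y' (j + k))"
    by (rule S.lag_left[OF e(1,2)]) blast
  obtain k :: int where k: "\<And>s. s \<le> of_int (n - L) \<Longrightarrow> \<bar>b (s + of_int d) - b s - of_int k\<bar> < e"
    "\<And>j. of_int j \<le> b (of_int (n - L)) \<Longrightarrow> z j = z (j + k)"
    using L[OF b b, of n d] per by blast
  have "\<forall>j<\<lfloor>b (of_int (n - L))\<rfloor>. z j = z (j + k)"
    using k(2) by (auto simp: less_floor_iff)
  then have "k = 0" using ap unfolding left_aperiodic_def by blast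
  define s where "s = (of_int (n - L) :: real)"
  have bd: "\<bar>b (s + of_int d) - b s\<bar> < \<epsilon>" using k(1)[of s] e(3) \<open>k = 0\<close> by (simp add: s_def)
  show "d = 0"
  proof (rule ccontr)
    assume "d \<noteq> 0"
    then consider "d \<ge> 1" | "d \<le> -1" by linarith
    then show False
    proof cases
      case 1
      then have "s + 1/2 \<le> s + of_int d" by linarith
      then have "b (s + 1/2) \<le> b (s + of_int d)" using b'(3) by (simp only: strict_mono_less_eq)
      then show False using inc[of s] bd by linarith
    next
      case 2
      then have "s + of_int d + 1/2 \<le> s" by linarith
      then have "b (s + of_int d + 1/2) \<le> b s" using b'(3) by (simp only: strict_mono_less_eq)
      then show False using inc[of "s + of_int d"] bd by linarith
    qed
  qed
qed

end

section \<open>The homeomorphism of unstable leaves induced by a flow equivalence\<close>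

locale flow_pair = suspension_homeo +
  assumes lift_h: "x \<in> X \<Longrightarrow> \<exists>x' a. lifts X X' h x x' a"
    and lift_g: "x' \<in> X' \<Longrightarrow> \<exists>x a. lifts X' X g x' x a"
begin

lemma swap: "flow_pair \<Sigma>' X' \<Sigma> X g h"
  by (rule flow_pair.intro[OF suspension_homeo_swap]) (unfold_locales, use lift_h lift_g in auto)

end

text \<open>When the left tail of \<open>z'\<close> is not periodic, an orbit contains at most one point of its tail class, so
  \<open>y'\<close> is determined by the orbit of the image of \<open>y\<close>.\<close>

definition leaf_image :: "(int \<Rightarrow> 'a) set \<Rightarrow> (int \<Rightarrow> 'b) set \<Rightarrow>
    (((int \<Rightarrow> 'a) \<times> real) set \<Rightarrow> ((int \<Rightarrow> 'b) \<times> real) set) \<Rightarrow> (int \<Rightarrow> 'b) \<Rightarrow> (int \<Rightarrow> 'a) \<Rightarrow> int \<Rightarrow> 'b" where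
  "leaf_image X X' h z' y = (THE y'. y' \<in> tail_class X' z' \<and> (\<exists>b. lifts X X' h y y' b))"

locale marked_flow_pair = flow_pair +
  fixes z z' a
  assumes base: "lifts X X' h z z' a" and left_aperiodic_z: "left_aperiodic z"
begin

abbreviation "H \<equiv> leaf_image X X' h z'"

lemma left_aperiodic_z': "left_aperiodic z'"
  using left_aperiodic_lift base left_aperiodic_z .

lemma swap_marked: "marked_flow_pair \<Sigma>' X' \<Sigma> X g h z' z (inv a)"
  using swap lifts_inverse[OF base] left_aperiodic_z'
  by (simp add: marked_flow_pair_def marked_flow_pair_axioms_def)

lemma lift_unique:
  assumes "lifts X X' h y y1 b" "lifts X X' h y y2 c" "y1 \<in> tail_class X' z'" "y2 \<in> tail_class X' z'"
  shows "y2 = y1"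
proof -
  have "pt X' y1 (b 0) = pt X' y2 (c 0)" "y1 \<in> X'" using assms(1,2) by (auto simp: lifts_def)
  then obtain n where n: "y2 = translate n y1" using X'.pt_eq_iff by blast
  then have "n = 0"
    using tail_class_lag[OF left_aperiodic_z' assms(4,3), of 0 n] by (simp add: translate_def)
  then show ?thesis using n by (simp add: translate_0)
qed

text \<open>An arbitrary lift follows the left tail of \<open>z'\<close> with some constant lag,
  which a translation removes.\<close>

lemma lift_exists:
  assumes y: "y \<in> tail_class X z"
  shows "\<exists>y' b. y' \<in> tail_class X' z' \<and> lifts X X' h y y' b"
proof -
  have yX: "y \<in> X" using y by (simp add: tail_class_def)
  obtain y' b where y': "lifts X X' h y y' b" using lift_h[OF yX] by blast
  obtain n where n: "\<And>i. i < n \<Longrightarrow> y i = z i" using y by (auto simp: tail_class_def)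
  obtain L :: int where L: "\<And>x y x' y' a b d n. lifts X X' h x x' a \<Longrightarrow> lifts X X' h y y' b \<Longrightarrow>
    (\<And>i. i < n \<Longrightarrow> x i = y (i + d)) \<Longrightarrow>
    \<exists>k :: int. (\<forall>s \<le> of_int (n - L). \<bar>b (s + of_int d) - a s - of_int k\<bar> < 1/4) \<and>
      (\<forall>j. of_int j \<le> a (of_int (n - L)) \<longrightarrow> x' j = y' (j + k))"
    by (rule lag_left[of "1/4"]) (simp, simp, blast)
  obtain k :: int where k: "\<And>j. of_int j \<le> a (of_int (n - L)) \<Longrightarrow> z' j = y' (j + k)"
    using L[OF base y', of n 0] n by auto
  have "translate k y' \<in> tail_class X' z'"
    unfolding tail_class_def
  proof (intro CollectI conjI exI[of _ "\<lfloor>a (of_int (n - L))\<rfloor>"] allI impI)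
    show "translate k y' \<in> X'" using y' by (simp add: lifts_def X'.translate_iff)
    fix i assume "i < \<lfloor>a (of_int (n - L))\<rfloor>"
    then show "translate k y' i = z' i" using k[of i] by (simp add: less_floor_iff translate_def)
  qed
  then show ?thesis using lifts_translate[OF y'] by blast
qed

lemma H_eqI:
  assumes "y' \<in> tail_class X' z'" "lifts X X' h y y' b"
  shows "H y = y'"
  unfolding leaf_image_def using assms lift_unique by (intro the_equality) blast+

lemma H_lift:
  assumes "y \<in> tail_class X z"
  shows "H y \<in> tail_class X' z'" and "\<exists>b. lifts X X' h y (H y) b"
  using lift_exists[OF assms] H_eqI by metis+

lemma leaf_image_inverse:
  assumes "y \<in> tail_class X z"
  shows "leaf_image X' X g z (H y) = y"
proof -
  interpret S: marked_flow_pair \<Sigma>' X' \<Sigma> X g h z' z "inv a" by (rule swap_marked)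
  show ?thesis using H_lift[OF assms] lifts_inverse S.H_eqI assms by blast
qed

text \<open>Both images have the aperiodic left tail of \<open>z'\<close>, so the lag supplied by
  \<open>lag_left\<close> is 0. Hence on a whole cylinder the time changes themselves, not only
  their classes modulo integers, differ by less than 1/4.\<close>

lemma lag_cyl:
  obtains L :: int where "\<And>y w a b n. y \<in> tail_class X z \<Longrightarrow> w \<in> cyl X n y \<Longrightarrow>
    lifts X X' h y (H y) a \<Longrightarrow> lifts X X' h w (H w) b \<Longrightarrow>
    (\<forall>s \<le> of_int (n - L). \<bar>b s - a s\<bar> < 1/4) \<and> (\<forall>j. of_int j \<le> a (of_int (n - L)) \<longrightarrow> H w j = H y j)"
proof -
  obtain L :: int where L: "\<And>x y x' y' a b d n. lifts X X' h x x' a \<Longrightarrow> lifts X X' h y y' b \<Longrightarrow>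
    (\<And>i. i < n \<Longrightarrow> x i = y (i + d)) \<Longrightarrow>
    \<exists>k :: int. (\<forall>s \<le> of_int (n - L). \<bar>b (s + of_int d) - a s - of_int k\<bar> < 1/4) \<and>
      (\<forall>j. of_int j \<le> a (of_int (n - L)) \<longrightarrow> x' j = y' (j + k))"
    by (rule lag_left[of "1/4"]) (simp, simp, blast)
  have "(\<forall>s \<le> of_int (n - L). \<bar>b s - a s\<bar> < 1/4) \<and> (\<forall>j. of_int j \<le> a (of_int (n - L)) \<longrightarrow> H w j = H y j)"
    if y: "y \<in> tail_class X z" and w: "w \<in> cyl X n y"
      and a: "lifts X X' h y (H y) a" and b: "lifts X X' h w (H w) b" for y w a b n
  proof -
    obtain k :: int where k: "\<And>s. s \<le> of_int (n - L) \<Longrightarrow> \<bar>b (s + of_int 0) - a s - of_int k\<bar> < 1/4"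
      "\<And>j. of_int j \<le> a (of_int (n - L)) \<Longrightarrow> H y j = H w (j + k)"
      using L[OF a b, of n 0] w by (auto simp: cyl_def simp del: of_int_diff)
    have "k = 0"
      using tail_class_lag[OF left_aperiodic_z' H_lift(1)[OF y] H_lift(1)[OF subsetD[OF cyl_subset_tail_class[OF y] w]],
          of "\<lfloor>a (of_int (n - L))\<rfloor>" k] k(2) by (simp add: le_floor_iff)
    then show ?thesis using k by auto
  qed
  then show ?thesis by (rule that)
qed

lemma H_continuous:
  assumes y: "y \<in> tail_class X z"
  shows "\<exists>n. \<forall>w\<in>cyl X n y. H w \<in> cyl X' m (H y)"
proof -
  obtain L :: int where L: "\<And>y w a b n. y \<in> tail_class X z \<Longrightarrow> w \<in> cyl X n y \<Longrightarrow>
    lifts X X' h y (H y) a \<Longrightarrow> lifts X X' h w (H w) b \<Longrightarrow>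
    (\<forall>s \<le> of_int (n - L). \<bar>b s - a s\<bar> < 1/4) \<and> (\<forall>j. of_int j \<le> a (of_int (n - L)) \<longrightarrow> H w j = H y j)"
    by (rule lag_cyl) blast
  obtain a where a: "lifts X X' h y (H y) a" using H_lift(2)[OF y] by blast
  obtain s where s: "a s = of_int m" using a unfolding lifts_def by (metis surjD)
  \<comment> \<open>\<open>s\<close> is the time at which the image of \<open>y\<close> arrives at
    position \<open>m\<close>; agreement of \<open>w\<close> with \<open>y\<close> up to
    \<open>L\<close> symbols beyond this time is enough.\<close>
  define n where "n = \<lceil>s\<rceil> + L"
  have "s \<le> of_int (n - L)" unfolding n_def by simp
  then have m: "of_int m \<le> a (of_int (n - L))"
    using a s unfolding lifts_def by (metis strict_mono_less_eq)
  have "H w \<in> cyl X' m (H y)" if w: "w \<in> cyl X n y" for w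
  proof -
    have wT: "w \<in> tail_class X z" using subsetD[OF cyl_subset_tail_class[OF y] w] .
    obtain b where "lifts X X' h w (H w) b" using H_lift(2)[OF wT] by blast
    then have "\<forall>j. of_int j \<le> a (of_int (n - L)) \<longrightarrow> H w j = H y j"
      using L[OF y w a] by blast
    moreover have "of_int j \<le> a (of_int (n - L))" if "j < m" for j
      using m that by (meson dual_order.trans less_imp_le of_int_le_iff)
    moreover have "H w \<in> X'" using H_lift(1)[OF wT] by (simp add: tail_class_def)
    ultimately show ?thesis by (simp add: cyl_def)
  qed
  then show ?thesis by blast
qed

text \<open>The point is that \<open>k\<close> and \<open>j0\<close> serve for all pairs
  \<open>u\<close>, \<open>v\<close> near \<open>x\<close>, \<open>y\<close>. At one reference time
  the time changes of \<open>u\<close> and \<open>v\<close> are close to those of \<open>x\<close>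
  and \<open>y\<close>, which pins the integer lag.\<close>

lemma H_holonomy:
  assumes x: "x \<in> tail_class X z" and y: "y \<in> tail_class X z"
    and eq: "\<And>i. n \<le> i \<Longrightarrow> x i = y (i + d)"
  shows "\<exists>m k j0. \<forall>u\<in>cyl X m x. \<forall>v\<in>cyl X (m + d) y. (\<forall>i\<ge>n. u i = v (i + d)) \<longrightarrow>
    (\<forall>j\<ge>j0. H u j = H v (j + k))"
proof -
  obtain L :: int where L: "\<And>y w a b n. y \<in> tail_class X z \<Longrightarrow> w \<in> cyl X n y \<Longrightarrow>
    lifts X X' h y (H y) a \<Longrightarrow> lifts X X' h w (H w) b \<Longrightarrow>
    (\<forall>s \<le> of_int (n - L). \<bar>b s - a s\<bar> < 1/4) \<and> (\<forall>j. of_int j \<le> a (of_int (n - L)) \<longrightarrow> H w j = H y j)"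
    by (rule lag_cyl) blast
  obtain R :: int where R: "\<And>x y x' y' a b d n. lifts X X' h x x' a \<Longrightarrow> lifts X X' h y y' b \<Longrightarrow>
    (\<And>i. n \<le> i \<Longrightarrow> x i = y (i + d)) \<Longrightarrow>
    \<exists>k :: int. (\<forall>s \<ge> of_int (n + R). \<bar>b (s + of_int d) - a s - of_int k\<bar> < 1/4) \<and>
      (\<forall>j. a (of_int (n + R)) \<le> of_int j \<longrightarrow> x' j = y' (j + k))"
    by (rule lag_right[of "1/4"]) (simp, simp, blast)
  obtain a where a: "lifts X X' h x (H x) a" using H_lift(2)[OF x] by blast
  obtain b where b: "lifts X X' h y (H y) b" using H_lift(2)[OF y] by blast
  define s where "s = (of_int (n + R) :: real)"
  obtain k :: int where k: "\<bar>b (s + of_int d) - a s - of_int k\<bar> < 1/4"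
    using R[OF a b eq] unfolding s_def by blast
  \<comment> \<open>From the reference time \<open>s = n + R\<close> on, the right tails are
    controlled by \<open>lag_right\<close>; with \<open>m = s + L\<close> the left cylinders still
    control the time changes at \<open>s\<close>.\<close>
  define m where "m = n + R + L"
  \<comment> \<open>The starting point for \<open>j\<close> is independent of \<open>u\<close>,
    because \<open>au s < a s + 1/4\<close>.\<close>
  have "H u j = H v (j + k)"
    if u: "u \<in> cyl X m x" and v: "v \<in> cyl X (m + d) y" and uv: "\<forall>i\<ge>n. u i = v (i + d)"
      and j: "j \<ge> \<lceil>a s\<rceil> + 1" for u v j
  proof -
    obtain au where au: "lifts X X' h u (H u) au" using H_lift(2) subsetD[OF cyl_subset_tail_class[OF x] u] by blast
    obtain bv where bv: "lifts X X' h v (H v) bv" using H_lift(2) subsetD[OF cyl_subset_tail_class[OF y] v] by blast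
    have 1: "\<bar>au s - a s\<bar> < 1/4" using L[OF x u a au] by (simp add: m_def s_def)
    have 2: "\<bar>bv (s + of_int d) - b (s + of_int d)\<bar> < 1/4"
      using L[OF y v b bv] by (simp add: m_def s_def)
    have "\<And>i. n \<le> i \<Longrightarrow> u i = v (i + d)" using uv by blast
    from R[OF au bv this] obtain k' :: int
      where 3: "\<bar>bv (s + of_int d) - au s - of_int k'\<bar> < 1/4"
        "\<And>j. au s \<le> of_int j \<Longrightarrow> H u j = H v (j + k')"
      unfolding s_def by blast
    \<comment> \<open>Four errors below 1/4 add up to less than 1, so the integers \<open>k\<close>
      and \<open>k'\<close> coincide.\<close>
    have "(of_int k' :: real) < of_int (k + 1)" "(of_int k :: real) < of_int (k' + 1)"
      using 1 2 3(1) k unfolding of_int_add by (simp_all only: of_int_1)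
    then have "k' = k" unfolding of_int_less_iff by linarith
    moreover have "au s \<le> of_int j" using j 1 by linarith
    ultimately show ?thesis using 3(2) by blast
  qed
  then show ?thesis by blast
qed

end

subsection \<open>Measures on unstable leaves\<close>

definition follow :: "int \<Rightarrow> (int \<Rightarrow> 'a) set \<Rightarrow> (nat \<Rightarrow> 'a) set" where
  "follow n V = (\<lambda>y k. y (n + int k)) ` V"

text \<open>A compact open subset of the leaf, given as a finite union of cylinders of one common
  level.\<close>

definition resolved :: "(int \<Rightarrow> 'a) set \<Rightarrow> (int \<Rightarrow> 'a) \<Rightarrow> int \<Rightarrow> (int \<Rightarrow> 'a) set \<Rightarrow> bool" where
  "resolved X z n C \<longleftrightarrow> C \<subseteq> tail_class X z \<and> (\<forall>y\<in>C. cyl X n y \<subseteq> C) \<and> finite (cyl X n ` C)"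

definition vol :: "(int \<Rightarrow> 'a) set \<Rightarrow> ((nat \<Rightarrow> 'a) set \<Rightarrow> 'm::comm_monoid_mult) \<Rightarrow> int \<Rightarrow> (int \<Rightarrow> 'a) set \<Rightarrow> 'm" where
  "vol X \<phi> n C = (\<Prod>V\<in>cyl X n ` C. \<phi> (follow n V))"

text \<open>For an additive \<open>\<phi>\<close> the value does not depend on the level chosen by \<open>SOME\<close>.\<close>

definition Vol :: "(int \<Rightarrow> 'a) set \<Rightarrow> (int \<Rightarrow> 'a) \<Rightarrow> ((nat \<Rightarrow> 'a) set \<Rightarrow> 'm::comm_monoid_mult) \<Rightarrow> (int \<Rightarrow> 'a) set \<Rightarrow> 'm" where
  "Vol X z \<phi> C = vol X \<phi> (SOME n. resolved X z n C) C"

definition follower_sets :: "(int \<Rightarrow> 'a) set \<Rightarrow> (int \<Rightarrow> 'a) \<Rightarrow> (nat \<Rightarrow> 'a) set set" where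
  "follower_sets X z = {follow n (cyl X n x) | n x. x \<in> tail_class X z}"

definition additive :: "(int \<Rightarrow> 'a) set \<Rightarrow> (int \<Rightarrow> 'a) \<Rightarrow> ((nat \<Rightarrow> 'a) set \<Rightarrow> 'm::comm_monoid_mult) \<Rightarrow> bool" where
  "additive X z \<phi> \<longleftrightarrow> (\<forall>x\<in>tail_class X z. \<forall>n.
     \<phi> (follow n (cyl X n x)) = (\<Prod>V\<in>cyl X (n + 1) ` cyl X n x. \<phi> (follow (n + 1) V)))"

text \<open>Prescribing the value 1 off the follower sets makes an element determined by its values
  on follower sets, so that counting elements counts measures.\<close>

definition cyl_measures :: "(int \<Rightarrow> 'a) set \<Rightarrow> (int \<Rightarrow> 'a) \<Rightarrow> nat \<Rightarrow> ((nat \<Rightarrow> 'a) set \<Rightarrow> complex) set" where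
  "cyl_measures X z M = {\<phi>. additive X z \<phi> \<and> (\<forall>S. \<phi> S ^ M = 1) \<and> (\<forall>S. S \<notin> follower_sets X z \<longrightarrow> \<phi> S = 1)}"

lemma cyl_eq: "y \<in> cyl X n x \<Longrightarrow> cyl X n y = cyl X n x"
  by (auto simp: cyl_def)

lemma mem_cyl_image: "V \<in> cyl X n ` C \<Longrightarrow> v \<in> V \<Longrightarrow> V = cyl X n v"
  by (auto simp: cyl_eq)

lemma cyl_disjoint: "V \<in> cyl X n ` C \<Longrightarrow> W \<in> cyl X n ` C \<Longrightarrow> V \<noteq> W \<Longrightarrow> V \<inter> W = {}"
  using mem_cyl_image by (metis disjoint_iff)

lemma cyl_antimono: "n \<le> m \<Longrightarrow> cyl X m x \<subseteq> cyl X n x"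
  by (auto simp: cyl_def)

lemma cyl_self: "x \<in> X \<Longrightarrow> x \<in> cyl X n x"
  by (simp add: cyl_def)

lemma cyl_subset: "cyl X n x \<subseteq> X"
  by (auto simp: cyl_def)

lemma tail_class_subset: "tail_class X z \<subseteq> X"
  by (auto simp: tail_class_def)

lemma image_UN_cyl:
  assumes "C \<subseteq> X" "\<And>y. y \<in> C \<Longrightarrow> cyl X n y \<subseteq> C"
  shows "f ` C = (\<Union>V\<in>cyl X n ` C. f ` V)"
proof -
  have "C = (\<Union>y\<in>C. cyl X n y)"
  proof
    show "C \<subseteq> (\<Union>y\<in>C. cyl X n y)" using assms(1) cyl_self by blast
    show "(\<Union>y\<in>C. cyl X n y) \<subseteq> C" using assms(2) by blast
  qed
  then have "f ` C = f ` (\<Union>y\<in>C. cyl X n y)" by (rule arg_cong)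
  then show ?thesis by (simp add: image_UN)
qed

lemma additiveD:
  "additive X z \<phi> \<Longrightarrow> x \<in> tail_class X z \<Longrightarrow>
     \<phi> (follow n (cyl X n x)) = (\<Prod>V\<in>cyl X (n + 1) ` cyl X n x. \<phi> (follow (n + 1) V))"
  by (simp add: additive_def)

section \<open>Volumes of compact open subsets of a leaf\<close>

context subshift_space
begin

lemma finite_subcylinders:
  "finite (cyl X m ` cyl X n x)"
proof -
  \<comment> \<open>The clause \<open>i < m\<close> covers the case \<open>m \<le> n\<close>, in
    which only positions left of \<open>m\<close> are prescribed.\<close>
  let ?f = "\<lambda>r. {w \<in> X. (\<forall>i<n. i < m \<longrightarrow> w i = x i) \<and> (\<forall>i\<in>{n..<m}. w i = r i)}"
  have "cyl X m ` cyl X n x \<subseteq> ?f ` (\<Pi>\<^sub>E i\<in>{n..<m}. \<Sigma>)"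
  proof
    fix V assume "V \<in> cyl X m ` cyl X n x"
    then obtain y where y: "y \<in> X" "\<forall>i<n. y i = x i" "V = cyl X m y" by (auto simp: cyl_def)
    have "V = ?f (restrict y {n..<m})"
      using y(2) unfolding y(3) cyl_def by force
    moreover have "restrict y {n..<m} \<in> (\<Pi>\<^sub>E i\<in>{n..<m}. \<Sigma>)"
      using symbol[OF y(1)] by auto
    ultimately show "V \<in> ?f ` (\<Pi>\<^sub>E i\<in>{n..<m}. \<Sigma>)" by blast
  qed
  then show ?thesis
    by (rule finite_subset) (intro finite_imageI finite_PiE finite_alphabet, simp)
qed

text \<open>Compactness of a cylinder in the leaf topology: inside \<open>cyl X n x\<close> the past
  is fixed, so the cylinder \<open>cyl X (r y) y\<close> is cut out by the finite window
  \<open>{n..<r y}\<close> and compactness of \<open>X\<close> applies.\<close>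

lemma cylinder_cover:
  "\<exists>Y. finite Y \<and> Y \<subseteq> cyl X n x \<and> cyl X n x \<subseteq> (\<Union>y\<in>Y. cyl X (r y) y)"
proof -
  define O' where "O' y = {w. \<forall>j\<in>{n..<r y}. w j = y j}" for y
  \<comment> \<open>The open set of sequences that differ from \<open>x\<close> somewhere left of
    \<open>n\<close>; it completes the windows to a cover of \<open>X\<close> and misses the
    cylinder.\<close>
  define N where "N = (\<Union>(v, i)\<in>{(v, i). i < n \<and> v i \<noteq> x i}. {u. \<forall>j\<in>{i}. u j = v j})"
  have N1: "openin seq_topology N"
    unfolding N_def by (rule openin_Union) (auto intro: openin_window[of "{_}", simplified])
  have N2: "w \<notin> cyl X n x" if "w \<in> N" for w
    using that by (auto simp: N_def cyl_def)
  have N3: "w \<in> N" if "w \<in> X" "w \<notin> cyl X n x" for w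
    using that unfolding N_def by (auto simp: cyl_def)
  have O1: "openin seq_topology (O' y)" for y
    unfolding O'_def by (rule openin_window) simp
  have "X \<subseteq> \<Union>(insert N (O' ` cyl X n x))"
    using N3 by (auto simp: O'_def)
  then obtain F where F: "finite F" "F \<subseteq> insert N (O' ` cyl X n x)" "X \<subseteq> \<Union>F"
    using compactinD[OF compactin, of "insert N (O' ` cyl X n x)"] N1 O1 by auto
  then have "finite (F - {N})" "F - {N} \<subseteq> O' ` cyl X n x" by auto
  then obtain Y where Y: "finite Y" "Y \<subseteq> cyl X n x" "F - {N} = O' ` Y"
    by (meson finite_subset_image)
  have "w \<in> (\<Union>y\<in>Y. cyl X (r y) y)" if w: "w \<in> cyl X n x" for w
  proof -
    obtain A where A: "A \<in> F" "w \<in> A" using w F(3) cyl_subset by blast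
    then have "A \<noteq> N" using N2 w by blast
    then obtain y where y: "y \<in> Y" "w \<in> O' y" using A Y(3) by blast
    then have "y \<in> cyl X n x" using Y(2) by blast
    then have "w \<in> cyl X (r y) y" using y(2) w by (auto simp: cyl_def O'_def)
    then show ?thesis using y(1) by blast
  qed
  then show ?thesis using Y by blast
qed

lemma resolved_Suc:
  assumes "resolved X z n C"
  shows "resolved X z (n + 1) C"
proof -
  have C: "C \<subseteq> tail_class X z" "\<And>y. y \<in> C \<Longrightarrow> cyl X n y \<subseteq> C" "finite (cyl X n ` C)"
    using assms by (auto simp: resolved_def)
  have "cyl X (n + 1) ` C \<subseteq> (\<Union>V\<in>cyl X n ` C. cyl X (n + 1) ` V)"
    by (rule equalityD1[OF image_UN_cyl[OF order_trans[OF C(1) tail_class_subset] C(2)]])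
  moreover have "finite (\<Union>V\<in>cyl X n ` C. cyl X (n + 1) ` V)"
    by (rule finite_UN_I[OF C(3)]) (auto simp only: finite_subcylinders image_iff)
  ultimately have "finite (cyl X (n + 1) ` C)" by (rule finite_subset)
  then show ?thesis
    unfolding resolved_def using C(1,2) cyl_antimono[of n "n + 1"] by force
qed

lemma vol_Suc:
  assumes C: "resolved X z n C" and \<phi>: "additive X z \<phi>"
  shows "vol X \<phi> (n + 1) C = vol X \<phi> n C"
proof -
  have C: "C \<subseteq> tail_class X z" "\<And>y. y \<in> C \<Longrightarrow> cyl X n y \<subseteq> C" "finite (cyl X n ` C)"
    using assms by (auto simp: resolved_def)
  have "cyl X (n + 1) ` C = (\<Union>V\<in>cyl X n ` C. cyl X (n + 1) ` V)"
    by (rule image_UN_cyl[OF order_trans[OF C(1) tail_class_subset] C(2)])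
  then have "vol X \<phi> (n + 1) C = prod (\<lambda>V. \<phi> (follow (n + 1) V)) (\<Union>V\<in>cyl X n ` C. cyl X (n + 1) ` V)"
    by (simp add: vol_def)
  also have "\<dots> = (\<Prod>V\<in>cyl X n ` C. \<Prod>W\<in>cyl X (n + 1) ` V. \<phi> (follow (n + 1) W))"
  proof (rule prod.UNION_disjoint[OF C(3), where A = "\<lambda>V. cyl X (n + 1) ` V"])
    show "\<forall>V\<in>cyl X n ` C. finite (cyl X (n + 1) ` V)" using finite_subcylinders by auto
    show "\<forall>V\<in>cyl X n ` C. \<forall>W\<in>cyl X n ` C. V \<noteq> W \<longrightarrow> cyl X (n + 1) ` V \<inter> cyl X (n + 1) ` W = {}"
    proof (intro ballI impI, rule ccontr)
      fix V W assume VW: "V \<in> cyl X n ` C" "W \<in> cyl X n ` C" "V \<noteq> W"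
        "cyl X (n + 1) ` V \<inter> cyl X (n + 1) ` W \<noteq> {}"
      then obtain v w where vw: "v \<in> V" "w \<in> W" "cyl X (n + 1) v = cyl X (n + 1) w" by auto
      then have "v \<in> X" using VW(1) cyl_subset by blast
      then have "v \<in> cyl X (n + 1) w" using vw(3) cyl_self by blast
      then have "v \<in> cyl X n w" using cyl_antimono[of n "n + 1" X w] by auto
      then have "cyl X n v = cyl X n w" by (rule cyl_eq)
      moreover have "cyl X n v = V" "cyl X n w = W" using VW(1,2) vw(1,2) mem_cyl_image by metis+
      ultimately show False using VW(3) by simp
    qed
  qed
  also have "\<dots> = (\<Prod>V\<in>cyl X n ` C. \<phi> (follow n V))"
    using additiveD[OF \<phi>] C(1) by (intro prod.cong) auto
  finally show ?thesis by (simp add: vol_def)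
qed

lemma resolved_mono:
  assumes "resolved X z n C" "n \<le> m"
  shows "resolved X z m C"
  using assms(2) by (induction m rule: int_ge_induct) (use assms(1) resolved_Suc in auto)

lemma vol_mono:
  assumes "resolved X z n C" "additive X z \<phi>" "n \<le> m"
  shows "vol X \<phi> m C = vol X \<phi> n C"
  using assms(3)
  by (induction m rule: int_ge_induct) (use vol_Suc[OF resolved_mono[OF assms(1)] assms(2)] in auto)

lemma Vol_eq:
  assumes "resolved X z n C" "additive X z \<phi>"
  shows "Vol X z \<phi> C = vol X \<phi> n C"
proof -
  define m where "m = (SOME n. resolved X z n C)"
  have "resolved X z m C" unfolding m_def using assms(1) by (rule someI)
  then show ?thesis
    unfolding Vol_def m_def[symmetric]
    using vol_mono[OF assms, of "max m n"] vol_mono[OF _ assms(2), of m C "max m n"] by simp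
qed

lemma resolved_cyl: "x \<in> tail_class X z \<Longrightarrow> resolved X z n (cyl X n x)"
  unfolding resolved_def
  by (intro conjI cyl_subset_tail_class ballI finite_subcylinders) (simp_all add: cyl_eq)

lemma Vol_cyl:
  assumes "x \<in> tail_class X z" "additive X z \<phi>"
  shows "Vol X z \<phi> (cyl X n x) = \<phi> (follow n (cyl X n x))"
proof -
  have x: "x \<in> cyl X n x" using assms(1) tail_class_subset cyl_self by blast
  have "cyl X n ` cyl X n x = (\<lambda>_. cyl X n x) ` cyl X n x"
    by (rule image_cong[OF refl]) (rule cyl_eq)
  then have "cyl X n ` cyl X n x = {cyl X n x}" using x by blast
  then show ?thesis
    using Vol_eq[OF resolved_cyl[OF assms(1)] assms(2)] by (simp add: vol_def)
qed

lemma resolved_UN: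
  assumes "finite I" "\<And>i. i \<in> I \<Longrightarrow> \<exists>n. resolved X z n (C i)"
  obtains n where "\<And>i. i \<in> I \<Longrightarrow> resolved X z n (C i)" "resolved X z n (\<Union>i\<in>I. C i)"
proof -
  obtain r where r: "\<And>i. i \<in> I \<Longrightarrow> resolved X z (r i) (C i)" using assms(2) by metis
  define n where "n = Max (insert 0 (r ` I))"
  have n: "resolved X z n (C i)" if "i \<in> I" for i
    using r[OF that] by (rule resolved_mono) (use that assms(1) in \<open>auto simp: n_def intro: Max_ge\<close>)
  have "finite (\<Union>i\<in>I. cyl X n ` C i)"
    using n assms(1) unfolding resolved_def by blast
  then have "finite (cyl X n ` (\<Union>i\<in>I. C i))" by (simp add: image_UN)
  then have "resolved X z n (\<Union>i\<in>I. C i)"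
    using n unfolding resolved_def by blast
  then show ?thesis using that n by blast
qed

lemma Vol_UN:
  assumes I: "finite I" "\<And>i. i \<in> I \<Longrightarrow> \<exists>n. resolved X z n (C i)"
    and disj: "\<And>i j. i \<in> I \<Longrightarrow> j \<in> I \<Longrightarrow> i \<noteq> j \<Longrightarrow> C i \<inter> C j = {}" and \<phi>: "additive X z \<phi>"
  shows "Vol X z \<phi> (\<Union>i\<in>I. C i) = (\<Prod>i\<in>I. Vol X z \<phi> (C i))"
proof -
  obtain n where n: "\<And>i. i \<in> I \<Longrightarrow> resolved X z n (C i)" "resolved X z n (\<Union>i\<in>I. C i)"
    by (rule resolved_UN[OF I]) blast+
  have "Vol X z \<phi> (\<Union>i\<in>I. C i) = prod (\<lambda>V. \<phi> (follow n V)) (\<Union>i\<in>I. cyl X n ` C i)"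
    unfolding Vol_eq[OF n(2) \<phi>] vol_def by (simp add: image_UN)
  also have "\<dots> = (\<Prod>i\<in>I. \<Prod>V\<in>cyl X n ` C i. \<phi> (follow n V))"
  proof (rule prod.UNION_disjoint[OF I(1), where A = "\<lambda>i. cyl X n ` C i"])
    show "\<forall>i\<in>I. finite (cyl X n ` C i)" using n(1) by (auto simp: resolved_def)
    show "\<forall>i\<in>I. \<forall>j\<in>I. i \<noteq> j \<longrightarrow> cyl X n ` C i \<inter> cyl X n ` C j = {}"
    proof (intro ballI impI, rule ccontr)
      fix i j assume ij: "i \<in> I" "j \<in> I" "i \<noteq> j" "cyl X n ` C i \<inter> cyl X n ` C j \<noteq> {}"
      then obtain v w where vw: "v \<in> C i" "w \<in> C j" "cyl X n v = cyl X n w" by auto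
      have "v \<in> X" using n(1)[OF ij(1)] vw(1) tail_class_subset unfolding resolved_def by blast
      then have "v \<in> cyl X n w" using vw(3) cyl_self by blast
      then have "v \<in> C j" using n(1)[OF ij(2)] vw(2) unfolding resolved_def by blast
      then show False using disj[OF ij(1-3)] vw(1) by blast
    qed
  qed
  also have "\<dots> = (\<Prod>i\<in>I. Vol X z \<phi> (C i))"
    by (rule prod.cong[OF refl]) (simp add: Vol_eq[OF n(1) \<phi>] vol_def)
  finally show ?thesis .
qed

end

section \<open>Transport of measures along a homeomorphism of leaves\<close>

locale leaf_homeo = X: subshift_space \<Sigma> X + X': subshift_space \<Sigma>' X'
  for \<Sigma> :: "'a set" and X and \<Sigma>' :: "'b set" and X' +
  fixes z z' H G
  assumes H_in: "y \<in> tail_class X z \<Longrightarrow> H y \<in> tail_class X' z'"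
    and G_in: "w \<in> tail_class X' z' \<Longrightarrow> G w \<in> tail_class X z"
    and GH: "y \<in> tail_class X z \<Longrightarrow> G (H y) = y"
    and HG: "w \<in> tail_class X' z' \<Longrightarrow> H (G w) = w"
    and H_cont: "y \<in> tail_class X z \<Longrightarrow> \<exists>n. \<forall>w\<in>cyl X n y. H w \<in> cyl X' m (H y)"
    and G_cont: "w \<in> tail_class X' z' \<Longrightarrow> \<exists>n. \<forall>v\<in>cyl X' n w. G v \<in> cyl X m (G w)"
begin

lemma leaf_homeo_swap: "leaf_homeo \<Sigma>' X' \<Sigma> X z' z G H"
  by unfold_locales (use H_in G_in GH HG H_cont G_cont in auto)

lemma image_cover:
  assumes x: "x \<in> tail_class X z"
  shows "\<exists>Y. finite Y \<and> Y \<subseteq> cyl X n x \<and> H ` cyl X n x \<subseteq> (\<Union>u\<in>Y. cyl X' (r (H u)) (H u))"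
proof -
  obtain q where q: "\<And>u w. u \<in> tail_class X z \<Longrightarrow> w \<in> cyl X (q u) u \<Longrightarrow> H w \<in> cyl X' (r (H u)) (H u)"
    using bchoice[of "tail_class X z" "\<lambda>u q. \<forall>w\<in>cyl X q u. H w \<in> cyl X' (r (H u)) (H u)"] H_cont by blast
  obtain Y where Y: "finite Y" "Y \<subseteq> cyl X n x" "cyl X n x \<subseteq> (\<Union>u\<in>Y. cyl X (q u) u)"
    using X.cylinder_cover by metis
  have "H ` cyl X n x \<subseteq> (\<Union>u\<in>Y. cyl X' (r (H u)) (H u))"
  proof
    fix w assume "w \<in> H ` cyl X n x"
    then obtain v where v: "v \<in> cyl X n x" "w = H v" by blast
    then obtain u where u: "u \<in> Y" "v \<in> cyl X (q u) u" using Y(3) by blast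
    then have "u \<in> tail_class X z" using Y(2) cyl_subset_tail_class[OF x] by blast
    then show "w \<in> (\<Union>u\<in>Y. cyl X' (r (H u)) (H u))" using q u v by blast
  qed
  then show ?thesis using Y by blast
qed

text \<open>Continuity of \<open>G\<close> gives every image point a cylinder inside the image; by
  compactness finitely many of these cover the image, and their largest level works
  throughout.\<close>

lemma resolved_image:
  assumes x: "x \<in> tail_class X z"
  shows "\<exists>m. resolved X' z' m (H ` cyl X n x)"
proof -
  obtain r where r: "\<And>w v. w \<in> tail_class X' z' \<Longrightarrow> v \<in> cyl X' (r w) w \<Longrightarrow> G v \<in> cyl X n (G w)"
    using bchoice[of "tail_class X' z'" "\<lambda>w r. \<forall>v\<in>cyl X' r w. G v \<in> cyl X n (G w)"] G_cont by blast
  obtain Y where Y: "finite Y" "Y \<subseteq> cyl X n x" "H ` cyl X n x \<subseteq> (\<Union>u\<in>Y. cyl X' (r (H u)) (H u))"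
    using image_cover[OF x] by metis
  have T: "cyl X n x \<subseteq> tail_class X z" by (rule cyl_subset_tail_class[OF x])
  define m where "m = Max (insert 0 ((\<lambda>u. r (H u)) ` Y))"
  have m: "r (H u) \<le> m" if "u \<in> Y" for u
    unfolding m_def using that Y(1) by (intro Max_ge) auto
  have sub: "cyl X' (r (H u)) (H u) \<subseteq> H ` cyl X n x" if u: "u \<in> Y" for u
  proof
    fix v assume v: "v \<in> cyl X' (r (H u)) (H u)"
    have uT: "u \<in> tail_class X z" using u Y(2) T by blast
    have "G v \<in> cyl X n (G (H u))" using r[OF H_in[OF uT] v] .
    then have "G v \<in> cyl X n x" using GH[OF uT] cyl_eq[of u X n x] u Y(2) by auto
    moreover have "v \<in> tail_class X' z'" using v cyl_subset_tail_class[OF H_in[OF uT]] by blast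
    ultimately show "v \<in> H ` cyl X n x" using HG by (metis imageI)
  qed
  have "cyl X' m w \<subseteq> H ` cyl X n x" if w: "w \<in> H ` cyl X n x" for w
  proof -
    obtain u where u: "u \<in> Y" "w \<in> cyl X' (r (H u)) (H u)" using w Y(3) by blast
    have "cyl X' m w \<subseteq> cyl X' (r (H u)) w" using m[OF u(1)] by (rule cyl_antimono)
    also have "\<dots> = cyl X' (r (H u)) (H u)" by (rule cyl_eq[OF u(2)])
    also have "\<dots> \<subseteq> H ` cyl X n x" by (rule sub[OF u(1)])
    finally show ?thesis .
  qed
  moreover have "finite (cyl X' m ` H ` cyl X n x)"
  proof (rule finite_subset)
    show "cyl X' m ` H ` cyl X n x \<subseteq> (\<Union>u\<in>Y. cyl X' m ` cyl X' (r (H u)) (H u))"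
      using Y(3) by blast
    show "finite (\<Union>u\<in>Y. cyl X' m ` cyl X' (r (H u)) (H u))"
      using Y(1) X'.finite_subcylinders by blast
  qed
  moreover have "H ` cyl X n x \<subseteq> tail_class X' z'" using T H_in by blast
  ultimately show ?thesis unfolding resolved_def by blast
qed

end

locale leaf_holonomy = leaf_homeo +
  assumes H_hol: "x \<in> tail_class X z \<Longrightarrow> y \<in> tail_class X z \<Longrightarrow> (\<And>i. n \<le> i \<Longrightarrow> x i = y (i + d)) \<Longrightarrow>
    \<exists>m k j0. \<forall>u\<in>cyl X m x. \<forall>v\<in>cyl X (m + d) y. (\<forall>i\<ge>n. u i = v (i + d)) \<longrightarrow>
      (\<forall>j\<ge>j0. H u j = H v (j + k))"
begin

text \<open>\<open>\<beta>\<close> is a holonomy: it replaces the past, shifts by \<open>d\<close>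
  and keeps the right tail. Conjugated by \<open>H\<close> it is locally again a holonomy, with its
  own shift \<open>k\<close>: \<open>H_hol\<close> matches the coordinates from some position on,
  and continuity of \<open>H\<close> at \<open>x0\<close> and \<open>y0\<close> fixes the earlier
  ones.\<close>

lemma local_holonomy:
  assumes x0: "x0 \<in> cyl X n x" and rel0: "\<And>i. n \<le> i \<Longrightarrow> x0 i = y0 (i + d)"
    and T: "x \<in> tail_class X z" "y \<in> tail_class X z" and d: "m = n + d"
    and \<beta>: "\<And>u. u \<in> cyl X n x \<Longrightarrow> \<beta> u \<in> cyl X m y" "\<And>u i. u \<in> cyl X n x \<Longrightarrow> n \<le> i \<Longrightarrow> u i = \<beta> u (i + d)"
    and surj: "\<And>v. v \<in> cyl X m y \<Longrightarrow> \<exists>u\<in>cyl X n x. \<beta> u = v" and y0: "y0 = \<beta> x0"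
  shows "\<exists>k M. (\<forall>w\<in>cyl X' M (H x0). G w \<in> cyl X n x \<and> H (\<beta> (G w)) \<in> cyl X' (M + k) (H y0) \<and>
      (\<forall>j\<ge>M. w j = H (\<beta> (G w)) (j + k))) \<and>
    (\<forall>w'\<in>cyl X' (M + k) (H y0). \<exists>w\<in>cyl X' M (H x0). H (\<beta> (G w)) = w')"
proof -
  have x0T: "x0 \<in> tail_class X z" and y0T: "y0 \<in> tail_class X z"
    using x0 \<beta>(1)[OF x0] y0 cyl_subset_tail_class[OF T(1)] cyl_subset_tail_class[OF T(2)] by auto
  obtain m1 k j0 where hol: "\<And>u v j. u \<in> cyl X m1 x0 \<Longrightarrow> v \<in> cyl X (m1 + d) y0 \<Longrightarrow>
      \<forall>i\<ge>n. u i = v (i + d) \<Longrightarrow> j \<ge> j0 \<Longrightarrow> H u j = H v (j + k)"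
    using H_hol[OF x0T y0T rel0] by metis
  obtain q where q: "\<And>v. v \<in> cyl X q y0 \<Longrightarrow> H v \<in> cyl X' (j0 + k) (H y0)"
    using H_cont[OF y0T] by blast
  obtain q2 where q2: "\<And>v. v \<in> cyl X q2 x0 \<Longrightarrow> H v \<in> cyl X' j0 (H x0)"
    using H_cont[OF x0T] by blast
  \<comment> \<open>\<open>m1\<close> makes the holonomy property applicable, \<open>n\<close> keeps
    points in the domain of \<open>\<beta>\<close>, and \<open>q - d\<close> and \<open>q2\<close>
    give continuity of \<open>H\<close> at \<open>y0\<close> and at \<open>x0\<close>.\<close>
  define p where "p = max (max m1 n) (max (q - d) q2)"
  have p: "m1 \<le> p" "n \<le> p" "q \<le> p + d" "q2 \<le> p" by (auto simp: p_def)
  obtain M1 where M1: "\<And>w. w \<in> cyl X' M1 (H x0) \<Longrightarrow> G w \<in> cyl X p x0"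
    using G_cont[OF H_in[OF x0T]] GH[OF x0T] by metis
  obtain M2 where M2: "\<And>w. w \<in> cyl X' M2 (H y0) \<Longrightarrow> G w \<in> cyl X (p + d) y0"
    using G_cont[OF H_in[OF y0T]] GH[OF y0T] by metis
  \<comment> \<open>Beyond \<open>j0\<close> the shift \<open>k\<close> relates the coordinates;
    \<open>M1\<close> and \<open>M2 - k\<close> make \<open>G\<close> map the two image cylinders
    into the cylinders of levels \<open>p\<close> and \<open>p + d\<close>.\<close>
  define M where "M = max (max j0 M1) (M2 - k)"
  have M: "j0 \<le> M" "M1 \<le> M" "M2 \<le> M + k" by (auto simp: M_def)
  have nx: "cyl X n x = cyl X n x0" using cyl_eq[OF x0] by simp
  have key: "H u j = H (\<beta> u) (j + k)" "\<beta> u \<in> cyl X (p + d) y0"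
    if u: "u \<in> cyl X p x0" and j: "j \<ge> j0" for u j
  proof -
    have un: "u \<in> cyl X n x" unfolding nx using u p(2) cyl_antimono by blast
    show v: "\<beta> u \<in> cyl X (p + d) y0"
      unfolding cyl_def
    proof (intro CollectI conjI allI impI)
      show "\<beta> u \<in> X" using \<beta>(1)[OF un] cyl_subset by blast
      fix i assume i: "i < p + d"
      show "\<beta> u i = y0 i"
      proof (cases "i < m")
        case True
        then show ?thesis using \<beta>(1)[OF un] \<beta>(1)[OF x0] y0 by (simp add: cyl_def)
      next
        case False
        then have "n \<le> i - d" "i - d < p" using d i by auto
        then show ?thesis using \<beta>(2)[OF un, of "i - d"] rel0[of "i - d"] u by (simp add: cyl_def)
      qed
    qed
    have "u \<in> cyl X m1 x0" using u p(1) cyl_antimono by blast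
    moreover have "\<beta> u \<in> cyl X (m1 + d) y0" using v p(1) cyl_antimono[of "m1 + d" "p + d" X y0] by auto
    ultimately show "H u j = H (\<beta> u) (j + k)" using hol \<beta>(2)[OF un] j by blast
  qed
  have x0p: "x0 \<in> cyl X p x0" using x0 cyl_subset cyl_self by blast
  have "G w \<in> cyl X n x \<and> H (\<beta> (G w)) \<in> cyl X' (M + k) (H y0) \<and> (\<forall>j\<ge>M. w j = H (\<beta> (G w)) (j + k))"
    if w: "w \<in> cyl X' M (H x0)" for w
  proof -
    have wT: "w \<in> tail_class X' z'" using w cyl_subset_tail_class[OF H_in[OF x0T]] by blast
    have u: "G w \<in> cyl X p x0" using w M(2) cyl_antimono M1 by blast
    then have Gw: "G w \<in> cyl X n x" unfolding nx using p(2) cyl_antimono by blast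
    have eq: "w j = H (\<beta> (G w)) (j + k)" if "j \<ge> j0" for j
      using key(1)[OF u that] HG[OF wT] by simp
    have "\<beta> (G w) \<in> cyl X q y0" using key(2)[OF u order_refl] p(3) cyl_antimono by blast
    then have hv: "H (\<beta> (G w)) \<in> cyl X' (j0 + k) (H y0)" by (rule q)
    have "H (\<beta> (G w)) i = H y0 i" if i: "i < M + k" for i
    proof (cases "i < j0 + k")
      case True
      then show ?thesis using hv by (simp add: cyl_def)
    next
      case False
      then have "j0 \<le> i - k" "i - k < M" using i by auto
      then show ?thesis
        using eq[of "i - k"] key(1)[OF x0p, of "i - k"] w y0 by (simp add: cyl_def)
    qed
    then have "H (\<beta> (G w)) \<in> cyl X' (M + k) (H y0)" using hv by (simp add: cyl_def)
    then show ?thesis using Gw eq M(1) by auto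
  qed
  moreover have "\<exists>w\<in>cyl X' M (H x0). H (\<beta> (G w)) = w'" if w': "w' \<in> cyl X' (M + k) (H y0)" for w'
  proof -
    have wT: "w' \<in> tail_class X' z'" using w' cyl_subset_tail_class[OF H_in[OF y0T]] by blast
    have v: "G w' \<in> cyl X (p + d) y0" using w' M(3) cyl_antimono M2 by blast
    have my: "cyl X m y = cyl X m y0" using cyl_eq \<beta>(1)[OF x0] y0 by metis
    have "G w' \<in> cyl X m y" unfolding my using v p(2) d cyl_antimono[of m "p + d" X y0] by auto
    then obtain u where u: "u \<in> cyl X n x" "\<beta> u = G w'" using surj by blast
    have up: "u \<in> cyl X p x0"
      unfolding cyl_def
    proof (intro CollectI conjI allI impI)
      show "u \<in> X" using u(1) cyl_subset by blast
      fix i assume i: "i < p"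
      show "u i = x0 i"
      proof (cases "i < n")
        case True
        then show ?thesis using u(1) x0 by (simp add: cyl_def)
      next
        case False
        then show ?thesis using \<beta>(2)[OF u(1), of i] rel0[of i] v u(2) i by (simp add: cyl_def)
      qed
    qed
    then have uT: "u \<in> tail_class X z" using cyl_subset_tail_class[OF x0T] by blast
    have "u \<in> cyl X q2 x0" using up p(4) cyl_antimono by blast
    then have hu: "H u \<in> cyl X' j0 (H x0)" by (rule q2)
    have "H u i = H x0 i" if i: "i < M" for i
    proof (cases "i < j0")
      case True
      then show ?thesis using hu by (simp add: cyl_def)
    next
      case False
      then have "H u i = w' (i + k)" using key(1)[OF up, of i] u(2) HG[OF wT] by simp
      also have "\<dots> = H x0 i" using w' i key(1)[OF x0p, of i] y0 False by (simp add: cyl_def)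
      finally show ?thesis .
    qed
    then have "H u \<in> cyl X' M (H x0)" using hu by (simp add: cyl_def)
    moreover have "H (\<beta> (G (H u))) = w'" using GH[OF uT] u(2) HG[OF wT] by simp
    ultimately show ?thesis by blast
  qed
  ultimately show ?thesis by blast
qed

text \<open>Equal follower sets give a holonomy \<open>\<beta>\<close> between the two cylinders.
  The conjugate \<open>B\<close> maps one image onto the other, and after a sufficiently fine
  partition it carries each piece to a cylinder with the same follower set. Both volumes are then
  the same product.\<close>

lemma Vol_holonomy:
  fixes \<phi> :: "(nat \<Rightarrow> 'b) set \<Rightarrow> 'm::comm_monoid_mult"
  assumes x: "x \<in> tail_class X z" and y: "y \<in> tail_class X z"
    and fol: "follow n (cyl X n x) = follow m (cyl X m y)" and \<phi>: "additive X' z' \<phi>"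
  shows "Vol X' z' \<phi> (H ` cyl X n x) = Vol X' z' \<phi> (H ` cyl X m y)"
proof -
  define d where "d = m - n"
  have d: "m = n + d" by (simp add: d_def)
  define P where "P = cyl X n x"
  define Q where "Q = cyl X m y"
  define C where "C = H ` P"
  have PT: "P \<subseteq> tail_class X z" and QT: "Q \<subseteq> tail_class X z"
    unfolding P_def Q_def using cyl_subset_tail_class[OF x] cyl_subset_tail_class[OF y] by auto
  have ex1: "\<exists>v\<in>Q. \<forall>i\<ge>n. u i = v (i + d)" if u: "u \<in> P" for u
  proof -
    have "(\<lambda>k. u (n + int k)) \<in> follow m Q" using u fol by (auto simp: follow_def P_def Q_def)
    then obtain v where "v \<in> Q" and *: "(\<lambda>k. u (n + int k)) = (\<lambda>k. v (m + int k))"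
      unfolding follow_def by (rule imageE)
    then have v: "v \<in> Q" "\<And>k. u (n + int k) = v (m + int k)"
      using fun_cong[OF *] by auto
    have "u i = v (i + d)" if "n \<le> i" for i
      using v(2)[of "nat (i - n)"] that d by (simp add: algebra_simps)
    then show ?thesis using v(1) by blast
  qed
  have ex2: "\<exists>u\<in>P. \<forall>i\<ge>n. u i = v (i + d)" if v: "v \<in> Q" for v
  proof -
    have "(\<lambda>k. v (m + int k)) \<in> follow n P" using v fol by (auto simp: follow_def P_def Q_def)
    then obtain u where "u \<in> P" and *: "(\<lambda>k. v (m + int k)) = (\<lambda>k. u (n + int k))"
      unfolding follow_def by (rule imageE)
    then have u: "u \<in> P" "\<And>k. v (m + int k) = u (n + int k)"
      using fun_cong[OF *] by auto
    have "u i = v (i + d)" if "n \<le> i" for i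
      using u(2)[of "nat (i - n)"] that d by (simp add: algebra_simps)
    then show ?thesis using u(1) by blast
  qed
  obtain \<beta> where \<beta>: "\<And>u. u \<in> P \<Longrightarrow> \<beta> u \<in> Q" "\<And>u i. u \<in> P \<Longrightarrow> n \<le> i \<Longrightarrow> u i = \<beta> u (i + d)"
    using ex1 by metis
  have surj: "\<exists>u\<in>P. \<beta> u = v" if v: "v \<in> Q" for v
  proof -
    obtain u where u: "u \<in> P" "\<And>i. i \<ge> n \<Longrightarrow> u i = v (i + d)" using ex2[OF v] by blast
    have "\<beta> u i = v i" for i
    proof (cases "i < m")
      case True
      then show ?thesis using \<beta>(1)[OF u(1)] v by (simp add: Q_def cyl_def)
    next
      case False
      then show ?thesis using \<beta>(2)[OF u(1), of "i - d"] u(2)[of "i - d"] d by simp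
    qed
    then show ?thesis using u(1) by blast
  qed
  have inj: "u = u'" if "u \<in> P" "u' \<in> P" "\<beta> u = \<beta> u'" for u u'
  proof
    fix i show "u i = u' i"
      using that \<beta>(2)[of u i] \<beta>(2)[of u' i] by (cases "i < n") (auto simp: P_def cyl_def)
  qed
  define B where "B w = H (\<beta> (G w))" for w
  have GC: "G w \<in> P" if "w \<in> C" for w
    using that GH PT by (auto simp: C_def)
  have BH: "B (H u) = H (\<beta> u)" if "u \<in> P" for u
    using that PT GH by (auto simp: B_def)
  have CT: "C \<subseteq> tail_class X' z'" using PT H_in by (auto simp: C_def)
  define loc where "loc w0 k M \<longleftrightarrow> (\<forall>w\<in>cyl X' M w0. G w \<in> P \<and> B w \<in> cyl X' (M + k) (B w0) \<and>
      (\<forall>j\<ge>M. w j = B w (j + k))) \<and> (\<forall>w'\<in>cyl X' (M + k) (B w0). \<exists>w\<in>cyl X' M w0. B w = w')" for w0 k M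
  have "\<exists>k M. loc w0 k M" if "w0 \<in> C" for w0
  proof -
    obtain x0 where x0: "x0 \<in> P" "w0 = H x0" using \<open>w0 \<in> C\<close> by (auto simp: C_def)
    have "\<exists>k M. (\<forall>w\<in>cyl X' M (H x0). G w \<in> cyl X n x \<and> H (\<beta> (G w)) \<in> cyl X' (M + k) (H (\<beta> x0)) \<and>
        (\<forall>j\<ge>M. w j = H (\<beta> (G w)) (j + k))) \<and>
      (\<forall>w'\<in>cyl X' (M + k) (H (\<beta> x0)). \<exists>w\<in>cyl X' M (H x0). H (\<beta> (G w)) = w')"
      by (rule local_holonomy[where x = x and y = y and n = n and m = m and d = d and \<beta> = \<beta>])
         (use x0(1) \<beta> surj x y d in \<open>auto simp: P_def Q_def\<close>)
    then show ?thesis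
      unfolding loc_def x0(2) BH[OF x0(1)] by (simp only: B_def P_def)
  qed
  then obtain k M where "\<And>w0. w0 \<in> C \<Longrightarrow> loc w0 (k w0) (M w0)" by metis
  then have kM: "\<And>w0 w. w0 \<in> C \<Longrightarrow> w \<in> cyl X' (M w0) w0 \<Longrightarrow> G w \<in> P"
    "\<And>w0 w. w0 \<in> C \<Longrightarrow> w \<in> cyl X' (M w0) w0 \<Longrightarrow> B w \<in> cyl X' (M w0 + k w0) (B w0)"
    "\<And>w0 w j. w0 \<in> C \<Longrightarrow> w \<in> cyl X' (M w0) w0 \<Longrightarrow> j \<ge> M w0 \<Longrightarrow> w j = B w (j + k w0)"
    "\<And>w0 w'. w0 \<in> C \<Longrightarrow> w' \<in> cyl X' (M w0 + k w0) (B w0) \<Longrightarrow> \<exists>w\<in>cyl X' (M w0) w0. B w = w'"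
    unfolding loc_def by blast+
  \<comment> \<open>Where the shift is constant, every finer cylinder is mapped onto a cylinder,
    with level raised by the shift and right tails unchanged.\<close>
  have step: "B ` cyl X' N w = cyl X' (N + k w0) (B w)"
      "follow N (cyl X' N w) = follow (N + k w0) (B ` cyl X' N w)"
    if w0: "w0 \<in> C" and w: "w \<in> cyl X' (M w0) w0" and N: "M w0 \<le> N" for w0 w N
  proof -
    have ww: "cyl X' (M w0) w = cyl X' (M w0) w0" by (rule cyl_eq[OF w])
    have in0: "w1 \<in> cyl X' (M w0) w0" if "w1 \<in> cyl X' N w" for w1
      using that cyl_antimono[OF N] unfolding ww[symmetric] by blast
    have Bw: "cyl X' (M w0 + k w0) (B w) = cyl X' (M w0 + k w0) (B w0)"
      by (rule cyl_eq[OF kM(2)[OF w0 w]])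
    show "B ` cyl X' N w = cyl X' (N + k w0) (B w)"
    proof (intro equalityI subsetI)
      fix v assume "v \<in> B ` cyl X' N w"
      then obtain w1 where w1: "w1 \<in> cyl X' N w" "v = B w1" by blast
      have b: "B w1 \<in> cyl X' (M w0 + k w0) (B w)" unfolding Bw by (rule kM(2)[OF w0 in0[OF w1(1)]])
      have "B w1 i = B w i" if "i < N + k w0" for i
      proof (cases "i < M w0 + k w0")
        case True
        then show ?thesis using b by (simp add: cyl_def)
      next
        case False
        then show ?thesis
          using kM(3)[OF w0 in0[OF w1(1)], of "i - k w0"] kM(3)[OF w0 w, of "i - k w0"] w1(1) that
          by (simp add: cyl_def)
      qed
      then show "v \<in> cyl X' (N + k w0) (B w)" using b w1(2) by (simp add: cyl_def)
    next
      fix v assume v: "v \<in> cyl X' (N + k w0) (B w)"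
      then have "v \<in> cyl X' (M w0 + k w0) (B w0)"
        unfolding Bw[symmetric] using cyl_antimono[of "M w0 + k w0" "N + k w0"] N by auto
      then obtain w1 where w1: "w1 \<in> cyl X' (M w0) w0" "B w1 = v" using kM(4)[OF w0] by blast
      have "w1 i = w i" if "i < N" for i
      proof (cases "i < M w0")
        case True
        then show ?thesis using w1(1) w by (simp add: cyl_def)
      next
        case False
        then show ?thesis
          using kM(3)[OF w0 w1(1), of i] kM(3)[OF w0 w, of i] w1(2) v that by (simp add: cyl_def)
      qed
      then have "w1 \<in> cyl X' N w" using w1(1) by (simp add: cyl_def)
      then show "v \<in> B ` cyl X' N w" using w1(2) by blast
    qed
    have "(\<lambda>t. w1 (N + int t)) = (\<lambda>t. B w1 (N + k w0 + int t))" if "w1 \<in> cyl X' N w" for w1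
      using kM(3)[OF w0 in0[OF that]] N by (auto simp: fun_eq_iff algebra_simps)
    then show "follow N (cyl X' N w) = follow (N + k w0) (B ` cyl X' N w)"
      unfolding follow_def image_image by (rule image_cong[OF refl])
  qed
  obtain Y where Y: "finite Y" "Y \<subseteq> P" "C \<subseteq> (\<Union>u\<in>Y. cyl X' (M (H u)) (H u))"
    using image_cover[OF x, of n M] unfolding P_def C_def by blast
  obtain m0 where m0: "resolved X' z' m0 C"
    using resolved_image[OF x] unfolding C_def P_def by blast
  \<comment> \<open>Fine enough to resolve \<open>C\<close> and to lie beyond the local level of
    every set of the finite cover.\<close>
  define N where "N = Max (insert m0 ((\<lambda>u. M (H u)) ` Y))"
  have N: "m0 \<le> N" "\<And>u. u \<in> Y \<Longrightarrow> M (H u) \<le> N"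
    unfolding N_def using Y(1) by (auto intro: Max_ge)
  have res: "resolved X' z' N C" using m0 N(1) by (rule X'.resolved_mono)
  then have fin: "finite (cyl X' N ` C)" and subC: "\<And>w. w \<in> C \<Longrightarrow> cyl X' N w \<subseteq> C"
    by (auto simp: resolved_def)
  have BT: "B w \<in> tail_class X' z'" if "w \<in> C" for w
    unfolding B_def using \<beta>(1)[OF GC[OF that]] QT H_in by blast
  have piece: "(\<exists>n. resolved X' z' n (B ` W)) \<and> Vol X' z' \<phi> (B ` W) = \<phi> (follow N W)"
    if W: "W \<in> cyl X' N ` C" for W
  proof -
    obtain w where w: "w \<in> C" "W = cyl X' N w" using W by blast
    then obtain u where u: "u \<in> Y" "w \<in> cyl X' (M (H u)) (H u)" using Y(3) by blast
    then have "H u \<in> C" using Y(2) by (auto simp: C_def)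
    note st = step[OF this u(2) N(2)[OF u(1)]]
    show ?thesis
      unfolding w(2) st(2) unfolding st(1)
      using X'.resolved_cyl[OF BT[OF w(1)]] X'.Vol_cyl[OF BT[OF w(1)] \<phi>] by blast
  qed
  have injB: "w1 = w2" if "w1 \<in> C" "w2 \<in> C" "B w1 = B w2" for w1 w2
  proof -
    have "\<beta> (G w1) = \<beta> (G w2)"
      using that \<beta>(1) GC QT GH unfolding B_def by (metis subsetD)
    then have "G w1 = G w2" using inj GC that by blast
    then show ?thesis using that CT HG by (metis subsetD)
  qed
  have "(\<Union>W\<in>cyl X' N ` C. B ` W) = B ` C"
    by (rule image_UN_cyl[symmetric]) (use CT tail_class_subset subC in blast)+
  also have "\<dots> = H ` Q"
    unfolding C_def image_image
  proof -
    have "(\<lambda>u. B (H u)) ` P = (\<lambda>u. H (\<beta> u)) ` P" by (rule image_cong[OF refl BH])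
    also have "\<dots> = H ` \<beta> ` P" by (simp add: image_image)
    also have "\<beta> ` P = Q" using \<beta>(1) surj by blast
    finally show "(\<lambda>u. B (H u)) ` P = H ` Q" .
  qed
  finally have "Vol X' z' \<phi> (H ` Q) = Vol X' z' \<phi> (\<Union>W\<in>cyl X' N ` C. B ` W)" by simp
  also have "\<dots> = (\<Prod>W\<in>cyl X' N ` C. Vol X' z' \<phi> (B ` W))"
  proof (rule X'.Vol_UN[OF fin _ _ \<phi>])
    fix V W assume VW: "V \<in> cyl X' N ` C" "W \<in> cyl X' N ` C" "V \<noteq> W"
    then have "V \<inter> W = {}" by (rule cyl_disjoint)
    moreover have "V \<subseteq> C" "W \<subseteq> C" using VW subC by auto
    ultimately show "B ` V \<inter> B ` W = {}" using injB by blast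
  qed (use piece in blast)
  also have "\<dots> = (\<Prod>W\<in>cyl X' N ` C. \<phi> (follow N W))"
    by (rule prod.cong[OF refl]) (use piece in blast)
  also have "\<dots> = Vol X' z' \<phi> C" unfolding X'.Vol_eq[OF res \<phi>] vol_def ..
  finally show ?thesis by (simp add: C_def P_def Q_def)
qed

text \<open>By \<open>Vol_holonomy\<close> the cylinder chosen to represent \<open>S\<close> is
  immaterial. The default 1 is the normalisation in \<open>cyl_measures\<close>.\<close>

definition pull :: "((nat \<Rightarrow> 'b) set \<Rightarrow> 'm::comm_monoid_mult) \<Rightarrow> (nat \<Rightarrow> 'a) set \<Rightarrow> 'm" where
  "pull \<phi> S = (if S \<in> follower_sets X z
     then Vol X' z' \<phi> (H ` (SOME V. \<exists>n x. x \<in> tail_class X z \<and> V = cyl X n x \<and> S = follow n V)) else 1)"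

lemma pull_follow:
  assumes x: "x \<in> tail_class X z" and \<phi>: "additive X' z' \<phi>"
  shows "pull \<phi> (follow n (cyl X n x)) = Vol X' z' \<phi> (H ` cyl X n x)"
proof -
  let ?S = "follow n (cyl X n x)"
  define V where "V = (SOME V. \<exists>n x. x \<in> tail_class X z \<and> V = cyl X n x \<and> ?S = follow n V)"
  have "\<exists>V n x. x \<in> tail_class X z \<and> V = cyl X n x \<and> ?S = follow n V" using x by blast
  then have "\<exists>n x. x \<in> tail_class X z \<and> V = cyl X n x \<and> ?S = follow n V"
    unfolding V_def by (rule someI_ex)
  then obtain m y where "y \<in> tail_class X z" "V = cyl X m y" "?S = follow m V" by blast
  moreover have "?S \<in> follower_sets X z" using x by (auto simp: follower_sets_def)
  ultimately show ?thesis
    using Vol_holonomy[OF _ x _ \<phi>, of y m n] unfolding pull_def V_def[symmetric] by simp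
qed

text \<open>Used twice: for a cylinder resolved one level further it yields additivity of
  \<open>pull \<phi>\<close>, and for the \<open>G\<close>-image of a cylinder it recovers
  \<open>\<phi>\<close> from \<open>pull \<phi>\<close>.\<close>

lemma Vol_image:
  assumes D: "resolved X z m D" and \<phi>: "additive X' z' \<phi>"
  shows "Vol X' z' \<phi> (H ` D) = (\<Prod>V\<in>cyl X m ` D. pull \<phi> (follow m V))"
proof -
  have D': "D \<subseteq> tail_class X z" "\<And>y. y \<in> D \<Longrightarrow> cyl X m y \<subseteq> D" "finite (cyl X m ` D)"
    using D by (auto simp: resolved_def)
  have "H ` D = (\<Union>V\<in>cyl X m ` D. H ` V)"
    by (rule image_UN_cyl[OF order_trans[OF D'(1) tail_class_subset] D'(2)])
  then have "Vol X' z' \<phi> (H ` D) = Vol X' z' \<phi> (\<Union>V\<in>cyl X m ` D. H ` V)" by simp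
  also have "\<dots> = (\<Prod>V\<in>cyl X m ` D. Vol X' z' \<phi> (H ` V))"
  proof (rule X'.Vol_UN[OF D'(3) _ _ \<phi>])
    fix V assume "V \<in> cyl X m ` D"
    then show "\<exists>n. resolved X' z' n (H ` V)" using resolved_image D'(1) by auto
  next
    fix V W assume VW: "V \<in> cyl X m ` D" "W \<in> cyl X m ` D" "V \<noteq> W"
    then have "V \<inter> W = {}" by (rule cyl_disjoint)
    moreover have "V \<subseteq> tail_class X z" "W \<subseteq> tail_class X z" using VW(1,2) D'(1,2) by auto
    moreover have "inj_on H (tail_class X z)" by (rule inj_on_inverseI[of _ G]) (rule GH)
    ultimately show "H ` V \<inter> H ` W = {}" by (metis image_empty inj_on_image_Int)
  qed
  also have "\<dots> = (\<Prod>V\<in>cyl X m ` D. pull \<phi> (follow m V))"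
    by (rule prod.cong[OF refl]) (use pull_follow[OF _ \<phi>] D'(1) in auto)
  finally show ?thesis .
qed

lemma pull_cyl_measures:
  assumes "\<phi> \<in> cyl_measures X' z' M"
  shows "pull \<phi> \<in> cyl_measures X z M"
proof -
  have \<phi>: "additive X' z' \<phi>" "\<And>S. \<phi> S ^ M = 1" using assms by (auto simp: cyl_measures_def)
  have "pull \<phi> (follow n (cyl X n x)) = (\<Prod>V\<in>cyl X (n + 1) ` cyl X n x. pull \<phi> (follow (n + 1) V))"
    if "x \<in> tail_class X z" for n x
    using pull_follow[OF that \<phi>(1)] Vol_image[OF X.resolved_Suc[OF X.resolved_cyl[OF that]] \<phi>(1)] by simp
  then have "additive X z (pull \<phi>)" by (simp add: additive_def)
  moreover have "pull \<phi> S ^ M = 1" for S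
    by (simp add: pull_def Vol_def vol_def prod_power_distrib \<phi>(2))
  ultimately show ?thesis by (simp add: cyl_measures_def pull_def)
qed

lemma inj_on_pull: "inj_on pull (cyl_measures X' z' M)"
proof (rule inj_onI, rule ext)
  fix \<phi> \<psi> S assume *: "\<phi> \<in> cyl_measures X' z' M" "\<psi> \<in> cyl_measures X' z' M" "pull \<phi> = pull \<psi>"
  interpret S: leaf_homeo \<Sigma>' X' \<Sigma> X z' z G H by (rule leaf_homeo_swap)
  show "\<phi> S = \<psi> S"
  proof (cases "S \<in> follower_sets X' z'")
    case True
    then obtain n w where w: "w \<in> tail_class X' z'" "S = follow n (cyl X' n w)"
      by (auto simp: follower_sets_def)
    obtain m where m: "resolved X z m (G ` cyl X' n w)" using S.resolved_image[OF w(1)] by blast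
    have "H ` G ` cyl X' n w = (\<lambda>v. v) ` cyl X' n w"
      unfolding image_image using HG cyl_subset_tail_class[OF w(1)] by (intro image_cong) auto
    then have "\<xi> S = (\<Prod>V\<in>cyl X m ` G ` cyl X' n w. pull \<xi> (follow m V))"
      if "\<xi> \<in> cyl_measures X' z' M" for \<xi>
      using that Vol_image[OF m, of \<xi>] X'.Vol_cyl[OF w(1), of \<xi> n] w(2)
      by (simp add: cyl_measures_def)
    then show ?thesis using * by metis
  qed (use * in \<open>auto simp: cyl_measures_def\<close>)
qed

lemma card_cyl_measures_le:
  assumes "finite (cyl_measures X z M)"
  shows "card (cyl_measures X' z' M) \<le> card (cyl_measures X z M)"
  by (rule card_inj_on_le[OF inj_on_pull _ assms]) (use pull_cyl_measures in blast)

end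

subsection \<open>The subshifts \<open>Z N\<close>\<close>

text \<open>After the last \<open>\<alpha>\<close>, the state \<open>StB m\<close> has read \<open>b\<^sup>m\<close>, the state \<open>StC j\<close> has read \<open>b\<^sup>j\<^sup>+\<^sup>kc\<^sup>k\<close> for some
  \<open>k \<ge> 1\<close>, and \<open>StD\<close> has read \<open>b\<^sup>mc\<^sup>k\<close> with \<open>k > m\<close>. In \<open>StF\<close> either \<open>cb\<close> has occurred since the last \<open>\<alpha>\<close> or
  there is no \<open>\<alpha>\<close> at all.\<close>

datatype state = StB nat | StC nat | StD | StF

text \<open>An \<open>\<alpha>\<close> resets the automaton even where it is forbidden: the state is
  defined along every sequence, and admissibility is tested separately by \<open>ok\<close>.\<close>

fun step :: "state \<Rightarrow> sym \<Rightarrow> state" where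
  "step s (Sym_alpha i) = StB 0"
| "step (StB m) Sym_b = StB (Suc m)"
| "step (StB 0) Sym_c = StD"
| "step (StB (Suc m)) Sym_c = StC m"
| "step (StC j) Sym_b = StF"
| "step (StC 0) Sym_c = StD"
| "step (StC (Suc j)) Sym_c = StC j"
| "step StD Sym_b = StF"
| "step StD Sym_c = StD"
| "step StF Sym_b = StF"
| "step StF Sym_c = StF"

text \<open>Whether an \<open>\<alpha>\<close> may come next: \<open>m\<close> and \<open>j\<close>
  count the surplus of \<open>b\<close> over \<open>c\<close> in the current block, which must be
  0.\<close>

fun ok :: "state \<Rightarrow> bool" where
  "ok (StB m) = (m = 0)"
| "ok (StC j) = (j = 0)"
| "ok StD = False"
| "ok StF = True"

fun is_alpha :: "sym \<Rightarrow> bool" where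
  "is_alpha (Sym_alpha i) = True"
| "is_alpha _ = False"

primrec run :: "state \<Rightarrow> (nat \<Rightarrow> sym) \<Rightarrow> nat \<Rightarrow> state" where
  "run s v 0 = s"
| "run s v (Suc k) = step (run s v k) (v k)"

lemma step_alpha: "is_alpha a \<Longrightarrow> step s a = StB 0"
  by (cases a) auto

lemma run_cong: "(\<And>i. i < k \<Longrightarrow> v i = w i) \<Longrightarrow> run s v k = run s w k"
  by (induction k) auto

definition run_after :: "(int \<Rightarrow> sym) \<Rightarrow> int \<Rightarrow> int \<Rightarrow> state" where
  "run_after y p n = run (StB 0) (\<lambda>k. y (p + 1 + int k)) (nat (n - p - 1))"

text \<open>A bi-infinite sequence has no initial state, so the run starts after some earlier
  \<open>\<alpha>\<close>; by the reset, all choices give the same state. Without an earlier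
  \<open>\<alpha>\<close> nothing restricts the next one, as in \<open>StF\<close>.\<close>

definition state_at :: "(int \<Rightarrow> sym) \<Rightarrow> int \<Rightarrow> state" where
  "state_at y n = (if \<exists>p<n. is_alpha (y p) then run_after y (SOME p. p < n \<and> is_alpha (y p)) n else StF)"

lemma run_after_base: "run_after y p (p + 1) = StB 0"
  by (simp add: run_after_def)

lemma run_after_Suc:
  assumes "p < n"
  shows "run_after y p (n + 1) = step (run_after y p n) (y n)"
proof -
  have "nat (n + 1 - p - 1) = Suc (nat (n - p - 1))" using assms by simp
  moreover have "p + 1 + int (nat (n - p - 1)) = n" using assms by simp
  ultimately show ?thesis by (simp add: run_after_def)
qed

lemma run_after_less:
  assumes "p < q" "is_alpha (y q)" "q < n"
  shows "run_after y p n = run_after y q n"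
proof -
  have "q + 1 \<le> n" using assms(3) by simp
  then show ?thesis
  proof (induction n rule: int_ge_induct)
    case base
    show ?case using run_after_Suc[OF assms(1), of y] assms(2) by (simp add: step_alpha run_after_base)
  next
    case (step n)
    then show ?case using run_after_Suc[of p n y] run_after_Suc[of q n y] assms(1) by simp
  qed
qed

lemma state_at_eq:
  assumes "p < n" "is_alpha (y p)"
  shows "state_at y n = run_after y p n"
proof -
  define q where "q = (SOME p. p < n \<and> is_alpha (y p))"
  have q: "q < n" "is_alpha (y q)"
    using someI[of "\<lambda>p. p < n \<and> is_alpha (y p)" p] assms by (auto simp: q_def)
  have "run_after y p n = run_after y q n"
  proof (cases p q rule: linorder_cases)
    case less
    then show ?thesis using q by (intro run_after_less)
  next
    case greater
    then show ?thesis using assms by (intro run_after_less[symmetric])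
  qed simp
  then show ?thesis using assms unfolding state_at_def q_def by auto
qed

lemma state_at_Suc: "state_at y (n + 1) = step (state_at y n) (y n)"
proof (cases "is_alpha (y n)")
  case True
  then show ?thesis using state_at_eq[of n "n + 1" y] by (simp add: run_after_base step_alpha)
next
  case na: False
  show ?thesis
  proof (cases "\<exists>p<n. is_alpha (y p)")
    case True
    then obtain p where p: "p < n" "is_alpha (y p)" by blast
    then show ?thesis using state_at_eq[of p "n + 1" y] state_at_eq[of p n y] run_after_Suc[of p n y] by simp
  next
    case False
    have "\<not> is_alpha (y p)" if "p < n + 1" for p
      using that na False by (cases "p = n") auto
    then have "\<not> (\<exists>p<n + 1. is_alpha (y p))" by blast
    then show ?thesis using False na by (cases "y n") (auto simp: state_at_def)
  qed
qed

lemma state_at_cong: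
  assumes "\<And>i. i < n \<Longrightarrow> x i = y i"
  shows "state_at x n = state_at y n"
proof (cases "\<exists>p<n. is_alpha (x p)")
  case True
  then obtain p where p: "p < n" "is_alpha (x p)" by blast
  then have "state_at x n = run_after x p n" "state_at y n = run_after y p n"
    using assms state_at_eq by auto
  moreover have "run_after x p n = run_after y p n"
    unfolding run_after_def using assms p(1) by (intro run_cong) auto
  ultimately show ?thesis by simp
next
  case False
  then have "\<not> (\<exists>p<n. is_alpha (y p))" using assms by auto
  then show ?thesis unfolding state_at_def by (simp only: False if_False)
qed

lemma run_state_at: "run (state_at y n) (\<lambda>k. y (n + int k)) k = state_at y (n + int k)"
proof (induction k)
  case (Suc k)
  have "n + int (Suc k) = n + int k + 1" by simp
  then show ?case using Suc state_at_Suc[of y "n + int k"] by (metis run.simps(2))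
qed simp

section \<open>Forbidden words in terms of states\<close>

definition block :: "(int \<Rightarrow> sym) \<Rightarrow> int \<Rightarrow> nat \<Rightarrow> nat \<Rightarrow> bool" where
  "block y p m k \<longleftrightarrow> is_alpha (y p) \<and> (\<forall>t<m. y (p + 1 + int t) = Sym_b) \<and>
     (\<forall>t<k. y (p + 1 + int m + int t) = Sym_c)"

lemma state_at_block:
  assumes "block y p m k"
  shows "state_at y (p + 1 + int m + int k) = (if k = 0 then StB m else if k \<le> m then StC (m - k) else StD)"
  using assms
proof (induction k)
  case 0
  have "m' \<le> m \<Longrightarrow> state_at y (p + 1 + int m') = StB m'" for m'
  proof (induction m')
    case 0
    show ?case using state_at_Suc[of y p] assms by (simp add: block_def step_alpha)
  next
    case (Suc m')
    then have "y (p + 1 + int m') = Sym_b" using assms by (simp add: block_def)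
    then show ?case using Suc state_at_Suc[of y "p + 1 + int m'"] by (simp add: algebra_simps)
  qed
  then show ?case by simp
next
  case (Suc k)
  then have "block y p m k" "y (p + 1 + int m + int k) = Sym_c" by (auto simp: block_def)
  then have "state_at y (p + 1 + int m + int (Suc k)) =
      step (if k = 0 then StB m else if k \<le> m then StC (m - k) else StD) Sym_c"
    using Suc.IH state_at_Suc[of y "p + 1 + int m + int k"] by (simp add: algebra_simps)
  then show ?case
    by (cases m; cases "m - k") (auto simp: Suc_diff_le)
qed

lemma block_if_state_at:
  "case state_at y n of
     StB m \<Rightarrow> block y (n - int m - 1) m 0
   | StC j \<Rightarrow> \<exists>k\<ge>1. block y (n - int (j + k) - int k - 1) (j + k) k
   | StD \<Rightarrow> \<exists>m k. m < k \<and> block y (n - int m - int k - 1) m k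
   | StF \<Rightarrow> True" (is "?P n")
proof (cases "\<exists>p<n. is_alpha (y p)")
  case True
  then obtain p where p: "p < n" "is_alpha (y p)" by blast
  have "p + 1 \<le> n" using p(1) by simp
  then show ?thesis
  proof (induction n rule: int_ge_induct)
    case base
    show ?case using state_at_eq[of p "p + 1" y] p(2) by (simp add: run_after_base block_def)
  next
    case (step n)
    have ext: "block y q m (Suc k)" if "block y q m k" "y (q + 1 + int m + int k) = Sym_c" for q m k
      using that by (auto simp: block_def less_Suc_eq)
    show ?case
    proof (cases "y n")
      case Sym_c
      show ?thesis
      proof (cases "state_at y n")
        case (StB m)
        then have b: "block y (n - int m - 1) m 0" using step.IH by simp
        have b': "block y (n - int m - 1) m (Suc 0)" using ext[OF b] Sym_c by simp
        show ?thesis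
        proof (cases m)
          case 0
          then have "\<exists>m k. m < k \<and> block y (n + 1 - int m - int k - 1) m k"
            using b' by (intro exI[of _ 0] exI[of _ "Suc 0"]) simp
          then show ?thesis using 0 StB Sym_c state_at_Suc[of y n] by simp
        next
          case (Suc i)
          then have "\<exists>k\<ge>1. block y (n + 1 - int (i + k) - int k - 1) (i + k) k"
            using b' by (intro exI[of _ "Suc 0"]) (simp add: algebra_simps)
          then show ?thesis using Suc StB Sym_c state_at_Suc[of y n] by simp
        qed
      next
        case (StC j)
        then obtain k where k: "k \<ge> 1" "block y (n - int (j + k) - int k - 1) (j + k) k"
          using step.IH by auto
        have b: "block y (n - int (j + k) - int k - 1) (j + k) (Suc k)" using ext[OF k(2)] Sym_c by simp
        show ?thesis
        proof (cases j)
          case 0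
          then have "\<exists>m k. m < k \<and> block y (n + 1 - int m - int k - 1) m k"
            using b by (intro exI[of _ k] exI[of _ "Suc k"]) simp
          then show ?thesis using 0 StC Sym_c state_at_Suc[of y n] by simp
        next
          case (Suc i)
          then show ?thesis using StC Sym_c state_at_Suc[of y n] b
            by (auto intro!: exI[of _ "Suc k"] simp: algebra_simps)
        qed
      next
        case StD
        then obtain m k where k: "m < k" "block y (n - int m - int k - 1) m k" using step.IH by auto
        have b: "block y (n - int m - int k - 1) m (Suc k)" using ext[OF k(2)] Sym_c by simp
        have "\<exists>m k. m < k \<and> block y (n + 1 - int m - int k - 1) m k"
          using b k(1) by (intro exI[of _ m] exI[of _ "Suc k"]) (simp add: algebra_simps)
        then show ?thesis using StD Sym_c state_at_Suc[of y n] by simp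
      next
        case StF
        then show ?thesis using Sym_c state_at_Suc[of y n] by simp
      qed
    next
      case Sym_b
      show ?thesis
      proof (cases "state_at y n")
        case (StB m)
        then have b: "block y (n - int m - 1) m 0" using step.IH by simp
        then have "block y (n - int m - 1) (Suc m) 0" using Sym_b by (auto simp: block_def less_Suc_eq)
        then show ?thesis using StB Sym_b state_at_Suc[of y n] by (simp add: algebra_simps)
      qed (use Sym_b state_at_Suc[of y n] in auto)
    next
      case (Sym_alpha i)
      then show ?thesis using state_at_Suc[of y n] by (simp add: block_def)
    qed
  qed
next
  case False
  then have "state_at y n = StF" unfolding state_at_def by (simp only: if_False)
  then show ?thesis by simp
qed

text \<open>Reduces forbidden words of unbounded length to a condition on the single state in which
  an \<open>\<alpha>\<close> is read; this is what makes \<open>Z_iff\<close> possible.\<close>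

lemma not_ok_state_at:
  "\<not> ok (state_at y n) \<longleftrightarrow> (\<exists>p m k. m \<noteq> k \<and> block y p m k \<and> n = p + 1 + int m + int k)"
proof
  assume "\<not> ok (state_at y n)"
  then show "\<exists>p m k. m \<noteq> k \<and> block y p m k \<and> n = p + 1 + int m + int k"
  proof (cases "state_at y n")
    case (StB m)
    then show ?thesis using block_if_state_at[of y n] \<open>\<not> ok (state_at y n)\<close>
      by (intro exI[of _ "n - int m - 1"] exI[of _ m] exI[of _ 0]) auto
  next
    case (StC j)
    then obtain k where "block y (n - int (j + k) - int k - 1) (j + k) k"
      using block_if_state_at[of y n] by auto
    then show ?thesis using StC \<open>\<not> ok (state_at y n)\<close>
      by (intro exI[of _ "n - int (j + k) - int k - 1"] exI[of _ "j + k"] exI[of _ k]) auto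
  next
    case StD
    then obtain m k where "m < k" "block y (n - int m - int k - 1) m k"
      using block_if_state_at[of y n] by auto
    then show ?thesis
      by (intro exI[of _ "n - int m - int k - 1"] exI[of _ m] exI[of _ k]) auto
  qed simp
next
  assume "\<exists>p m k. m \<noteq> k \<and> block y p m k \<and> n = p + 1 + int m + int k"
  then obtain p m k where "m \<noteq> k" "block y p m k" "n = p + 1 + int m + int k" by blast
  then show "\<not> ok (state_at y n)" using state_at_block[of y p m k] by (cases "k = 0") auto
qed

lemma contains_forbidden:
  "contains_word y ([Sym_alpha i] @ replicate m Sym_b @ replicate k Sym_c @ [Sym_alpha j]) \<longleftrightarrow>
     (\<exists>p. y p = Sym_alpha i \<and> block y p m k \<and> y (p + 1 + int m + int k) = Sym_alpha j)"
proof -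
  have app: "(\<forall>t<length (u @ v). y (p + int t) = (u @ v) ! t) \<longleftrightarrow>
      (\<forall>t<length u. y (p + int t) = u ! t) \<and> (\<forall>t<length v. y (p + int (length u) + int t) = v ! t)"
    for u v p
  proof safe
    fix t assume *: "\<forall>t<length (u @ v). y (p + int t) = (u @ v) ! t"
    { assume "t < length u" then show "y (p + int t) = u ! t" using *[rule_format, of t] by (simp add: nth_append) }
    { assume "t < length v" then show "y (p + int (length u) + int t) = v ! t"
        using *[rule_format, of "length u + t"] by (simp add: nth_append add.assoc) }
  next
    fix t assume *: "\<forall>t<length u. y (p + int t) = u ! t" "\<forall>t<length v. y (p + int (length u) + int t) = v ! t"
      "t < length (u @ v)"
    show "y (p + int t) = (u @ v) ! t"
    proof (cases "t < length u")
      case False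
      then show ?thesis using *(2)[rule_format, of "t - length u"] *(3) by (simp add: nth_append)
    qed (use * in \<open>simp add: nth_append\<close>)
  qed
  have "contains_word y ([Sym_alpha i] @ replicate m Sym_b @ replicate k Sym_c @ [Sym_alpha j]) \<longleftrightarrow>
    (\<exists>p. y p = Sym_alpha i \<and> (\<forall>t<m. y (p + 1 + int t) = Sym_b) \<and>
      (\<forall>t<k. y (p + 1 + int m + int t) = Sym_c) \<and> y (p + 1 + int m + int k) = Sym_alpha j)"
    unfolding contains_word_def app by simp
  then show ?thesis by (auto simp: block_def)
qed

lemma Z_iff:
  "y \<in> Z N \<longleftrightarrow> (\<forall>n. y n \<in> Z_alphabet N \<and> (is_alpha (y n) \<longrightarrow> ok (state_at y n)))"
proof -
  have "y \<in> Z N \<longleftrightarrow> (\<forall>n. y n \<in> Z_alphabet N) \<and>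
      \<not> (\<exists>i\<in>{1..N}. \<exists>j\<in>{1..N}. \<exists>m k. m \<noteq> k \<and>
        contains_word y ([Sym_alpha i] @ replicate m Sym_b @ replicate k Sym_c @ [Sym_alpha j]))"
    unfolding Z_def avoiding_shift_def full_shift_def Z_forbidden_def by blast
  also have "\<dots> \<longleftrightarrow> (\<forall>n. y n \<in> Z_alphabet N) \<and>
      \<not> (\<exists>p m k. m \<noteq> k \<and> block y p m k \<and> is_alpha (y (p + 1 + int m + int k)))"
  proof (intro conj_cong refl arg_cong[of _ _ Not])
    assume alph: "\<forall>n. y n \<in> Z_alphabet N"
    have al: "is_alpha (y p) \<longleftrightarrow> (\<exists>i\<in>{1..N}. y p = Sym_alpha i)" for p
      using alph[rule_format, of p] by (auto simp: Z_alphabet_def)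
    show "(\<exists>i\<in>{1..N}. \<exists>j\<in>{1..N}. \<exists>m k. m \<noteq> k \<and>
        contains_word y ([Sym_alpha i] @ replicate m Sym_b @ replicate k Sym_c @ [Sym_alpha j])) \<longleftrightarrow>
      (\<exists>p m k. m \<noteq> k \<and> block y p m k \<and> is_alpha (y (p + 1 + int m + int k)))"
      unfolding contains_forbidden
    proof
      assume "\<exists>p m k. m \<noteq> k \<and> block y p m k \<and> is_alpha (y (p + 1 + int m + int k))"
      then obtain p m k where p: "m \<noteq> k" "block y p m k" "is_alpha (y (p + 1 + int m + int k))" by blast
      then have "is_alpha (y p)" by (simp add: block_def)
      then obtain i j where "i \<in> {1..N}" "y p = Sym_alpha i" "j \<in> {1..N}"
        "y (p + 1 + int m + int k) = Sym_alpha j"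
        using al p(3) by metis
      then show "\<exists>i\<in>{1..N}. \<exists>j\<in>{1..N}. \<exists>m k. m \<noteq> k \<and>
        (\<exists>p. y p = Sym_alpha i \<and> block y p m k \<and> y (p + 1 + int m + int k) = Sym_alpha j)"
        using p(1,2) by blast
    next
      assume "\<exists>i\<in>{1..N}. \<exists>j\<in>{1..N}. \<exists>m k. m \<noteq> k \<and>
        (\<exists>p. y p = Sym_alpha i \<and> block y p m k \<and> y (p + 1 + int m + int k) = Sym_alpha j)"
      then show "\<exists>p m k. m \<noteq> k \<and> block y p m k \<and> is_alpha (y (p + 1 + int m + int k))"
        using al by blast
    qed
  qed
  also have "\<dots> \<longleftrightarrow> (\<forall>n. y n \<in> Z_alphabet N) \<and> (\<forall>n. is_alpha (y n) \<longrightarrow> ok (state_at y n))"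
  proof -
    have "(\<exists>p m k. m \<noteq> k \<and> block y p m k \<and> is_alpha (y (p + 1 + int m + int k))) \<longleftrightarrow>
        (\<exists>n. is_alpha (y n) \<and> \<not> ok (state_at y n))"
      unfolding not_ok_state_at by blast
    then show ?thesis by blast
  qed
  finally show ?thesis by blast
qed

section \<open>Follower sets of cylinders as states\<close>

definition accepted :: "nat \<Rightarrow> state \<Rightarrow> (nat \<Rightarrow> sym) set" where
  "accepted N s = {v. \<forall>k. v k \<in> Z_alphabet N \<and> (is_alpha (v k) \<longrightarrow> ok (run s v k))}"

text \<open>The past acts only through its state: the past of \<open>x\<close> glued to any right
  tail accepted from that state is again a point of \<open>Z N\<close>.\<close>

lemma follow_Z:
  assumes x: "x \<in> Z N"
  shows "follow n (cyl (Z N) n x) = accepted N (state_at x n)"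
proof (intro equalityI subsetI)
  fix v assume "v \<in> follow n (cyl (Z N) n x)"
  then obtain y where y: "y \<in> Z N" "\<And>i. i < n \<Longrightarrow> y i = x i" "v = (\<lambda>k. y (n + int k))"
    by (auto simp: follow_def cyl_def)
  have "state_at y n = state_at x n" using y(2) by (rule state_at_cong)
  then have "run (state_at x n) v k = state_at y (n + int k)" for k
    using run_state_at[of y n k] y(3) by simp
  then show "v \<in> accepted N (state_at x n)" using y(1) unfolding y(3) Z_iff accepted_def by auto
next
  fix v assume v: "v \<in> accepted N (state_at x n)"
  define y where "y i = (if i < n then x i else v (nat (i - n)))" for i
  have vy: "v = (\<lambda>k. y (n + int k))" by (auto simp: y_def)
  have st: "state_at y i = state_at x i" if "i \<le> n" for i
    using that by (intro state_at_cong) (simp add: y_def)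
  have "y i \<in> Z_alphabet N \<and> (is_alpha (y i) \<longrightarrow> ok (state_at y i))" for i
  proof (cases "i < n")
    case True
    then show ?thesis using x st[of i] unfolding Z_iff by (simp add: y_def)
  next
    case False
    then have i: "i = n + int (nat (i - n))" by simp
    have "state_at y i = run (state_at x n) v (nat (i - n))"
      using run_state_at[of y n "nat (i - n)"] st[of n] i vy by simp
    then show ?thesis using v False by (simp add: accepted_def y_def)
  qed
  then have "y \<in> Z N" unfolding Z_iff by blast
  then have "y \<in> cyl (Z N) n x" by (simp add: cyl_def y_def)
  then show "v \<in> follow n (cyl (Z N) n x)" unfolding follow_def using vy by blast
qed

definition letters :: "nat \<Rightarrow> state \<Rightarrow> sym set" where
  "letters N s = {a \<in> Z_alphabet N. is_alpha a \<longrightarrow> ok s}"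

lemma letter_realised:
  assumes x: "x \<in> Z N" and a: "a \<in> letters N (state_at x n)"
  obtains y where "y \<in> cyl (Z N) n x" "y n = a" "state_at y (n + 1) = step (state_at x n) a"
proof -
  \<comment> \<open>A tail of symbols \<open>b\<close> contains no \<open>\<alpha>\<close> and so
    imposes no further condition.\<close>
  define v where "v = (\<lambda>k::nat. if k = 0 then a else Sym_b)"
  have "v \<in> accepted N (state_at x n)"
    using a by (auto simp: accepted_def letters_def v_def Z_alphabet_def)
  then obtain y where y: "y \<in> cyl (Z N) n x" "v = (\<lambda>k. y (n + int k))"
    unfolding follow_Z[OF x, symmetric] follow_def by blast
  have "y n = a" using fun_cong[OF y(2), of 0] by (simp add: v_def)
  moreover have "state_at y n = state_at x n" using y(1) by (intro state_at_cong) (simp add: cyl_def)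
  ultimately show ?thesis using that y(1) state_at_Suc[of y n] by simp
qed

lemma letter_of_cyl:
  assumes "x \<in> Z N" "y \<in> cyl (Z N) n x"
  shows "y n \<in> letters N (state_at x n)"
proof -
  have "state_at y n = state_at x n" using assms(2) by (intro state_at_cong) (simp add: cyl_def)
  then show ?thesis using assms(2) by (auto simp: letters_def cyl_def Z_iff dest!: spec[of _ n])
qed

text \<open>Subcylinders of the next level correspond to admissible next letters. The
  \<open>N\<close> letters \<open>\<alpha>\<close> give distinct subcylinders with one and the same
  follower set, whence the \<open>N\<close>-th power in \<open>prod_letters\<close>.\<close>

lemma prod_children:
  fixes \<phi> :: "(nat \<Rightarrow> sym) set \<Rightarrow> complex"
  assumes x: "x \<in> Z N"
  shows "(\<Prod>V\<in>cyl (Z N) (n + 1) ` cyl (Z N) n x. \<phi> (follow (n + 1) V)) =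
    (\<Prod>a\<in>letters N (state_at x n). \<phi> (accepted N (step (state_at x n) a)))"
proof -
  have "\<forall>a\<in>letters N (state_at x n). \<exists>y. y \<in> cyl (Z N) n x \<and> y n = a \<and>
      state_at y (n + 1) = step (state_at x n) a"
    using letter_realised[OF x] by metis
  then obtain e where e: "\<And>a. a \<in> letters N (state_at x n) \<Longrightarrow> e a \<in> cyl (Z N) n x"
    "\<And>a. a \<in> letters N (state_at x n) \<Longrightarrow> e a n = a"
    "\<And>a. a \<in> letters N (state_at x n) \<Longrightarrow> state_at (e a) (n + 1) = step (state_at x n) a"
    by metis
  have eZ: "e a \<in> Z N" if "a \<in> letters N (state_at x n)" for a
    using e(1)[OF that] cyl_subset by blast
  have inj: "inj_on (\<lambda>a. cyl (Z N) (n + 1) (e a)) (letters N (state_at x n))"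
  proof (rule inj_onI)
    fix a b assume ab: "a \<in> letters N (state_at x n)" "b \<in> letters N (state_at x n)"
      "cyl (Z N) (n + 1) (e a) = cyl (Z N) (n + 1) (e b)"
    then have "e a \<in> cyl (Z N) (n + 1) (e b)" using cyl_self[OF eZ[OF ab(1)]] by blast
    then have "e a n = e b n" by (simp add: cyl_def)
    then show "a = b" using e(2) ab by simp
  qed
  have "cyl (Z N) (n + 1) ` cyl (Z N) n x = (\<lambda>a. cyl (Z N) (n + 1) (e a)) ` letters N (state_at x n)"
  proof (intro equalityI subsetI)
    fix V assume "V \<in> cyl (Z N) (n + 1) ` cyl (Z N) n x"
    then obtain y where y: "y \<in> cyl (Z N) n x" "V = cyl (Z N) (n + 1) y" by blast
    have l: "y n \<in> letters N (state_at x n)" by (rule letter_of_cyl[OF x y(1)])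
    have "y i = e (y n) i" if "i < n + 1" for i
    proof (cases "i = n")
      case True
      then show ?thesis using e(2)[OF l] by metis
    next
      case False
      then have "e (y n) i = x i" "y i = x i" using e(1)[OF l] y(1) that unfolding cyl_def by auto
      then show ?thesis by metis
    qed
    then have "y \<in> cyl (Z N) (n + 1) (e (y n))" using y(1) unfolding cyl_def by blast
    then have "V = cyl (Z N) (n + 1) (e (y n))" unfolding y(2) by (rule cyl_eq)
    then show "V \<in> (\<lambda>a. cyl (Z N) (n + 1) (e a)) ` letters N (state_at x n)" using l by blast
  qed (use e(1) in auto)
  then have "(\<Prod>V\<in>cyl (Z N) (n + 1) ` cyl (Z N) n x. \<phi> (follow (n + 1) V)) =
      (\<Prod>a\<in>letters N (state_at x n). \<phi> (follow (n + 1) (cyl (Z N) (n + 1) (e a))))"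
    using prod.reindex[OF inj] by simp
  also have "\<dots> = (\<Prod>a\<in>letters N (state_at x n). \<phi> (accepted N (step (state_at x n) a)))"
    using follow_Z[OF eZ] e(3) by (intro prod.cong) auto
  finally show ?thesis .
qed

lemma prod_letters:
  fixes f :: "state \<Rightarrow> complex"
  shows "(\<Prod>a\<in>letters N s. f (step s a)) =
    f (step s Sym_b) * f (step s Sym_c) * (if ok s then f (StB 0) ^ N else 1)"
proof -
  have l: "letters N s = {Sym_b, Sym_c} \<union> (if ok s then Sym_alpha ` {1..N} else {})"
    by (auto simp: letters_def Z_alphabet_def)
  have "(\<Prod>a\<in>Sym_alpha ` {1..N}. f (step s a)) = f (StB 0) ^ N"
    by (simp add: prod.reindex inj_on_def)
  moreover have "(\<Prod>a\<in>{Sym_b, Sym_c} \<union> Sym_alpha ` {1..N}. f (step s a)) =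
      (\<Prod>a\<in>{Sym_b, Sym_c}. f (step s a)) * (\<Prod>a\<in>Sym_alpha ` {1..N}. f (step s a))"
    by (rule prod.union_disjoint) auto
  ultimately show ?thesis unfolding l by simp
qed

section \<open>The measure equations on the states\<close>

definition reached :: "nat \<Rightarrow> (int \<Rightarrow> sym) \<Rightarrow> state set" where
  "reached N z = {state_at x n | x n. x \<in> tail_class (Z N) z}"

lemma reached_step:
  assumes "s \<in> reached N z" "a \<in> letters N s"
  shows "step s a \<in> reached N z"
proof -
  obtain x n where x: "x \<in> tail_class (Z N) z" "s = state_at x n" using assms(1) by (auto simp: reached_def)
  then have xZ: "x \<in> Z N" using tail_class_subset by blast
  obtain y where "y \<in> cyl (Z N) n x" "state_at y (n + 1) = step s a"
    using letter_realised[OF xZ, of a n] assms(2) x(2) by metis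
  moreover then have "y \<in> tail_class (Z N) z" using cyl_subset_tail_class[OF x(1)] by blast
  ultimately show ?thesis unfolding reached_def by (metis (mono_tags, lifting) mem_Collect_eq)
qed

text \<open>Reading \<open>cb\<close> leads from any state to \<open>StF\<close>, then an
  \<open>\<alpha>\<close> leads to \<open>StB 0\<close>, and the remaining states follow by reading
  \<open>b\<close> and \<open>c\<close>. Hence neither the follower sets nor the equations depend on
  \<open>z\<close>.\<close>

lemma reached_all:
  assumes z: "z \<in> Z N" and N: "N \<ge> 1"
  shows "reached N z = UNIV"
proof -
  have b: "step s Sym_b \<in> reached N z" and c: "step s Sym_c \<in> reached N z" if "s \<in> reached N z" for s
    using that by (intro reached_step; simp add: letters_def Z_alphabet_def)+
  have "z \<in> tail_class (Z N) z" using z by (auto simp: tail_class_def)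
  then obtain s where s: "s \<in> reached N z" by (auto simp: reached_def)
  have "step (step s Sym_c) Sym_b = StF"
    by (cases "(s, Sym_c)" rule: step.cases) auto
  then have F: "StF \<in> reached N z" using b[OF c[OF s]] by simp
  have "step StF (Sym_alpha 1) \<in> reached N z"
    using F N by (intro reached_step) (auto simp: letters_def Z_alphabet_def)
  then have B0: "StB 0 \<in> reached N z" by simp
  have B: "StB m \<in> reached N z" for m
    by (induction m) (use B0 b in force)+
  have C: "StC m \<in> reached N z" for m using c[OF B[of "Suc m"]] by simp
  have D: "StD \<in> reached N z" using c[OF B0] by simp
  show ?thesis using B C D F by (metis UNIV_eq_I state.exhaust)
qed

lemma follower_sets_Z:
  assumes "z \<in> Z N" "N \<ge> 1"
  shows "follower_sets (Z N) z = range (accepted N)"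
proof -
  have "follower_sets (Z N) z = accepted N ` reached N z"
    unfolding follower_sets_def reached_def using follow_Z tail_class_subset by blast
  then show ?thesis using reached_all[OF assms] by simp
qed

lemma additive_Z:
  fixes \<phi> :: "(nat \<Rightarrow> sym) set \<Rightarrow> complex"
  assumes "z \<in> Z N" "N \<ge> 1"
  shows "additive (Z N) z \<phi> \<longleftrightarrow> (\<forall>s. \<phi> (accepted N s) = \<phi> (accepted N (step s Sym_b)) *
    \<phi> (accepted N (step s Sym_c)) * (if ok s then \<phi> (accepted N (StB 0)) ^ N else 1))"
    (is "_ \<longleftrightarrow> (\<forall>s. ?P s)")
proof -
  have "\<phi> (follow n (cyl (Z N) n x)) = (\<Prod>V\<in>cyl (Z N) (n + 1) ` cyl (Z N) n x. \<phi> (follow (n + 1) V))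
      \<longleftrightarrow> ?P (state_at x n)" if "x \<in> tail_class (Z N) z" for n x
  proof -
    have x: "x \<in> Z N" using that tail_class_subset by blast
    show ?thesis unfolding prod_children[OF x] follow_Z[OF x]
      using prod_letters[of "\<lambda>s. \<phi> (accepted N s)" "state_at x n" N] by simp
  qed
  then have "additive (Z N) z \<phi> \<longleftrightarrow> (\<forall>s\<in>reached N z. ?P s)"
    unfolding additive_def reached_def by blast
  then show ?thesis using reached_all[OF assms] by simp
qed

lemma run_const_c: "run s (\<lambda>k. if k < n then Sym_c else v k) k = ((\<lambda>s. step s Sym_c) ^^ k) s" if "k \<le> n"
  using that by (induction k) auto

lemma c_power_StB: "((\<lambda>s. step s Sym_c) ^^ k) (StB m) = (if k = 0 then StB m else if k \<le> m then StC (m - k) else StD)"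
proof (induction k)
  case (Suc k)
  then show ?case by (cases m; cases "m - k") (auto simp: Suc_diff_le)
qed simp

lemma c_power_StC: "((\<lambda>s. step s Sym_c) ^^ k) (StC m) = (if k \<le> m then StC (m - k) else StD)"
proof (induction k)
  case (Suc k)
  then show ?case by (cases "m - k") (auto simp: Suc_diff_le)
qed simp

lemma c_power_StD: "((\<lambda>s. step s Sym_c) ^^ k) StD = StD"
  by (induction k) auto

lemma c_power_StF: "((\<lambda>s. step s Sym_c) ^^ k) StF = StF"
  by (induction k) auto

text \<open>Lets values on states be read as values on follower sets. The tail \<open>c^n\<close>
  followed by \<open>\<alpha>\<close> is accepted from \<open>StB m\<close> and \<open>StC m\<close>
  exactly for \<open>n = m\<close>, from \<open>StF\<close> always and from \<open>StD\<close>
  never; \<open>b\<close> followed by \<open>\<alpha>\<close> separates \<open>StC m\<close> from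
  \<open>StB m\<close>.\<close>

lemma inj_accepted:
  assumes N: "N \<ge> 1"
  shows "inj (accepted N)"
proof (rule injI)
  fix s t assume eq: "accepted N s = accepted N t"
  define v where "v n = (\<lambda>k. if k < n then Sym_c else if k = n then Sym_alpha 1 else Sym_b)" for n :: nat
  have v: "v n \<in> accepted N s \<longleftrightarrow> ok (((\<lambda>s. step s Sym_c) ^^ n) s)" for n s
  proof -
    have "run s (v n) n = ((\<lambda>s. step s Sym_c) ^^ n) s" unfolding v_def by (rule run_const_c) simp
    moreover have "is_alpha (v n k) \<longleftrightarrow> k = n" for k by (simp add: v_def)
    moreover have "v n k \<in> Z_alphabet N" for k using N by (simp add: v_def Z_alphabet_def)
    ultimately show ?thesis by (auto simp: accepted_def)
  qed
  define w where "w = (\<lambda>k :: nat. if k = 1 then Sym_alpha 1 else Sym_b)"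
  have w: "w \<in> accepted N s \<longleftrightarrow> ok (step s Sym_b)" for s
  proof -
    have "run s w 1 = step s Sym_b" by (simp add: w_def)
    moreover have "is_alpha (w k) \<longleftrightarrow> k = 1" for k by (simp add: w_def)
    moreover have "w k \<in> Z_alphabet N" for k using N by (simp add: w_def Z_alphabet_def)
    ultimately show ?thesis by (auto simp: accepted_def)
  qed
  have c: "ok (((\<lambda>s. step s Sym_c) ^^ n) s) \<longleftrightarrow> ok (((\<lambda>s. step s Sym_c) ^^ n) t)" for n
    using v eq by blast
  have b: "ok (step s Sym_b) \<longleftrightarrow> ok (step t Sym_b)" using w eq by blast
  have B: "ok (((\<lambda>s. step s Sym_c) ^^ n) (StB m)) \<longleftrightarrow> n = m" for n m by (auto simp: c_power_StB)
  have C: "ok (((\<lambda>s. step s Sym_c) ^^ n) (StC m)) \<longleftrightarrow> n = m" for n m by (auto simp: c_power_StC)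
  have D: "\<not> ok (((\<lambda>s. step s Sym_c) ^^ n) StD)" for n by (simp add: c_power_StD)
  have F: "ok (((\<lambda>s. step s Sym_c) ^^ n) StF)" for n by (simp add: c_power_StF)
  have inf: "\<not> (\<forall>n. n = m)" for m :: nat by (metis n_not_Suc_n)
  show "s = t"
    using c b inf by (cases s; cases t; simp add: B C D F; metis n_not_Suc_n)
qed

section \<open>Solving the measure equations\<close>

fun state_value :: "complex \<Rightarrow> complex \<Rightarrow> state \<Rightarrow> complex" where
  "state_value a d (StB m) = a / d ^ m"
| "state_value a d (StC j) = d"
| "state_value a d StD = d"
| "state_value a d StF = 1"

lemma state_value_equation:
  assumes "a ^ N = 1" "d \<noteq> 0"
  shows "state_value a d s = state_value a d (step s Sym_b) * state_value a d (step s Sym_c) *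
    (if ok s then state_value a d (StB 0) ^ N else 1)"
proof (cases s)
  case (StB m)
  then show ?thesis using assms by (cases m) auto
next
  case (StC j)
  then show ?thesis using assms by (cases j) auto
qed (use assms in auto)

lemma additive_Z_values:
  assumes z: "z \<in> Z N" and N: "N \<ge> 1" and add: "additive (Z N) z \<phi>" and nz: "\<And>S. \<phi> S \<noteq> 0"
  defines "a \<equiv> \<phi> (accepted N (StB 0))" and "d \<equiv> \<phi> (accepted N StD)"
  shows "a ^ N = 1" "\<phi> (accepted N s) = state_value a d s"
proof -
  define f where "f s = \<phi> (accepted N s)" for s
  have eq: "f s = f (step s Sym_b) * f (step s Sym_c) * (if ok s then a ^ N else 1)" for s
    using add additive_Z[OF z N, of \<phi>] unfolding f_def a_def by blast
  have f0: "f s \<noteq> 0" for s by (simp add: f_def nz)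
  have d: "d = f StD" "a = f (StB 0)" by (simp_all add: d_def a_def f_def)
  \<comment> \<open>\<open>StD\<close> goes to \<open>StF\<close> under \<open>b\<close> and to
    itself under \<open>c\<close>, so its own value cancels. The equation at \<open>StF\<close> then
    leaves \<open>a ^ N = 1\<close>.\<close>
  have F: "f StF = 1" using eq[of StD] f0[of StD] by simp
  show aN: "a ^ N = 1" using eq[of StF] F by simp
  have C: "f (StC j) = d" for j
  proof (induction j)
    case 0 show ?case using eq[of "StC 0"] F aN d by simp
  next
    case (Suc j) then show ?case using eq[of "StC (Suc j)"] F by simp
  qed
  have B: "f (StB m) = a / d ^ m" for m
  proof (induction m)
    case 0 show ?case by (simp add: d)
  next
    case (Suc m)
    \<comment> \<open>Reading \<open>c\<close> leads to \<open>StD\<close> for \<open>m = 0\<close>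
      and to \<open>StC (m - 1)\<close> otherwise, both of value \<open>d\<close>; the factor
      \<open>a ^ N\<close>, present only for \<open>m = 0\<close>, is 1.\<close>
    have "f (StB m) = f (StB (Suc m)) * d"
      using eq[of "StB m"] aN C d by (cases m) auto
    then show ?case using Suc f0[of StD] d(1) by (simp add: field_simps)
  qed
  show "\<phi> (accepted N s) = state_value a d s"
    unfolding f_def[symmetric] by (cases s) (simp_all only: B C F d(1)[symmetric] state_value.simps)
qed

text \<open>The free parameters are the values at \<open>StB 0\<close> and \<open>StD\<close>. The
  condition \<open>a ^ N = 1\<close> comes from the equation at \<open>StF\<close>, the exponents
  \<open>M\<close> from the value group.\<close>

lemma bij_betw_cyl_measures_Z:
  assumes z: "z \<in> Z N" and N: "N \<ge> 1" and M: "M \<ge> 1"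
  shows "bij_betw (\<lambda>\<phi>. (\<phi> (accepted N (StB 0)), \<phi> (accepted N StD))) (cyl_measures (Z N) z M)
    ({a. a ^ N = 1 \<and> a ^ M = 1} \<times> {d. d ^ M = 1})"
    (is "bij_betw ?r _ _")
proof -
  have nz: "(x :: complex) \<noteq> 0" if "x ^ M = 1" for x using that M by (auto simp: power_0_left)
  have cm: "additive (Z N) z \<phi>" "\<phi> S ^ M = 1" "\<phi> S \<noteq> 0" "S \<notin> range (accepted N) \<Longrightarrow> \<phi> S = 1"
    if "\<phi> \<in> cyl_measures (Z N) z M" for \<phi> S
    using that nz follower_sets_Z[OF z N] by (auto simp: cyl_measures_def)
  show ?thesis
  proof (rule bij_betwI')
    fix \<phi> \<psi> assume *: "\<phi> \<in> cyl_measures (Z N) z M" "\<psi> \<in> cyl_measures (Z N) z M"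
    show "?r \<phi> = ?r \<psi> \<longleftrightarrow> \<phi> = \<psi>"
    proof
      assume r: "?r \<phi> = ?r \<psi>"
      have "\<phi> S = \<psi> S" for S
      proof (cases "S \<in> range (accepted N)")
        case True
        then obtain s where "S = accepted N s" by blast
        then show ?thesis
          using r additive_Z_values(2)[OF z N cm(1)[OF *(1)] cm(3)[OF *(1)], of s]
            additive_Z_values(2)[OF z N cm(1)[OF *(2)] cm(3)[OF *(2)], of s] by simp
      next
        case False
        then show ?thesis using cm(4)[OF *(1)] cm(4)[OF *(2)] by simp
      qed
      then show "\<phi> = \<psi>" by (rule ext)
    qed simp
  next
    fix \<phi> assume *: "\<phi> \<in> cyl_measures (Z N) z M"
    show "?r \<phi> \<in> {a. a ^ N = 1 \<and> a ^ M = 1} \<times> {d. d ^ M = 1}"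
      using additive_Z_values(1)[OF z N cm(1)[OF *] cm(3)[OF *]] cm(2)[OF *] by simp
  next
    fix p :: "complex \<times> complex" assume "p \<in> {a. a ^ N = 1 \<and> a ^ M = 1} \<times> {d. d ^ M = 1}"
    then obtain a d where p: "p = (a, d)" and a: "a ^ N = 1" "a ^ M = 1" and d: "d ^ M = 1" by blast
    define \<phi> where "\<phi> S = (if S \<in> range (accepted N) then state_value a d (inv (accepted N) S) else 1)" for S
    have \<phi>: "\<phi> (accepted N s) = state_value a d s" for s
      by (simp add: \<phi>_def inv_f_f[OF inj_accepted[OF N]])
    have "additive (Z N) z \<phi>"
      unfolding additive_Z[OF z N] \<phi> using state_value_equation[OF a(1) nz[OF d]] by blast
    moreover have "state_value a d s ^ M = 1" for s
    proof (cases s)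
      case (StB m)
      have "(d ^ m) ^ M = (d ^ M) ^ m" by (metis mult.commute power_mult)
      then show ?thesis using StB a(2) d by (simp add: power_divide)
    qed (use d in simp_all)
    then have "\<phi> S ^ M = 1" for S by (simp add: \<phi>_def)
    ultimately have "\<phi> \<in> cyl_measures (Z N) z M"
      using follower_sets_Z[OF z N] by (simp add: cyl_measures_def \<phi>_def)
    moreover have "p = ?r \<phi>" by (simp add: p \<phi>)
    ultimately show "\<exists>\<phi>\<in>cyl_measures (Z N) z M. p = ?r \<phi>" by blast
  qed
qed

lemma card_roots_of_unity:
  assumes "n \<ge> 1"
  shows "finite {x :: complex. x ^ n = 1}" "card {x :: complex. x ^ n = 1} = n"
  using assms card_nth_roots[of 1 n] finite_nth_roots[of n 1] by auto

lemma cyl_measures_Z_card: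
  assumes "z \<in> Z N" "N \<ge> 1" "M \<ge> 1"
  shows "finite (cyl_measures (Z N) z M)"
    and "card (cyl_measures (Z N) z M) \<le> N * M"
    and "N = M \<Longrightarrow> card (cyl_measures (Z N) z M) = M * M"
proof -
  let ?A = "{a :: complex. a ^ N = 1 \<and> a ^ M = 1}" and ?D = "{d :: complex. d ^ M = 1}"
  note bij = bij_betw_cyl_measures_Z[OF assms]
  have fin: "finite ?A" "finite ?D"
    using card_roots_of_unity(1)[OF assms(2)] card_roots_of_unity(1)[OF assms(3)] by auto
  then show "finite (cyl_measures (Z N) z M)" using bij_betw_finite[OF bij] by simp
  have c: "card (cyl_measures (Z N) z M) = card ?A * M"
    using bij_betw_same_card[OF bij] card_roots_of_unity(2)[OF assms(3)] by (simp add: card_cartesian_product)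
  have "card ?A \<le> card {a :: complex. a ^ N = 1}"
    by (rule card_mono[OF card_roots_of_unity(1)[OF assms(2)]]) auto
  then show "card (cyl_measures (Z N) z M) \<le> N * M"
    using c card_roots_of_unity(2)[OF assms(2)] by simp
  show "card (cyl_measures (Z N) z M) = M * M" if "N = M"
    using c card_roots_of_unity(2)[OF assms(3)] that by simp
qed

subsection \<open>Comparison\<close>

lemma (in marked_flow_pair) leaf_holonomy:
  "leaf_holonomy \<Sigma> X \<Sigma>' X' z z' (leaf_image X X' h z') (leaf_image X' X g z)"
proof -
  interpret S: marked_flow_pair \<Sigma>' X' \<Sigma> X g h z' z "inv a" by (rule swap_marked)
  show ?thesis
    by unfold_locales
      (use H_lift(1) S.H_lift(1) leaf_image_inverse S.leaf_image_inverse H_continuous S.H_continuous H_holonomy in blast)+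
qed

lemma (in flow_pair) card_cyl_measures_le:
  assumes z: "z \<in> X" "left_aperiodic z"
  obtains z' where "z' \<in> X'"
    "finite (cyl_measures X z M) \<Longrightarrow> card (cyl_measures X' z' M) \<le> card (cyl_measures X z M)"
proof -
  obtain z' a where lift: "lifts X X' h z z' a" using lift_h[OF z(1)] by blast
  interpret marked_flow_pair \<Sigma> X \<Sigma>' X' h g z z' a
    using lift z(2) by unfold_locales
  interpret L: leaf_holonomy \<Sigma> X \<Sigma>' X' z z' H "leaf_image X' X g z" by (rule leaf_holonomy)
  show ?thesis using that lift L.card_cyl_measures_le by (auto simp: lifts_def)
qed

text \<open>The time change \<open>\<tau>\<close> is not given as onto; the lower bound on its
  increments, which rests on continuity of the inverse homeomorphism, makes it so.\<close>

lemma flow_equivalent_imp_flow_pair: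
  assumes X: "subshift_space \<Sigma> X" and X': "subshift_space \<Sigma>' X'" and fe: "flow_equivalent X X'"
  obtains h g where "flow_pair \<Sigma> X \<Sigma>' X' h g"
proof -
  interpret X: subshift_space \<Sigma> X by (rule X)
  interpret X': subshift_space \<Sigma>' X' by (rule X')
  obtain h where h: "homeomorphic_map (suspension X) (suspension X') h" "preserves_direction X h"
    using fe by (auto simp: flow_equivalent_def)
  then obtain g where g: "homeomorphic_maps (suspension X) (suspension X') h g"
    by (auto simp: homeomorphic_map_maps)
  interpret suspension_homeo \<Sigma> X \<Sigma>' X' h g
    using g by unfold_locales (auto simp: homeomorphic_maps_def)
  have lift: "\<exists>x' a. lifts X X' h x x' a" if x: "x \<in> X" for x
  proof -
    have p: "pt X x 0 \<in> topspace (suspension X)" using x by (auto simp: X.topspace_eq)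
    then have "h (pt X x 0) \<in> topspace (suspension X')"
      using cont_h by (auto simp: continuous_map_def)
    then obtain x' t where x': "x' \<in> X'" "h (pt X x 0) = pt X' x' t" by (auto simp: X'.topspace_eq)
    obtain \<tau> where \<tau>: "strict_mono \<tau>" "continuous_on UNIV \<tau>"
      "\<And>s. h (flow s (pt X x 0)) = flow (\<tau> s) (h (pt X x 0))"
      using h(2) p unfolding preserves_direction_def by blast
    define a where "a s = t + \<tau> s" for s
    have a: "strict_mono a" "continuous_on UNIV a"
      using \<tau>(1,2) by (auto simp: a_def strict_mono_def intro!: continuous_intros)
    have ha: "h (pt X x s) = pt X' x' (a s)" for s
      using \<tau>(3)[of s] by (simp add: X.flow_pt[OF x] x'(2) X'.flow_pt[OF x'(1)] a_def)
    obtain \<epsilon> where \<epsilon>: "\<epsilon> > 0" "\<And>x x' a s. x \<in> X \<Longrightarrow> x' \<in> X' \<Longrightarrow> strict_mono a \<Longrightarrow>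
        (\<And>s. h (pt X x s) = pt X' x' (a s)) \<Longrightarrow> a s + \<epsilon> \<le> a (s + 1/2)"
      by (rule time_increment[OF X X' cont_g gh]) blast+
    have "surj a" by (rule surj_time_change[OF a(2) \<epsilon>(1) \<epsilon>(2)[OF x x'(1) a(1) ha]])
    then show ?thesis using x x'(1) a ha by (auto simp: lifts_def)
  qed
  have "flow_pair \<Sigma> X \<Sigma>' X' h g"
    using lift lift_g_if_lift_h by unfold_locales blast+
  then show ?thesis by (rule that)
qed

text \<open>Distinct powers of two differ by at least half of the larger one, so a fixed nonzero
  difference bounds both.\<close>

lemma power2_close:
  assumes "(2::int) ^ k - 2 ^ l = d" "d \<noteq> 0"
  shows "2 ^ k \<le> 2 * \<bar>d\<bar>"
proof (cases "l < k")
  case True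
  then have "(2::int) ^ Suc l \<le> 2 ^ k" by (intro power_increasing) auto
  then show ?thesis using assms(1) by simp
next
  case False
  then have "k < l" using assms by (cases "k = l") auto
  then have "(2::int) ^ Suc k \<le> 2 ^ l" by (intro power_increasing) auto
  moreover have "(0::int) \<le> 2 ^ k" by simp
  ultimately show ?thesis using assms(1) by simp
qed

lemma left_aperiodic_point_Z:
  obtains z where "z \<in> Z N" "left_aperiodic z"
proof -
  \<comment> \<open>The gaps between occurrences of \<open>c\<close> grow to the left, which rules out a period.\<close>
  define z where "z i = (if \<exists>k::nat. i = - (2 ^ k) then Sym_c else Sym_b)" for i :: int
  \<comment> \<open>No \<open>\<alpha>\<close> occurs in \<open>z\<close>, so no forbidden word
    does.\<close>
  have "z \<in> Z N" unfolding Z_iff by (simp add: z_def Z_alphabet_def)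
  moreover have "left_aperiodic z"
    unfolding left_aperiodic_def
  proof (intro allI impI, rule ccontr)
    fix d n assume per: "\<forall>i<n. z i = z (i + d)" and d: "d \<noteq> 0"
    \<comment> \<open>Chosen so that \<open>- (2 ^ k)\<close> lies left of \<open>n\<close> and
      \<open>2 ^ k\<close> exceeds the bound \<open>2 * \<bar>d\<bar>\<close>.\<close>
    define k where "k = nat (\<bar>n\<bar> + 2 * \<bar>d\<bar>)"
    have "int k < 2 ^ k" using of_nat_less_two_power[of k] by simp
    then have k: "\<bar>n\<bar> + 2 * \<bar>d\<bar> < 2 ^ k" by (simp add: k_def)
    then have "z (- (2 ^ k)) = z (- (2 ^ k) + d)" using per by auto
    moreover have "z (- (2 ^ k)) = Sym_c" by (auto simp: z_def)
    ultimately obtain l :: nat where "- (2 ^ k) + d = - (2 ^ l)" by (auto simp: z_def split: if_splits)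
    then have "2 ^ k - 2 ^ l = d" by simp
    then show False using power2_close[OF _ d] k by fastforce
  qed
  ultimately show ?thesis by (rule that)
qed

text \<open>Taking the parameter \<open>M\<close> of the target as the order of the value group
  makes \<open>a ^ M = 1\<close> impose nothing new there, so the target count is the full
  \<open>M * M\<close>, for whatever leaf the equivalence selects.\<close>

lemma Z_flow_pair_le:
  assumes fp: "flow_pair (Z_alphabet K) (Z K) (Z_alphabet M) (Z M) h g" and "K \<ge> 1" "M \<ge> 1"
  shows "M \<le> K"
proof -
  obtain z where z: "z \<in> Z K" "left_aperiodic z" by (rule left_aperiodic_point_Z)
  obtain z' where z': "z' \<in> Z M"
    "finite (cyl_measures (Z K) z M) \<Longrightarrow> card (cyl_measures (Z M) z' M) \<le> card (cyl_measures (Z K) z M)"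
    by (rule flow_pair.card_cyl_measures_le[OF fp z]) blast
  have "M * M = card (cyl_measures (Z M) z' M)"
    using cyl_measures_Z_card(3)[OF z'(1)] assms by simp
  also have "\<dots> \<le> K * M"
    using z'(2) cyl_measures_Z_card(1,2)[OF z(1) \<open>K \<ge> 1\<close> \<open>M \<ge> 1\<close>] by linarith
  finally show ?thesis using \<open>M \<ge> 1\<close> by simp
qed

theorem proposition6p1:
  fixes N N' :: nat
  assumes "N \<ge> 1" and "N' \<ge> 1" and "N \<noteq> N'"
  shows "\<not> flow_equivalent (Z N) (Z N')"
proof
  assume "flow_equivalent (Z N) (Z N')"
  moreover have "subshift_space (Z_alphabet K) (Z K)" for K
    by (rule subshift_space.intro[OF subshift_Z])
  ultimately obtain h g where fp: "flow_pair (Z_alphabet N) (Z N) (Z_alphabet N') (Z N') h g"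
    using flow_equivalent_imp_flow_pair by metis
  show False
    using Z_flow_pair_le[OF fp assms(1,2)] Z_flow_pair_le[OF flow_pair.swap[OF fp] assms(2,1)] assms(3)
    by simp
qed

end
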